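(* Let $C_1,C_2\in\mathbb{C}$ be constants, let $\varphi(z)=C_1\operatorname{Ai}(-2^{-1/3}z)+C_2\operatorname{Bi}(-2^{-1/3}z)$ and, for $n\ge1$, $\tau_n(z)=\det\left(\frac{d^{j+k}}{dz^{j+k}}\varphi(z)\right)_{j,k=0,\ldots,n-1}$. Put $$K_n=\frac{2^{-\frac{3n^2}{4}-\frac n6}}{\pi^{n/2}},\qquad \psi_{n,r}(z)=(n-2r)\left(\frac{\sqrt2\,z^{3/2}}{3}+\frac{n\pi}{4}\right),$$ $$M_{n,r}=(-1)^{r(n-r)}2^{\frac52 r(n-r)}G(r+1)G(n-r+1),$$ where $G$ is the Barnes $G$-function. Then, as $z\to\infty$ with $z\in\mathbb{R}^+$, for every integer $s\ge1$, $$\tau_{2s}(z)=K_{2s}\,z^{-s^2}\left[\mathbf{B}_{2s,s}(z)+2\sum_{r=0}^{s-1}\Big(\mathbf{B}_{2s,r}(z)\cos\psi_{2s,r}(z)+\mathbf{D}_{2s,r}(z)\sin\psi_{2s,r}(z)\Big)\right],$$ $$\tau_{2s-1}(z)=2K_{2s-1}\,z^{-\frac{(2s-1)^2}{4}}\sum_{r=0}^{s-1}\Big(\mathbf{B}_{2s-1,r}(z)\cos\psi_{2s-1,r}(z)+\mathbf{D}_{2s-1,r}(z)\sin\psi_{2s-1,r}(z)\Big),$$ where the functions $\mathbf{B}_{n,r},\mathbf{D}_{n,r}$ have asymptotic expansions $$\mathbf{B}_{n,r}(z)\sim M_{n,r}\,z^{\frac32r(n-r)}\sum_{j=0}^\infty\frac{b_{n,r}^{(j)}}{z^{3j/2}},\qquad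 \mathbf{D}_{n,r}(z)\sim M_{n,r}\,z^{\frac32r(n-r)}\sum_{j=0}^\infty\frac{d_{n,r}^{(j)}}{z^{3j/2}}$$ with constants $b_{n,r}^{(j)},d_{n,r}^{(j)}$ (independent of $z$) and leading coefficients $$b_{n,r}^{(0)}=\sum_{p=0}^{\lfloor n/2\rfloor}(-1)^pC_1^{2p}C_2^{n-2p}\sum_{q=\max(0,2p-r)}^{\min(2p,n-r)}(-1)^q\binom{r}{2p-q}\binom{n-r}{q},$$ $$d_{n,r}^{(0)}=\sum_{p=0}^{\lceil n/2\rceil-1}(-1)^{p-1}C_1^{2p+1}C_2^{n-2p-1}\sum_{q=\max(0,2p+1-r)}^{\min(2p+1,n-r)}(-1)^q\binom{r}{2p+1-q}\binom{n-r}{q}.$$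
   Context: $\operatorname{Ai}$ and $\operatorname{Bi}$ are the standard Airy functions. At positive integers $n\ge1$ the Barnes function is $G(n)=\prod_{k=0}^{n-2}k!$ (so $G(1)=G(2)=1$). Powers of $z>0$ are positive. The symbol $\sim$ denotes an asymptotic expansion in the sense of Poincaré as $z\to+\infty$. The convention $C^0=1$ is used, also for $C=0$. *)

theory Defs
  imports
    "HOL-Analysis.Analysis"
    "HOL-Library.Landau_Symbols"
    "Jordan_Normal_Form.Determinant"
begin

text \<open>
  Maclaurin coefficients of the solution of \<open>w'' = z w\<close>, \<open>w 0 = w0\<close>, \<open>w' 0 = w1\<close>.
\<close>

fun airy_coeff :: "complex \<Rightarrow> complex \<Rightarrow> nat \<Rightarrow> complex" where
  "airy_coeff w0 w1 0 = w0"
| "airy_coeff w0 w1 (Suc 0) = w1"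
| "airy_coeff w0 w1 (Suc (Suc 0)) = 0"
| "airy_coeff w0 w1 (Suc (Suc (Suc n))) = airy_coeff w0 w1 n / of_nat ((n + 2) * (n + 3))"

definition airy_sol :: "complex \<Rightarrow> complex \<Rightarrow> complex \<Rightarrow> complex" where
  "airy_sol w0 w1 z = (\<Sum>n. airy_coeff w0 w1 n * z ^ n)"

text \<open>
  The standard normalisation is given by the values of the functions and of their derivatives at 0;
  see \<open>Ai_ode\<close>, \<open>Bi_ode\<close>, \<open>Ai_initial\<close>, \<open>Bi_initial\<close> below.
\<close>

definition Ai :: "complex \<Rightarrow> complex" where
  "Ai = airy_sol (of_real (3 powr (-2/3) / Gamma (2/3))) (of_real (- (3 powr (-1/3) / Gamma (1/3))))"

definition Bi :: "complex \<Rightarrow> complex" where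
  "Bi = airy_sol (of_real (3 powr (-1/6) / Gamma (2/3))) (of_real (3 powr (1/6) / Gamma (1/3)))"

lemma airy_coeff_bounded:
  assumes "\<rho> > 0"
  shows "\<exists>A. \<forall>n. norm (airy_coeff w0 w1 n) * \<rho> ^ n \<le> A"
proof -
  let ?c = "\<lambda>n. norm (airy_coeff w0 w1 n) * \<rho> ^ n"
  obtain N :: nat where N: "\<rho> ^ 3 \<le> real N"
    using real_arch_simple by blast
  define A where "A = (\<Sum>n<N+3. ?c n)"
  have "?c n \<le> A" for n
  proof (induction n rule: less_induct)
    case (less n)
    show ?case
    proof (cases "n < N + 3")
      case True
      then show ?thesis unfolding A_def
        by (intro member_le_sum) (use assms in auto)
    next
      case False
      define m where "m = n - 3"
      have n: "n = Suc (Suc (Suc m))" and mN: "m \<ge> N"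
        using False by (auto simp: m_def)
      have "real N \<le> real ((m + 2) * (m + 3))"
        using mN by (intro of_nat_mono) (simp add: algebra_simps)
      with N have le: "\<rho> ^ 3 \<le> real ((m + 2) * (m + 3))" by linarith
      have "?c n = ?c m * (\<rho> ^ 3 / real ((m + 2) * (m + 3)))"
        unfolding n by (simp add: norm_divide norm_mult power3_eq_cube field_simps del: of_nat_mult of_nat_add)
      also have "\<dots> \<le> ?c m * 1"
      proof (intro mult_left_mono)
        have "0 < real ((m + 2) * (m + 3))" by (simp only: of_nat_0_less_iff) simp
        with le show "\<rho> ^ 3 / real ((m + 2) * (m + 3)) \<le> 1"
          by (simp only: divide_le_eq_1_pos)
      qed (use assms in auto)
      also have "\<dots> \<le> A" using less[of m] n by simp
      finally show ?thesis .
    qed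
  qed
  then show ?thesis by blast
qed

lemma summable_airy_coeff: "summable (\<lambda>n. airy_coeff w0 w1 n * z ^ n)"
proof -
  obtain A where A: "\<And>n. norm (airy_coeff w0 w1 n) * (norm z + 1) ^ n \<le> A"
    using airy_coeff_bounded[of "norm z + 1" w0 w1] by (auto simp: add_nonneg_pos)
  have "summable (\<lambda>n. norm (airy_coeff w0 w1 n) * norm z ^ n)"
  proof (rule Abel_lemma)
    show "norm z < norm z + 1" by simp
  qed (use A in auto)
  then show ?thesis
    by (intro summable_norm_cancel[of "\<lambda>n. airy_coeff w0 w1 n * z ^ n"]) (simp add: norm_mult norm_power)
qed

lemma airy_coeff_diffs2:
  "diffs (diffs (airy_coeff w0 w1)) n = (case n of 0 \<Rightarrow> 0 | Suc m \<Rightarrow> airy_coeff w0 w1 m)"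
proof (cases n)
  case (Suc m)
  have "of_nat ((m + 2) * (m + 3)) \<noteq> (0 :: complex)"
    by (simp only: of_nat_eq_0_iff) simp
  then show ?thesis unfolding Suc diffs_def
    by (simp add: field_simps)
qed (simp add: diffs_def)

lemma has_field_derivative_airy_sol:
  "(airy_sol w0 w1 has_field_derivative (\<Sum>n. diffs (airy_coeff w0 w1) n * z ^ n)) (at z)"
  unfolding airy_sol_def[abs_def]
  by (rule termdiffs_strong_converges_everywhere) (rule summable_airy_coeff)

lemma deriv_airy_sol: "deriv (airy_sol w0 w1) = (\<lambda>z. \<Sum>n. diffs (airy_coeff w0 w1) n * z ^ n)"
  using has_field_derivative_airy_sol by (intro ext DERIV_imp_deriv)

lemma airy_sol_ode: "(deriv (airy_sol w0 w1) has_field_derivative z * airy_sol w0 w1 z) (at z)"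
proof -
  let ?d = "diffs (diffs (airy_coeff w0 w1))"
  have "(deriv (airy_sol w0 w1) has_field_derivative (\<Sum>n. ?d n * z ^ n)) (at z)"
    unfolding deriv_airy_sol
    by (rule termdiffs_strong_converges_everywhere)
       (rule termdiff_converges_all, rule summable_airy_coeff)
  moreover have "(\<lambda>n. ?d (Suc n) * z ^ Suc n) sums (z * airy_sol w0 w1 z)"
    using sums_mult[OF summable_sums[OF summable_airy_coeff[of w0 w1 z]], of z]
    by (simp add: airy_coeff_diffs2 airy_sol_def mult_ac)
  then have "(\<lambda>n. ?d n * z ^ n) sums (z * airy_sol w0 w1 z)"
    by (subst (asm) sums_Suc_iff) (simp add: airy_coeff_diffs2)
  ultimately show ?thesis by (simp add: sums_iff)
qed

lemma airy_sol_0: "airy_sol w0 w1 0 = w0"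
  by (simp add: airy_sol_def)

lemma deriv_airy_sol_0: "deriv (airy_sol w0 w1) 0 = w1"
  by (simp add: deriv_airy_sol diffs_def)

lemma Ai_ode: "(Ai has_field_derivative deriv Ai z) (at z)"
    "(deriv Ai has_field_derivative z * Ai z) (at z)"
  and Bi_ode: "(Bi has_field_derivative deriv Bi z) (at z)"
    "(deriv Bi has_field_derivative z * Bi z) (at z)"
  using has_field_derivative_airy_sol airy_sol_ode
  by (auto simp: Ai_def Bi_def deriv_airy_sol)

lemma Ai_initial: "Ai 0 = of_real (3 powr (-2/3) / Gamma (2/3))"
    "deriv Ai 0 = of_real (- (3 powr (-1/3) / Gamma (1/3)))"
  and Bi_initial: "Bi 0 = of_real (3 powr (-1/6) / Gamma (2/3))"
    "deriv Bi 0 = of_real (3 powr (1/6) / Gamma (1/3))"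
  unfolding Ai_def Bi_def by (rule airy_sol_0 deriv_airy_sol_0)+

definition airy_phi :: "complex \<Rightarrow> complex \<Rightarrow> complex \<Rightarrow> complex" where
  "airy_phi C1 C2 z =
     C1 * Ai (- of_real (2 powr (-1/3)) * z) + C2 * Bi (- of_real (2 powr (-1/3)) * z)"

text \<open>\<open>HOL-Analysis\<close> has a different, type-indexed \<open>det\<close>, hence the qualified names.\<close>

definition airy_tau :: "complex \<Rightarrow> complex \<Rightarrow> nat \<Rightarrow> complex \<Rightarrow> complex" where
  "airy_tau C1 C2 n z =
     Determinant.det (Matrix.mat n n (\<lambda>(j, k). (deriv ^^ (j + k)) (airy_phi C1 C2) z))"

text \<open>Only used at \<open>n \<ge> 1\<close>, where the product runs over \<open>0 \<le> k \<le> n - 2\<close>.\<close>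

definition barnes_G :: "nat \<Rightarrow> real" where
  "barnes_G n = (\<Prod>k<n - 1. fact k)"

definition K_const :: "nat \<Rightarrow> real" where
  "K_const n = 2 powr (- (3 * real n ^ 2 / 4) - real n / 6) / pi powr (real n / 2)"

definition psi :: "nat \<Rightarrow> nat \<Rightarrow> real \<Rightarrow> real" where
  "psi n r z = (real n - 2 * real r) * (sqrt 2 * z powr (3/2) / 3 + real n * pi / 4)"

definition M_const :: "nat \<Rightarrow> nat \<Rightarrow> real" where
  "M_const n r = (-1) ^ (r * (n - r)) * 2 powr (5/2 * real (r * (n - r)))
     * barnes_G (r + 1) * barnes_G (n - r + 1)"

text \<open>
  Truncated subtraction on \<^typ>\<open>nat\<close> makes \<open>2 * p - r\<close> the lower limit \<open>max 0 (2 * p - r)\<close>;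
  all other subtractions below are exact when \<open>r \<le> n\<close> and \<open>n \<ge> 1\<close>.
  In \<open>d_lead\<close> the sign \<open>(-1) ^ (p + 1)\<close> stands for \<open>(-1) ^ (p - 1)\<close>, and
  \<open>\<lceil>n/2\<rceil> = (n + 1) div 2\<close>.
\<close>

definition b_lead :: "complex \<Rightarrow> complex \<Rightarrow> nat \<Rightarrow> nat \<Rightarrow> complex" where
  "b_lead C1 C2 n r =
     (\<Sum>p = 0..n div 2. (-1) ^ p * C1 ^ (2 * p) * C2 ^ (n - 2 * p) *
        (\<Sum>q = 2 * p - r..min (2 * p) (n - r).
           (-1) ^ q * of_nat (r choose (2 * p - q)) * of_nat ((n - r) choose q)))"

definition d_lead :: "complex \<Rightarrow> complex \<Rightarrow> nat \<Rightarrow> nat \<Rightarrow> complex" where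
  "d_lead C1 C2 n r =
     (\<Sum>p = 0..(n + 1) div 2 - 1. (-1) ^ (p + 1) * C1 ^ (2 * p + 1) * C2 ^ (n - 2 * p - 1) *
        (\<Sum>q = 2 * p + 1 - r..min (2 * p + 1) (n - r).
           (-1) ^ q * of_nat (r choose (2 * p + 1 - q)) * of_nat ((n - r) choose q)))"

text \<open>
  \<open>f z \<sim> h z * (\<Sum>j. a j / z powr (3 * j / 2))\<close> as \<open>z\<close> tends to infinity through the positive
  reals, in the sense of Poincare: after any partial sum the remainder is of smaller order than
  the last scale function included. The series need not converge.
\<close>

definition poincare_expansion ::
    "(real \<Rightarrow> complex) \<Rightarrow> (real \<Rightarrow> complex) \<Rightarrow> (nat \<Rightarrow> complex) \<Rightarrow> bool" where
  "poincare_expansion f h a \<longleftrightarrow>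
     (\<forall>N. (\<lambda>z. f z - h z * (\<Sum>j\<le>N. a j / of_real (z powr (3 * real j / 2))))
        \<in> o[at_top](\<lambda>z. h z / of_real (z powr (3 * real N / 2))))"

end

theory Submission
  imports Defs "HOL-Probability.Probability" "HOL-Complex_Analysis.Complex_Analysis"
begin

text \<open>
  Write \<open>\<phi> = \<alpha> ((C\<^sub>2 - i C\<^sub>1) f\<^sub>+ + (C\<^sub>2 + i C\<^sub>1) f\<^sub>-)\<close>, where \<open>f\<^sub>+\<close> is the integral of \<open>exp (2t\<^sup>3/3 + zt)\<close> along a
  path from the direction \<open>arg t = \<pi>\<close> to \<open>arg t = \<pi>/3\<close>, and \<open>f\<^sub>-\<close> is its conjugate. Values at \<open>0\<close>
  are Gamma integrals over two rays, which identifies the Airy functions; the path can also be moved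
  to the line of slope \<open>\<pi>/6\<close> through the saddle point \<open>ib\<close>, \<open>b = \<surd>(z/2)\<close>, on which the cubic term is
  purely oscillatory. Derivatives of \<open>f\<^sub>\<plusminus>\<close> are moments \<open>\<integral> t\<^sup>m\<close>, and the moments centred at the saddle point,
  measured in units of \<open>b\<close>, are \<open>(2\<epsilon>)\<^sup>a\<close> times functions of \<open>\<epsilon> = (2z) powr (-3/4)\<close> that have
  asymptotic power series.

  The matrix of \<open>\<tau>\<^sub>n\<close> is therefore \<open>V H V\<^sup>T\<close> with a constant \<open>V\<close> (Taylor coefficients of the monomials
  at \<open>\<plusminus>i\<close>) and a matrix \<open>H\<close> consisting of two Hankel blocks. Expanding this product as in the
  Cauchy-Binet formula, a term that takes \<open>r\<close> rows from the second block carries a power of \<open>\<epsilon>\<close> which is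
  smallest only when the lowest \<open>n - r\<close> and \<open>r\<close> moments are selected. This exhibits all cancellations:
  the leading coefficient is the square of a confluent Vandermonde determinant times two Hankel
  determinants of Gaussian moments, and parity in \<open>\<epsilon>\<close> removes the odd powers.
\<close>

section \<open>Congruence expansion of two-block determinants\<close>

text \<open>At leading order the entries of the Hankel matrix are combinations of (ib)^(j+k) and
  (-ib)^(j+k), a matrix of rank at most two. Inserting the Airy asymptotics into the determinant
  therefore cancels to an order that grows quadratically in n, and the leading coefficient sits ever
  deeper in those expansions. Keeping the centred moments as exact functions of \<epsilon> until the
  cancellation is an explicit power avoids this. The least total degree of the moments is n(n-1)/2 -
  r(n-r), and its deficit r(n-r) is the source of the factor z^(3r(n-r)/2).

  The slope pi/6 is not that of steepest descent, which is pi/4. It makes the modulus of the scaled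
  integrand a Gaussian that does not depend on \<epsilon>, so Taylor remainders can be integrated
  over the whole line without separating tails, and \<epsilon> = 0 and negative \<epsilon> are
  admissible. The value at 0 is the leading coefficient, and reflection gives the parity. The
  missing angle pi/12 has to be turned only at \<epsilon> = 0. The parameter \<epsilon> itself is
  half the ratio of the width of the Gaussian to b.\<close>

abbreviation mat_det :: "nat \<Rightarrow> (nat \<times> nat \<Rightarrow> 'a::comm_ring_1) \<Rightarrow> 'a" where
  "mat_det n A \<equiv> Determinant.det (Matrix.mat n n A)"

lemma det_mat_eq_sum:
  "Determinant.det (Matrix.mat n n A) =
     (\<Sum>p | p permutes {0..<n}. signof p * (\<Prod>j = 0..<n. A (j, p j)))"
  by (subst det_def'[of _ n]) (auto intro!: sum.cong prod.cong simp: permutes_in_image)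

lemma det_mat_transpose:
  "mat_det n (\<lambda>(j, k). A k j) = mat_det n (\<lambda>(j, k). A j k)"
proof -
  have "Matrix.mat n n (\<lambda>(j, k). A k j) = transpose_mat (Matrix.mat n n (\<lambda>(j, k). A j k))"
    by (intro eq_matI) auto
  then show ?thesis by (simp add: det_transpose[of _ n])
qed

lemma det_expand_rows:
  fixes V :: "nat \<Rightarrow> 'r \<Rightarrow> 'a::comm_ring_1"
  assumes "finite R"
  shows "mat_det n (\<lambda>(j, k). \<Sum>\<rho>\<in>R. V j \<rho> * Q \<rho> k) =
    (\<Sum>f\<in>{0..<n} \<rightarrow>\<^sub>E R. (\<Prod>j = 0..<n. V j (f j)) * mat_det n (\<lambda>(j, k). Q (f j) k))"
proof -
  let ?S = "{p. p permutes {0..<n}}" and ?F = "{0..<n} \<rightarrow>\<^sub>E R"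
  have "mat_det n (\<lambda>(j, k). \<Sum>\<rho>\<in>R. V j \<rho> * Q \<rho> k) =
      (\<Sum>p\<in>?S. signof p * (\<Sum>f\<in>?F. \<Prod>j = 0..<n. V j (f j) * Q (f j) (p j)))"
    using assms by (simp add: det_mat_eq_sum prod_sum_PiE)
  also have "\<dots> = (\<Sum>f\<in>?F. \<Sum>p\<in>?S. (\<Prod>j = 0..<n. V j (f j)) * (signof p * (\<Prod>j = 0..<n. Q (f j) (p j))))"
    by (subst sum.swap) (simp add: sum_distrib_left prod.distrib mult_ac)
  finally show ?thesis by (simp add: det_mat_eq_sum sum_distrib_left)
qed

text \<open>A Cauchy-Binet expansion with a middle factor, summed over all maps \<open>f\<close> and
  \<open>g\<close> instead of increasing index sets. No order on the labels has to be chosen: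
  repeated labels contribute zero, and the n! orderings of one label set reassemble a minor of
  \<open>V\<close>.\<close>

lemma det_expand_congruence:
  fixes V :: "nat \<Rightarrow> 'r \<Rightarrow> 'a::comm_ring_1"
  assumes "finite R"
  shows "mat_det n (\<lambda>(j, k). \<Sum>\<rho>\<in>R. \<Sum>\<sigma>\<in>R. V j \<rho> * H \<rho> \<sigma> * V k \<sigma>) =
    (\<Sum>f\<in>{0..<n} \<rightarrow>\<^sub>E R. \<Sum>g\<in>{0..<n} \<rightarrow>\<^sub>E R. (\<Prod>j = 0..<n. V j (f j)) * (\<Prod>j = 0..<n. V j (g j)) *
       mat_det n (\<lambda>(j, k). H (f j) (g k)))"
proof -
  have "mat_det n (\<lambda>(j, k). \<Sum>\<rho>\<in>R. \<Sum>\<sigma>\<in>R. V j \<rho> * H \<rho> \<sigma> * V k \<sigma>) =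
     mat_det n (\<lambda>(j, k). \<Sum>\<rho>\<in>R. V j \<rho> * (\<Sum>\<sigma>\<in>R. H \<rho> \<sigma> * V k \<sigma>))"
    by (simp add: sum_distrib_left mult_ac)
  also have "\<dots> = (\<Sum>f\<in>{0..<n} \<rightarrow>\<^sub>E R. (\<Prod>j = 0..<n. V j (f j)) *
       mat_det n (\<lambda>(j, k). \<Sum>\<sigma>\<in>R. H (f j) \<sigma> * V k \<sigma>))"
    by (rule det_expand_rows) fact
  also have "\<dots> = (\<Sum>f\<in>{0..<n} \<rightarrow>\<^sub>E R. (\<Prod>j = 0..<n. V j (f j)) *
       (\<Sum>g\<in>{0..<n} \<rightarrow>\<^sub>E R. (\<Prod>j = 0..<n. V j (g j)) * mat_det n (\<lambda>(j, k). H (f j) (g k))))"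
  proof (rule sum.cong[OF refl])
    fix f
    have "mat_det n (\<lambda>(j, k). \<Sum>\<sigma>\<in>R. H (f j) \<sigma> * V k \<sigma>) =
       mat_det n (\<lambda>(j, k). \<Sum>\<sigma>\<in>R. V j \<sigma> * H (f k) \<sigma>)"
      by (subst det_mat_transpose[symmetric]) (simp add: mult_ac)
    also have "\<dots> = (\<Sum>g\<in>{0..<n} \<rightarrow>\<^sub>E R. (\<Prod>j = 0..<n. V j (g j)) *
         mat_det n (\<lambda>(j, k). H (f k) (g j)))"
      by (rule det_expand_rows) fact
    also have "\<dots> = (\<Sum>g\<in>{0..<n} \<rightarrow>\<^sub>E R. (\<Prod>j = 0..<n. V j (g j)) *
         mat_det n (\<lambda>(j, k). H (f j) (g k)))"
      by (subst det_mat_transpose) simp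
    finally show "(\<Prod>j = 0..<n. V j (f j)) *
          mat_det n (\<lambda>(j, k). \<Sum>\<sigma>\<in>R. H (f j) \<sigma> * V k \<sigma>) =
       (\<Prod>j = 0..<n. V j (f j)) * (\<Sum>g\<in>{0..<n} \<rightarrow>\<^sub>E R. (\<Prod>j = 0..<n. V j (g j)) *
         mat_det n (\<lambda>(j, k). H (f j) (g k)))"
      by simp
  qed
  finally show ?thesis by (simp add: sum_distrib_left mult_ac)
qed

lemma det_mat_noninj_rows:
  fixes H :: "'r \<Rightarrow> nat \<Rightarrow> 'a::comm_ring_1"
  assumes "\<not> inj_on f {0..<n}"
  shows "mat_det n (\<lambda>(j, k). H (f j) k) = 0"
proof -
  from assms obtain i j where "i < n" "j < n" "i \<noteq> j" "f i = f j"
    by (auto simp: inj_on_def)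
  then show ?thesis
    by (intro det_identical_rows[of _ n i j]) (auto intro!: eq_vecI)
qed

lemma det_mat_noninj_cols:
  fixes H :: "nat \<Rightarrow> 'r \<Rightarrow> 'a::comm_ring_1"
  assumes "\<not> inj_on f {0..<n}"
  shows "mat_det n (\<lambda>(j, k). H j (f k)) = 0"
  using det_mat_noninj_rows[OF assms, of "\<lambda>\<rho> k. H k \<rho>"]
  by (subst det_mat_transpose[symmetric]) simp

section \<open>Selections of rows from two Hankel blocks, and their degrees\<close>

definition num_true :: "nat \<Rightarrow> (nat \<Rightarrow> bool \<times> nat) \<Rightarrow> nat" where
  "num_true n f = card {j \<in> {0..<n}. fst (f j)}"

definition total_deg :: "nat \<Rightarrow> (nat \<Rightarrow> bool \<times> nat) \<Rightarrow> nat" where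
  "total_deg n f = (\<Sum>j = 0..<n. snd (f j))"

text \<open>For r \<le> n this is n(n-1)/2 - r(n-r).\<close>

definition min_deg :: "nat \<Rightarrow> nat \<Rightarrow> nat" where
  "min_deg n r = \<Sum>{0..<n - r} + \<Sum>{0..<r}"

definition selections :: "nat \<Rightarrow> nat \<Rightarrow> (nat \<Rightarrow> bool \<times> nat) set" where
  "selections n r = {f \<in> {0..<n} \<rightarrow>\<^sub>E (UNIV \<times> {..<n}). inj_on f {0..<n} \<and> num_true n f = r}"

definition block_det :: "(bool \<Rightarrow> nat \<Rightarrow> 'a::comm_ring_1) \<Rightarrow> nat \<Rightarrow> (nat \<Rightarrow> bool \<times> nat) \<Rightarrow> (nat \<Rightarrow> bool \<times> nat) \<Rightarrow> 'a" where
  "block_det h n f g = mat_det n (\<lambda>(j, k).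
     if fst (f j) = fst (g k) then h (fst (f j)) (snd (f j) + snd (g k)) else 0)"

lemma finite_selections [simp]: "finite (selections n r)"
  unfolding selections_def
  by (rule finite_subset[of _ "{0..<n} \<rightarrow>\<^sub>E (UNIV \<times> {..<n})"]) (auto intro: finite_PiE)

lemma num_true_le: "num_true n f \<le> n"
  unfolding num_true_def by (rule order.trans[OF card_mono[of "{0..<n}"]]) auto

text \<open>A nonzero Leibniz term needs a permutation that respects the block labels, and such a
  permutation carries the \<open>True\<close> rows of \<open>f\<close> bijectively to the
  \<open>True\<close> columns of \<open>g\<close>.\<close>

lemma block_det_eq_0:
  assumes "num_true n f \<noteq> num_true n g"
  shows "block_det h n f g = 0"
proof -
  have "(\<Prod>j = 0..<n. if fst (f j) = fst (g (p j)) then h (fst (f j)) (snd (f j) + snd (g (p j))) else 0) = 0"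
    if p: "p permutes {0..<n}" for p
  proof -
    have "\<exists>j\<in>{0..<n}. fst (f j) \<noteq> fst (g (p j))"
    proof (rule ccontr)
      assume "\<not> ?thesis"
      then have *: "\<And>j. j \<in> {0..<n} \<Longrightarrow> fst (f j) = fst (g (p j))" by blast
      have "bij_betw p {j \<in> {0..<n}. fst (f j)} {j \<in> {0..<n}. fst (g j)}"
      proof (rule bij_betw_imageI)
        show "inj_on p {j \<in> {0..<n}. fst (f j)}"
          using permutes_inj[OF p] by (auto intro: inj_on_subset)
        show "p ` {j \<in> {0..<n}. fst (f j)} = {j \<in> {0..<n}. fst (g j)}"
        proof (safe)
          fix j assume "j \<in> {0..<n}" "fst (f j)"
          then show "p j \<in> {0..<n}" "fst (g (p j))" using * permutes_in_image[OF p] by auto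
        next
          fix j assume j: "j \<in> {0..<n}" "fst (g j)"
          then have "j \<in> p ` {0..<n}" using permutes_image[OF p] by simp
          then obtain i where "i \<in> {0..<n}" "j = p i" by blast
          then show "j \<in> p ` {j \<in> {0..<n}. fst (f j)}" using * j by auto
        qed
      qed
      from bij_betw_same_card[OF this] show False using assms by (simp add: num_true_def)
    qed
    then show ?thesis by (auto intro!: prod_zero)
  qed
  then show ?thesis by (simp add: block_det_def det_mat_eq_sum)
qed

lemma block_det_noninj:
  assumes "\<not> inj_on f {0..<n} \<or> \<not> inj_on g {0..<n}"
  shows "block_det h n f g = 0"
  using assms
proof
  assume "\<not> inj_on f {0..<n}"
  from det_mat_noninj_rows[OF this, of "\<lambda>\<rho> k. if fst \<rho> = fst (g k) then h (fst \<rho>) (snd \<rho> + snd (g k)) else 0"]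
  show ?thesis by (simp add: block_det_def)
next
  assume "\<not> inj_on g {0..<n}"
  from det_mat_noninj_cols[OF this, of "\<lambda>j \<rho>. if fst (f j) = fst \<rho> then h (fst (f j)) (snd (f j) + snd \<rho>) else 0"]
  show ?thesis by (simp add: block_det_def)
qed

lemma prod_fst_eq_num_true:
  fixes X :: "bool \<Rightarrow> 'a::comm_monoid_mult"
  shows "(\<Prod>j = 0..<n. X (fst (f j))) = X False ^ (n - num_true n f) * X True ^ num_true n f"
proof -
  let ?A = "{j \<in> {0..<n}. fst (f j)}"
  have "(\<Prod>j = 0..<n. X (fst (f j))) = (\<Prod>j\<in>{0..<n} - ?A. X (fst (f j))) * (\<Prod>j\<in>?A. X (fst (f j)))"
    by (rule prod.subset_diff) auto
  also have "(\<Prod>j\<in>?A. X (fst (f j))) = (\<Prod>j\<in>?A. X True)"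
    by (intro prod.cong) auto
  also have "(\<Prod>j\<in>{0..<n} - ?A. X (fst (f j))) = (\<Prod>j\<in>{0..<n} - ?A. X False)"
    by (intro prod.cong) auto
  also have "card ({0..<n} - ?A) = n - card ?A"
    by (subst card_Diff_subset) auto
  ultimately show ?thesis by (simp add: num_true_def)
qed

text \<open>All Leibniz terms share one factor: a row supplies X and its power of t, a column its
  power of t, and a permutation only reorders the columns. With X = 1 and t = -1 the same identity
  yields the parity in \<open>reduced_det_parity\<close>.\<close>

lemma det_block_scaled:
  fixes X :: "bool \<Rightarrow> 'a::comm_ring_1"
  shows "mat_det n (\<lambda>(j, k). if fst (f j) = fst (g k)
      then X (fst (f j)) * t ^ (snd (f j) + snd (g k)) * h (fst (f j)) (snd (f j) + snd (g k)) else 0) =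
    X False ^ (n - num_true n f) * X True ^ num_true n f * t ^ (total_deg n f + total_deg n g) * block_det h n f g"
proof -
  have "(\<Prod>j = 0..<n. if fst (f j) = fst (g (p j))
      then X (fst (f j)) * t ^ (snd (f j) + snd (g (p j))) * h (fst (f j)) (snd (f j) + snd (g (p j))) else 0)
     = (\<Prod>j = 0..<n. X (fst (f j))) * t ^ (total_deg n f + total_deg n g) * (\<Prod>j = 0..<n. if fst (f j) = fst (g (p j))
      then h (fst (f j)) (snd (f j) + snd (g (p j))) else 0)" if p: "p permutes {0..<n}" for p
  proof -
    have "total_deg n g = (\<Sum>j = 0..<n. snd (g (p j)))"
      unfolding total_deg_def using sum.permute[OF p, of "\<lambda>j. snd (g j)"] by (simp add: o_def)
    then have "(\<Prod>j = 0..<n. X (fst (f j))) * t ^ (total_deg n f + total_deg n g) =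
        (\<Prod>j = 0..<n. X (fst (f j)) * t ^ (snd (f j) + snd (g (p j))))"
      by (simp add: total_deg_def power_add power_sum prod.distrib)
    then show ?thesis by (simp add: prod.distrib[symmetric] if_distrib mult_ac cong: if_cong)
  qed
  then show ?thesis
    by (simp add: block_det_def det_mat_eq_sum sum_distrib_left prod_fst_eq_num_true mult_ac)
qed

text \<open>The contribution of the selections with r labels \<open>True\<close>, after the common
  power t^(2 * min_deg n r) has been taken out. The subtraction in the exponent is exact because no
  selection has degree below \<open>min_deg n r\<close>; the quotient thus makes sense at t =
  0.\<close>

definition reduced_det ::
    "(nat \<Rightarrow> bool \<times> nat \<Rightarrow> 'a::comm_ring_1) \<Rightarrow> (bool \<Rightarrow> nat \<Rightarrow> 'a) \<Rightarrow> 'a \<Rightarrow> nat \<Rightarrow> nat \<Rightarrow> 'a" where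
  "reduced_det V h t n r = (\<Sum>f\<in>selections n r. \<Sum>g\<in>selections n r.
     (\<Prod>j = 0..<n. V j (f j)) * (\<Prod>j = 0..<n. V j (g j)) *
     t ^ (total_deg n f + total_deg n g - 2 * min_deg n r) * block_det h n f g)"

text \<open>Induction by removing the maximum, which is at least m in a set of m + 1 natural
  numbers. The case of equality decides which selections survive at t = 0.\<close>

lemma sum_lessThan_card_le:
  fixes A :: "nat set"
  assumes "finite A"
  shows "\<Sum>{0..<card A} \<le> \<Sum>A \<and> (\<Sum>A = \<Sum>{0..<card A} \<longrightarrow> A = {0..<card A})"
  using assms
proof (induction "card A" arbitrary: A)
  case 0
  then show ?case by simp
next
  case (Suc m)
  then have ne: "A \<noteq> {}" by auto
  let ?M = "Max A" and ?B = "A - {Max A}"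
  have M: "?M \<in> A" using ne Suc by simp
  have card: "card ?B = m" using Suc M by simp
  have "A \<subseteq> {0..?M}" using Suc by auto
  from card_mono[OF _ this] have ge: "m \<le> ?M" using Suc by simp
  have IH: "\<Sum>{0..<m} \<le> \<Sum>?B" "\<Sum>?B = \<Sum>{0..<m} \<Longrightarrow> ?B = {0..<m}"
    using Suc.hyps(1)[of ?B] Suc.prems card by auto
  have sum: "\<Sum>A = ?M + \<Sum>?B" using M Suc.prems by (simp add: sum.remove)
  have "A = {0..<Suc m}" if "\<Sum>A = \<Sum>{0..<Suc m}"
  proof -
    have "?M = m" "\<Sum>?B = \<Sum>{0..<m}" using that sum ge IH(1) by auto
    with IH(2) have "A = insert m {0..<m}" using M by auto
    then show ?thesis by auto
  qed
  moreover have "\<Sum>{0..<Suc m} \<le> \<Sum>A" using sum ge IH(1) by simp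
  ultimately show ?case using Suc.hyps(2) by simp
qed

text \<open>By injectivity the degrees taken from one block are pairwise distinct, so each block
  contributes at least 0 + 1 + 2 + ..., and equality forces initial segments in both blocks.\<close>

lemma selections_degree:
  assumes "f \<in> selections n r"
  shows "min_deg n r \<le> total_deg n f"
    and "total_deg n f = min_deg n r \<Longrightarrow>
      f ` {0..<n} = {False} \<times> {0..<n - r} \<union> {True} \<times> {0..<r}"
proof -
  let ?I = "\<lambda>s. {j \<in> {0..<n}. fst (f j) = s}"
  let ?A = "\<lambda>s. (\<lambda>j. snd (f j)) ` ?I s"
  have inj: "inj_on f {0..<n}" and r: "card (?I True) = r"
    using assms by (auto simp: selections_def num_true_def)
  have inj': "inj_on (\<lambda>j. snd (f j)) (?I s)" for s
    using inj by (auto simp: inj_on_def prod_eq_iff)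
  have "?I False = {0..<n} - ?I True" by auto
  moreover have "card ({0..<n} - ?I True) = n - r"
    unfolding r[symmetric] by (subst card_Diff_subset) (auto intro: finite_subset[of _ "{0..<n}"])
  ultimately have r': "card (?I False) = n - r" by simp
  have cards: "card (?A True) = r" "card (?A False) = n - r"
    using r r' card_image[OF inj', of True] card_image[OF inj', of False] by (simp_all only:)
  have tot: "total_deg n f = \<Sum>(?A False) + \<Sum>(?A True)"
  proof -
    have "total_deg n f = (\<Sum>j\<in>?I False \<union> ?I True. snd (f j))"
      unfolding total_deg_def by (intro sum.cong) auto
    also have "\<dots> = (\<Sum>j\<in>?I False. snd (f j)) + (\<Sum>j\<in>?I True. snd (f j))"
      by (intro sum.union_disjoint) auto
    also have "\<dots> = \<Sum>(?A False) + \<Sum>(?A True)"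
      using sum.reindex[OF inj', of "\<lambda>x. x" False] sum.reindex[OF inj', of "\<lambda>x. x" True]
      by (simp only: o_def)
    finally show ?thesis .
  qed
  note F = sum_lessThan_card_le[of "?A False", unfolded cards]
  note T = sum_lessThan_card_le[of "?A True", unfolded cards]
  show "min_deg n r \<le> total_deg n f" using F T tot by (simp add: min_deg_def)
  assume "total_deg n f = min_deg n r"
  then have eq: "?A False = {0..<n - r}" "?A True = {0..<r}"
    using F T tot by (auto simp: min_deg_def)
  have "f ` {0..<n} = (\<Union>s. f ` ?I s)" by (subst image_UN[symmetric]) (rule arg_cong, auto)
  also have "\<dots> = (\<Union>s. {s} \<times> ?A s)"
  proof (intro SUP_cong refl)
    fix s
    have "f ` ?I s = (\<lambda>j. (s, snd (f j))) ` ?I s" by (intro image_cong) (auto simp: prod_eq_iff)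
    moreover have "(\<lambda>j. (s, snd (f j))) ` B = {s} \<times> (\<lambda>j. snd (f j)) ` B" for B by auto
    ultimately show "f ` ?I s = {s} \<times> ?A s" by (simp only:)
  qed
  finally have "f ` {0..<n} = {False} \<times> ?A False \<union> {True} \<times> ?A True"
    by (simp add: UNIV_bool)
  then show "f ` {0..<n} = {False} \<times> {0..<n - r} \<union> {True} \<times> {0..<r}" using eq by simp
qed

text \<open>Only pairs of injective \<open>f\<close> and \<open>g\<close> with the same number r of
  \<open>True\<close> labels remain, and the factors of X depend on r alone; hence the grouping by
  r.\<close>

theorem det_two_block_congruence:
  fixes V :: "nat \<Rightarrow> bool \<times> nat \<Rightarrow> 'a::comm_ring_1"
  assumes H: "\<And>s a s' a'. H (s, a) (s', a') = (if s = s' then X s * t ^ (a + a') * h s (a + a') else 0)"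
  shows "mat_det n (\<lambda>(j, k). \<Sum>\<rho>\<in>UNIV \<times> {..<n}. \<Sum>\<sigma>\<in>UNIV \<times> {..<n}. V j \<rho> * H \<rho> \<sigma> * V k \<sigma>) =
    (\<Sum>r\<le>n. X False ^ (n - r) * X True ^ r * t ^ (2 * min_deg n r) * reduced_det V h t n r)"
proof -
  define R where "R = (UNIV :: bool set) \<times> {..<n}"
  let ?F = "{0..<n} \<rightarrow>\<^sub>E R"
  let ?G = "{f\<in>?F. inj_on f {0..<n}}"
  define c where "c f g = (\<Prod>j = 0..<n. V j (f j)) * (\<Prod>j = 0..<n. V j (g j)) *
     (X False ^ (n - num_true n f) * X True ^ num_true n f * t ^ (total_deg n f + total_deg n g) * block_det h n f g)" for f g
  have fin: "finite ?F" by (auto simp: R_def intro!: finite_PiE)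
  have "H \<rho> \<sigma> = (if fst \<rho> = fst \<sigma>
      then X (fst \<rho>) * t ^ (snd \<rho> + snd \<sigma>) * h (fst \<rho>) (snd \<rho> + snd \<sigma>) else 0)" for \<rho> \<sigma>
    using H[of "fst \<rho>" "snd \<rho>" "fst \<sigma>" "snd \<sigma>"] by simp
  then have "mat_det n (\<lambda>(j, k). \<Sum>\<rho>\<in>R. \<Sum>\<sigma>\<in>R. V j \<rho> * H \<rho> \<sigma> * V k \<sigma>) =
     (\<Sum>f\<in>?F. \<Sum>g\<in>?F. c f g)"
    by (subst det_expand_congruence) (simp_all add: R_def c_def det_block_scaled)
  also have "\<dots> = (\<Sum>f\<in>?G. \<Sum>g\<in>?F. c f g)"
    using fin by (intro sum.mono_neutral_right) (auto simp: c_def block_det_noninj)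
  also have "\<dots> = (\<Sum>r\<le>n. \<Sum>f\<in>{f\<in>?G. num_true n f = r}. \<Sum>g\<in>?F. c f g)"
    by (rule sum.group[symmetric]) (use fin num_true_le in auto)
  also have "\<dots> = (\<Sum>r\<le>n. \<Sum>f\<in>selections n r. \<Sum>g\<in>?F. c f g)"
    by (intro sum.cong) (auto simp: selections_def R_def)
  also have "\<dots> = (\<Sum>r\<le>n. \<Sum>f\<in>selections n r. \<Sum>g\<in>selections n r. c f g)"
  proof (rule sum.cong[OF refl], rule sum.cong[OF refl])
    fix r f assume f: "f \<in> selections n r"
    show "(\<Sum>g\<in>?F. c f g) = (\<Sum>g\<in>selections n r. c f g)"
    proof (rule sum.mono_neutral_right)
      show "\<forall>g\<in>?F - selections n r. c f g = 0"
      proof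
        fix g assume "g \<in> ?F - selections n r"
        then have "\<not> inj_on g {0..<n} \<or> num_true n f \<noteq> num_true n g"
          using f by (auto simp: selections_def R_def)
        then have "block_det h n f g = 0" using block_det_noninj block_det_eq_0 by blast
        then show "c f g = 0" by (simp add: c_def)
      qed
    qed (use fin in \<open>auto simp: selections_def R_def\<close>)
  qed
  also have "\<dots> = (\<Sum>r\<le>n. X False ^ (n - r) * X True ^ r * t ^ (2 * min_deg n r) * reduced_det V h t n r)"
  proof (rule sum.cong[OF refl])
    fix r
    have "c f g = X False ^ (n - r) * X True ^ r * t ^ (2 * min_deg n r) * ((\<Prod>j = 0..<n. V j (f j)) * (\<Prod>j = 0..<n. V j (g j)) *
     t ^ (total_deg n f + total_deg n g - 2 * min_deg n r) * block_det h n f g)"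
      if "f \<in> selections n r" "g \<in> selections n r" for f g
    proof -
      have "total_deg n f + total_deg n g = 2 * min_deg n r + (total_deg n f + total_deg n g - 2 * min_deg n r)"
        using selections_degree(1)[OF that(1)] selections_degree(1)[OF that(2)] by simp
      then have "t ^ (total_deg n f + total_deg n g) = t ^ (2 * min_deg n r) * t ^ (total_deg n f + total_deg n g - 2 * min_deg n r)"
        by (metis power_add)
      then show ?thesis using that by (simp add: c_def selections_def mult_ac)
    qed
    then show "(\<Sum>f\<in>selections n r. \<Sum>g\<in>selections n r. c f g) = 
       X False ^ (n - r) * X True ^ r * t ^ (2 * min_deg n r) * reduced_det V h t n r"
      unfolding reduced_det_def sum_distrib_left by (intro sum.cong refl) auto
  qed
  finally show ?thesis by (simp only: R_def)
qed


text \<open>Lists the lowest n - r labels of the first block and then the lowest r of the second.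
  The value \<open>undefined\<close> from n on keeps the map in the extensional function space that
  \<open>selections\<close> uses.\<close>

definition std_sel :: "nat \<Rightarrow> nat \<Rightarrow> nat \<Rightarrow> bool \<times> nat" where
  "std_sel n r j = (if j < n - r then (False, j) else if j < n then (True, j - (n - r)) else undefined)"

lemma std_sel_inj: "r \<le> n \<Longrightarrow> inj_on (std_sel n r) {0..<n}"
  by (auto simp: inj_on_def std_sel_def split: if_splits)

lemma std_sel_image:
  assumes "r \<le> n"
  shows "std_sel n r ` {0..<n} = {False} \<times> {0..<n - r} \<union> {True} \<times> {0..<r}"
proof (intro equalityI subsetI)
  fix x assume "x \<in> std_sel n r ` {0..<n}"
  then show "x \<in> {False} \<times> {0..<n - r} \<union> {True} \<times> {0..<r}"
    using assms by (auto simp: std_sel_def split: if_splits)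
next
  fix x assume x: "x \<in> {False} \<times> {0..<n - r} \<union> {True} \<times> {0..<r}"
  define j where "j = (if fst x then snd x + (n - r) else snd x)"
  have "x = std_sel n r j" "j < n" using x assms by (auto simp: std_sel_def j_def)
  then show "x \<in> std_sel n r ` {0..<n}" by auto
qed

lemma num_true_comp_permutes:
  assumes "p permutes {0..<n}"
  shows "num_true n (f \<circ> p) = num_true n f"
proof -
  have "num_true n g = (\<Sum>j = 0..<n. if fst (g j) then 1 else 0)" for g
    unfolding num_true_def by (subst sum.If_cases) (auto intro!: arg_cong[of _ _ card])
  then show ?thesis
    using sum.permute[OF assms, of "\<lambda>j. if fst (f j) then 1 else (0::nat)"] by (simp add: o_def)
qed

lemma total_deg_comp_permutes:
  assumes "p permutes {0..<n}"
  shows "total_deg n (f \<circ> p) = total_deg n f"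
  unfolding total_deg_def using sum.permute[OF assms, of "\<lambda>j. snd (f j)"] by (simp add: o_def)

lemma std_sel_selections:
  assumes "r \<le> n"
  shows "std_sel n r \<in> selections n r" "total_deg n (std_sel n r) = min_deg n r"
proof -
  have "{j \<in> {0..<n}. fst (std_sel n r j)} = {n - r..<n}"
    by (auto simp: std_sel_def split: if_splits)
  then have "num_true n (std_sel n r) = r" using assms by (simp add: num_true_def)
  moreover have "std_sel n r \<in> {0..<n} \<rightarrow>\<^sub>E UNIV \<times> {..<n}"
    by (auto simp: std_sel_def PiE_def extensional_def)
  ultimately show "std_sel n r \<in> selections n r"
    using std_sel_inj[OF assms] by (simp add: selections_def)
  have "total_deg n (std_sel n r) = (\<Sum>x\<in>std_sel n r ` {0..<n}. snd x)"
    unfolding total_deg_def by (subst sum.reindex[OF std_sel_inj[OF assms]]) simp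
  also have "\<dots> = (\<Sum>x\<in>{False} \<times> {0..<n - r}. snd x) + (\<Sum>x\<in>{True} \<times> {0..<r}. snd x)"
    unfolding std_sel_image[OF assms] by (rule sum.union_disjoint) auto
  also have "\<dots> = min_deg n r"
    unfolding min_deg_def by (simp add: sum.cartesian_product' flip: sum.cartesian_product)
  finally show "total_deg n (std_sel n r) = min_deg n r" .
qed

text \<open>Minimal degree fixes the image of a selection, so only the order in which its labels are
  listed is free.\<close>

lemma minimal_selections:
  assumes "r \<le> n"
  shows "{f \<in> selections n r. total_deg n f = min_deg n r} = (\<lambda>p. std_sel n r \<circ> p) ` {p. p permutes {0..<n}}"
proof (intro equalityI subsetI)
  fix f assume f: "f \<in> {f \<in> selections n r. total_deg n f = min_deg n r}"
  have im: "f ` {0..<n} = std_sel n r ` {0..<n}"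
    using selections_degree(2)[of f n r] f std_sel_image[OF assms] by auto
  have inj: "inj_on f {0..<n}" and ext: "\<And>j. j \<notin> {0..<n} \<Longrightarrow> f j = undefined"
    using f by (auto simp: selections_def PiE_def extensional_def)
  \<comment> \<open>The permutation has to be the identity from n on; there \<open>f\<close> and
    \<open>std_sel n r\<close> agree because both are \<open>undefined\<close>.\<close>
  define p where "p j = (if j < n then inv_into {0..<n} (std_sel n r) (f j) else j)" for j
  have in_im: "f j \<in> std_sel n r ` {0..<n}" if "j < n" for j using im that by auto
  have fp: "f = std_sel n r \<circ> p"
  proof
    fix j show "f j = (std_sel n r \<circ> p) j"
      using f_inv_into_f[OF in_im, of j] ext[of j] by (auto simp: p_def std_sel_def[of n r j])
  qed
  have "p permutes {0..<n}"
  proof (rule bij_imp_permutes)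
    have "inj_on (std_sel n r \<circ> p) {0..<n}" using inj fp by simp
    then have "inj_on p {0..<n}" by (rule inj_on_imageI2)
    moreover have "p ` {0..<n} \<subseteq> {0..<n}"
      using inv_into_into[OF in_im] by (auto simp: p_def)
    ultimately show "bij_betw p {0..<n} {0..<n}"
      by (simp add: bij_betw_def endo_inj_surj)
  qed (simp add: p_def)
  with fp show "f \<in> (\<lambda>p. std_sel n r \<circ> p) ` {p. p permutes {0..<n}}" by blast
next
  fix f assume "f \<in> (\<lambda>p. std_sel n r \<circ> p) ` {p. p permutes {0..<n}}"
  then obtain p where p: "p permutes {0..<n}" "f = std_sel n r \<circ> p" by auto
  have "f \<in> {0..<n} \<rightarrow>\<^sub>E UNIV \<times> {..<n}"
    using p(1) std_sel_selections(1)[OF assms] permutes_in_image[OF p(1)] permutes_not_in[OF p(1)]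
    unfolding p(2) by (auto simp: selections_def PiE_def extensional_def Pi_def)
  moreover have "inj_on f {0..<n}"
    unfolding p(2) using std_sel_inj[OF assms] permutes_inj_on[OF p(1)] permutes_image[OF p(1)]
    by (intro comp_inj_on) auto
  ultimately show "f \<in> {f \<in> selections n r. total_deg n f = min_deg n r}"
    using std_sel_selections[OF assms] num_true_comp_permutes[OF p(1)] total_deg_comp_permutes[OF p(1)]
    unfolding p(2) by (auto simp: selections_def)
qed

lemma block_det_comp_permutes:
  assumes p: "p permutes {0..<n}" and q: "q permutes {0..<n}"
  shows "block_det h n (f \<circ> p) (g \<circ> q) = signof p * signof q * block_det h n f g"
proof -
  let ?H = "\<lambda>\<rho> \<sigma>. if fst \<rho> = fst \<sigma> then h (fst \<rho>) (snd \<rho> + snd \<sigma>) else 0"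
  have rows: "mat_det n (\<lambda>(j, k). A (p j) k) = signof p * mat_det n (\<lambda>(j, k). A j k)"
    if "p permutes {0..<n}" for p and A :: "nat \<Rightarrow> nat \<Rightarrow> 'a"
  proof -
    have "Matrix.mat n n (\<lambda>(j, k). A (p j) k) = Matrix.mat n n (\<lambda>(i, j). Matrix.mat n n (\<lambda>(j, k). A j k) $$ (p i, j))"
      using permutes_in_image[OF that] by (intro eq_matI) auto
    then show ?thesis by (simp add: det_permute_rows[OF _ that])
  qed
  have "block_det h n (f \<circ> p) (g \<circ> q) = signof p * mat_det n (\<lambda>(j, k). ?H (f j) (g (q k)))"
    unfolding block_det_def o_def by (rule rows[OF p, of "\<lambda>j k. ?H (f j) (g (q k))"])
  also have "mat_det n (\<lambda>(j, k). ?H (f j) (g (q k))) =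
      signof q * mat_det n (\<lambda>(j, k). ?H (f j) (g k))"
    using rows[OF q, of "\<lambda>j k. ?H (f k) (g j)"] by (simp add: det_mat_transpose[of n "\<lambda>j k. ?H (f j) (g (q k))"] det_mat_transpose[of n "\<lambda>j k. ?H (f j) (g k)"])
  finally show ?thesis by (simp add: block_det_def[of h n f g] mult_ac o_def)
qed

definition hankel_det :: "(nat \<Rightarrow> 'a::comm_ring_1) \<Rightarrow> nat \<Rightarrow> 'a" where
  "hankel_det m n = mat_det n (\<lambda>(j, k). m (j + k))"

lemma block_det_std_sel:
  fixes h :: "bool \<Rightarrow> nat \<Rightarrow> 'a::idom"
  assumes "r \<le> n"
  shows "block_det h n (std_sel n r) (std_sel n r) = hankel_det (h False) (n - r) * hankel_det (h True) r"
proof -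
  let ?A = "Matrix.mat (n - r) (n - r) (\<lambda>(j, k). h False (j + k))"
  let ?D = "Matrix.mat r r (\<lambda>(j, k). h True (j + k))"
  have "Matrix.mat n n (\<lambda>(j, k). if fst (std_sel n r j) = fst (std_sel n r k)
      then h (fst (std_sel n r j)) (snd (std_sel n r j) + snd (std_sel n r k)) else 0)
    = four_block_mat ?A (0\<^sub>m (n - r) r) (0\<^sub>m r (n - r)) ?D"
    using assms by (intro eq_matI) (auto simp: std_sel_def)
  then show ?thesis
    unfolding block_det_def hankel_det_def
    by (simp add: det_four_block_mat_lower_left_zero[of _ "n - r" _ r])
qed

text \<open>Since 0^0 = 1, exactly the pairs of minimal selections survive. They are reorderings of
  \<open>std_sel n r\<close>, and the signs that \<open>block_det\<close> picks up turn the sums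
  over the two reorderings into the same determinant of \<open>V\<close>, hence the square.\<close>

lemma reduced_det_0:
  fixes V :: "nat \<Rightarrow> bool \<times> nat \<Rightarrow> 'a::idom"
  assumes "r \<le> n"
  shows "reduced_det V h 0 n r = (mat_det n (\<lambda>(j, k). V j (std_sel n r k)))\<^sup>2 *
    (hankel_det (h False) (n - r) * hankel_det (h True) r)"
proof -
  let ?P = "{p. p permutes {0..<n}}" and ?s = "std_sel n r"
  let ?M = "{f \<in> selections n r. total_deg n f = min_deg n r}"
  let ?c = "\<lambda>f g. (\<Prod>j = 0..<n. V j (f j)) * (\<Prod>j = 0..<n. V j (g j)) * block_det h n f g"
  have inj: "inj_on (\<lambda>p. ?s \<circ> p) ?P"
  proof (rule inj_onI)
    fix p q assume pq: "p \<in> ?P" "q \<in> ?P" "?s \<circ> p = ?s \<circ> q"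
    show "p = q"
    proof
      fix j
      show "p j = q j"
      proof (cases "j < n")
        case True
        have "?s (p j) = ?s (q j)" using fun_cong[OF pq(3), of j] by (simp only: o_apply)
        then show ?thesis
          using pq(1,2) True permutes_in_image[of p "{0..<n}" j] permutes_in_image[of q "{0..<n}" j]
          by (intro inj_onD[OF std_sel_inj[OF assms]]) auto
      next
        case False
        then show ?thesis using pq by (simp add: permutes_not_in)
      qed
    qed
  qed
  have "reduced_det V h 0 n r = (\<Sum>f\<in>?M. \<Sum>g\<in>?M. ?c f g)"
  proof -
    have z: "2 * min_deg n r < total_deg n f + total_deg n g"
      if "f \<in> selections n r" "g \<in> selections n r" "f \<notin> ?M \<or> g \<notin> ?M" for f g
      using that selections_degree(1)[of f n r] selections_degree(1)[of g n r] by force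
    have "reduced_det V h 0 n r = (\<Sum>f\<in>?M. \<Sum>g\<in>selections n r. (\<Prod>j = 0..<n. V j (f j)) * (\<Prod>j = 0..<n. V j (g j)) *
     0 ^ (total_deg n f + total_deg n g - 2 * min_deg n r) * block_det h n f g)"
      unfolding reduced_det_def
      by (intro sum.mono_neutral_right ballI sum.neutral) (use z in auto)
    also have "\<dots> = (\<Sum>f\<in>?M. \<Sum>g\<in>?M. (\<Prod>j = 0..<n. V j (f j)) * (\<Prod>j = 0..<n. V j (g j)) *
     0 ^ (total_deg n f + total_deg n g - 2 * min_deg n r) * block_det h n f g)"
      by (rule sum.cong[OF refl], rule sum.mono_neutral_right)
        (use z in \<open>auto intro!: le_antisym selections_degree(1) simp: not_less\<close>)
    also have "\<dots> = (\<Sum>f\<in>?M. \<Sum>g\<in>?M. ?c f g)"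
      by (intro sum.cong refl) auto
    finally show ?thesis .
  qed
  also have "\<dots> = (\<Sum>p\<in>?P. \<Sum>q\<in>?P. ?c (?s \<circ> p) (?s \<circ> q))"
    unfolding minimal_selections[OF assms] by (simp add: sum.reindex[OF inj])
  also have "\<dots> = (\<Sum>p\<in>?P. \<Sum>q\<in>?P. (signof p * (\<Prod>j = 0..<n. V j (?s (p j)))) *
      (signof q * (\<Prod>j = 0..<n. V j (?s (q j)))) * block_det h n ?s ?s)"
    by (intro sum.cong refl) (simp add: block_det_comp_permutes mult_ac)
  also have "\<dots> = (\<Sum>p\<in>?P. signof p * (\<Prod>j = 0..<n. V j (?s (p j)))) *
      (\<Sum>q\<in>?P. signof q * (\<Prod>j = 0..<n. V j (?s (q j)))) * block_det h n ?s ?s"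
    by (subst sum_product) (simp only: sum_distrib_right)
  also have "(\<Sum>p\<in>?P. signof p * (\<Prod>j = 0..<n. V j (?s (p j)))) = mat_det n (\<lambda>(j, k). V j (?s k))"
    by (simp add: det_mat_eq_sum)
  finally show ?thesis by (simp add: block_det_std_sel[OF assms] power2_eq_square)
qed

section \<open>Confluent Vandermonde determinants and Hankel determinants of Gaussian
  moments\<close>

definition taylor_coeff :: "(bool \<Rightarrow> 'a::comm_ring_1) \<Rightarrow> nat \<Rightarrow> bool \<times> nat \<Rightarrow> 'a" where
  "taylor_coeff T j = (\<lambda>(s, a). of_nat (j choose a) * T s ^ (j - a))"

lemma coeff_pcompose_linear:
  fixes p :: "'a::comm_ring_1 poly"
  assumes "degree p < n"
  shows "coeff (pcompose p [:T s, 1:]) a = (\<Sum>i = 0..<n. coeff p i * taylor_coeff T i (s, a))"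
proof -
  have pow: "pcompose (monom c i) q = Polynomial.smult c (q ^ i)" for c i and q :: "'a poly"
    by (induction i) (simp_all add: monom_0 monom_Suc pcompose_pCons)
  have "coeff ([:T s, 1:] ^ i) a = taylor_coeff T i (s, a)" for i
  proof (cases "a \<le> i")
    case True
    then show ?thesis by (simp add: coeff_linear_poly_power taylor_coeff_def)
  next
    case False
    have "degree ([:T s, 1:] ^ i) \<le> 1 * i"
      by (rule order.trans[OF degree_power_le]) simp
    then show ?thesis using False by (simp add: taylor_coeff_def coeff_eq_0 binomial_eq_0)
  qed
  moreover have "p = (\<Sum>i = 0..<n. monom (coeff p i) i)"
    using poly_as_sum_of_monoms'[of p "n - 1"] assms by (cases n) (simp_all add: atLeast0LessThan lessThan_Suc_atMost)
  then have "pcompose p [:T s, 1:] = pcompose (\<Sum>i = 0..<n. monom (coeff p i) i) [:T s, 1:]"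
    by (rule arg_cong)
  then have "pcompose p [:T s, 1:] = (\<Sum>i = 0..<n. Polynomial.smult (coeff p i) ([:T s, 1:] ^ i))"
    by (simp only: pcompose_sum pow)
  ultimately show ?thesis by (simp add: coeff_sum)
qed

text \<open>The polynomials \<open>P j\<close> are the monic Newton basis for the node
  \<open>T False\<close> taken n - r times and then \<open>T True\<close>. Passing to this basis is
  unitriangular, and the Taylor coefficients of the new basis form a triangular matrix. Each of its
  last r diagonal entries is (T True - T False)^(n-r), all others are 1.\<close>

lemma det_confluent_vandermonde:
  fixes T :: "bool \<Rightarrow> 'a::idom"
  assumes "r \<le> n"
  shows "mat_det n (\<lambda>(j, k). taylor_coeff T j (std_sel n r k)) =
    (T True - T False) ^ (r * (n - r))"
proof -
  define P where "P j = [:- T False, 1:] ^ min j (n - r) * [:- T True, 1:] ^ (j - (n - r))" for j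
  define U where "U = Matrix.mat n n (\<lambda>(j, i). coeff (P j) i)"
  define V where "V = Matrix.mat n n (\<lambda>(j, k). taylor_coeff T j (std_sel n r k))"
  define N where "N = Matrix.mat n n (\<lambda>(j, k). coeff (pcompose (P j) [:T (fst (std_sel n r k)), 1:]) (snd (std_sel n r k)))"
  have deg: "degree (P j) = j" for j
    unfolding P_def by (simp add: degree_mult_eq degree_power_eq)
  have monic: "lead_coeff (P j) = 1" for j
    unfolding P_def by (simp only: lead_coeff_mult lead_coeff_power) simp
  have carrier: "U \<in> carrier_mat n n" "V \<in> carrier_mat n n" "N \<in> carrier_mat n n"
    by (simp_all add: U_def V_def N_def)
  have "N = U * V"
    by (intro eq_matI)
      (auto simp: N_def U_def V_def scalar_prod_def coeff_pcompose_linear[where n = n] deg)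
  then have "Determinant.det N = Determinant.det U * Determinant.det V"
    using carrier by (simp add: det_mult)
  moreover have "Determinant.det U = 1"
  proof -
    have "Determinant.det U = prod_list (diag_mat U)"
      by (rule det_lower_triangular[OF _ carrier(1)]) (auto simp: U_def deg coeff_eq_0)
    also have "diag_mat U = map (\<lambda>j. 1) [0..<n]"
      using monic by (auto simp: diag_mat_def U_def deg)
    finally show ?thesis by (simp add: map_replicate_const)
  qed
  moreover have "Determinant.det N = (T True - T False) ^ (r * (n - r))"
  proof -
    have pow: "pcompose (p ^ i) q = pcompose p q ^ i" for i and p q :: "'a poly"
      by (induction i) (simp_all add: pcompose_mult pcompose_1)
    have F: "pcompose (P j) [:T False, 1:] = monom 1 (min j (n - r)) * [:T False - T True, 1:] ^ (j - (n - r))" for j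
      by (simp add: P_def pcompose_mult pow pcompose_pCons monom_altdef)
    have T: "pcompose (P j) [:T True, 1:] = monom 1 (j - (n - r)) * [:T True - T False, 1:] ^ min j (n - r)" for j
      by (simp add: P_def pcompose_mult pow pcompose_pCons monom_altdef mult.commute)
    have "upper_triangular N"
      using carrier(3) by (auto simp: upper_triangular_def N_def std_sel_def F T coeff_monom_mult)
    then have "Determinant.det N = prod_list (diag_mat N)"
      using carrier(3) by (rule det_upper_triangular)
    also have "diag_mat N = map (\<lambda>j. if j < n - r then 1 else (T True - T False) ^ (n - r)) [0..<n]"
      by (auto simp: diag_mat_def N_def std_sel_def F T coeff_monom_mult coeff_0_power)
    also have "prod_list \<dots> = (\<Prod>j\<in>{0..<n}. if j < n - r then 1 else (T True - T False) ^ (n - r))"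
      by (subst prod.distinct_set_conv_list[symmetric]) simp_all
    also have "\<dots> = (\<Prod>j\<in>{n - r..<n}. (T True - T False) ^ (n - r))"
      by (rule prod.mono_neutral_cong_right) auto
    finally show ?thesis using assms by (simp add: power_mult[symmetric] mult.commute)
  qed
  ultimately show ?thesis by (simp add: V_def)
qed

text \<open>The factorisation is \<open>x\<^sup>j = \<Sum>\<^sub>k a\<^sub>j\<^sub>k He\<^sub>k\<close> with \<open>a\<^sub>j\<^sub>k = (j choose k) m\<^sub>j\<^sub>-\<^sub>k\<close>
  and the orthogonality of the Hermite polynomials \<open>He\<^sub>k\<close>.\<close>

lemma gaussian_moment_product:
  fixes m :: "nat \<Rightarrow> 'a::field_char_0"
  assumes m0: "m 0 = 1" and m1: "m 1 = 0" and m2: "\<And>k. m (k + 2) = of_nat (k + 1) * c * m k"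
  shows "m (j + l) = (\<Sum>k\<le>j + l + N. fact k * c ^ k * (of_nat (j choose k) * m (j - k)) * (of_nat (l choose k) * m (l - k)))"
proof -
  define a where "a j k = (if k \<le> j then of_nat (j choose k) * m (j - k) else 0)" for j k
  have a0: "a j 0 = m j" for j by (simp add: a_def)
  have rec0: "a (Suc j) 0 = c * a j 1" for j
  proof (cases j)
    case (Suc i)
    then show ?thesis using m2[of i] by (simp add: a_def mult_ac)
  qed (use m1 in \<open>simp add: a_def\<close>)
  \<comment> \<open>The rule x He_k = He_(k+1) + k c He_(k-1) read on coefficients: it expresses the
    expansion of x^(j+1) through that of x^j.\<close>
  have rec: "a (Suc j) (Suc k) = a j k + of_nat (k + 2) * c * a j (k + 2)" for j k
  proof -
    consider "j < k" | "j = k" | "j = Suc k" | i where "j = k + 2 + i"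
      by (metis add_2_eq_Suc' le_Suc_ex less_Suc_eq less_or_eq_imp_le linorder_not_less not_less_eq_eq)
    then show ?thesis
    proof cases
      case 4
      have 1: "of_nat (k + 2) * of_nat ((k + 2 + i) choose (k + 2)) = (of_nat (i + 1) :: 'a) * of_nat ((k + 2 + i) choose (k + 1))"
      proof -
        have "(k + 2) * ((k + 2 + i) choose (k + 2)) = (i + 1) * ((k + 2 + i) choose (k + 1))"
          using binomial_absorb_comp[of "k + 2 + i" "k + 1"] Suc_times_binomial_eq[of "k + 1 + i" "k + 1"] 
          using binomial_absorption[of "k + 1" "k + 2 + i"]
          by simp
        then show ?thesis by (metis of_nat_mult)
      qed
      have "a (Suc j) (Suc k) = (of_nat ((k + 2 + i) choose k) + of_nat ((k + 2 + i) choose (k + 1))) * m (i + 2)"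
        using 4 by (simp add: a_def)
      also have "\<dots> = of_nat ((k + 2 + i) choose k) * m (i + 2) + of_nat (k + 2) * c * (of_nat ((k + 2 + i) choose (k + 2)) * m i)"
        unfolding m2 distrib_right using 1 by (simp add: mult_ac)
      finally show ?thesis using 4 by (simp add: a_def)
    qed (use m0 m1 in \<open>auto simp: a_def\<close>)
  qed
  define S where "S N j l = (\<Sum>k\<le>N. fact k * c ^ k * a j k * a l k)" for N j l
  \<comment> \<open>Multiplication by x is symmetric for the bilinear form: both sides stand for the
    moment of order j + l + 1. Since the total order is the same, one cutoff serves both sums.
    Induction on l then moves every factor x to the first argument.\<close>
  have shift: "S (j + l + 1 + N) (Suc j) l = S (j + l + 1 + N) j (Suc l)" for j l N
  proof -
    have *: "S (Suc M) (Suc j) l = (\<Sum>k\<le>Suc M. fact (Suc k) * c ^ (Suc k) * (a j (Suc k) * a l k + a j k * a l (Suc k)))"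
      if M: "j + l \<le> M" for M j l
    proof -
      have "S (Suc M) (Suc j) l = c * a j 1 * a l 0 + (\<Sum>k\<le>M. fact (Suc k) * c ^ Suc k * (a j k + of_nat (k + 2) * c * a j (k + 2)) * a l (Suc k))"
        unfolding S_def by (subst sum.atMost_Suc_shift) (simp only: rec rec0, simp)
      also have "\<dots> = (\<Sum>k\<le>M. fact (Suc k) * c ^ Suc k * a j k * a l (Suc k)) +
         (c * a j 1 * a l 0 + (\<Sum>k\<le>M. fact (Suc (Suc k)) * c ^ Suc (Suc k) * a j (Suc (Suc k)) * a l (Suc k)))"
        by (simp add: sum.distrib algebra_simps)
      also have "c * a j 1 * a l 0 + (\<Sum>k\<le>M. fact (Suc (Suc k)) * c ^ Suc (Suc k) * a j (Suc (Suc k)) * a l (Suc k))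
        = (\<Sum>k\<le>Suc M. fact (Suc k) * c ^ Suc k * a j (Suc k) * a l k)"
        by (simp only: sum.atMost_Suc_shift) simp
      also have "(\<Sum>k\<le>M. fact (Suc k) * c ^ Suc k * a j k * a l (Suc k)) = (\<Sum>k\<le>Suc M. fact (Suc k) * c ^ Suc k * a j k * a l (Suc k))"
        using M by (simp add: a_def)
      finally show ?thesis by (simp add: sum.distrib[symmetric] algebra_simps)
    qed
    have "S M j l = S M l j" for M j l by (simp add: S_def mult_ac)
    then show ?thesis using *[of j l "j + l + N"] *[of l j "j + l + N"] by (simp add: algebra_simps)
  qed
  have "S (j + l + N) j l = m (j + l)"
  proof (induction l arbitrary: j)
    case 0
    have "S (j + N) j 0 = (\<Sum>k\<in>{0}. fact k * c ^ k * a j k * a 0 k)"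
      unfolding S_def by (rule sum.mono_neutral_right) (auto simp: a_def)
    then show ?case using m0 by (simp add: a_def)
  next
    case (Suc l)
    then show ?case using shift[of j l N] Suc[of "Suc j"] by simp
  qed
  moreover have "a j k = of_nat (j choose k) * m (j - k)" for j k by (simp add: a_def)
  ultimately show ?thesis by (simp add: S_def mult_ac)
qed

text \<open>An algebraic statement, to be applied with a complex variance c. The factorisation is A
  D A^T with A unitriangular and D the diagonal of the squared norms m 0 * c^k * k!. If m 0 = 0 the
  moments cannot be normalised, but then they all vanish.\<close>

lemma gaussian_hankel_det:
  fixes m :: "nat \<Rightarrow> 'a::field_char_0"
  assumes m1: "m 1 = 0" and m2: "\<And>k. m (k + 2) = of_nat (k + 1) * c * m k"
  shows "hankel_det m n = m 0 ^ n * (\<Prod>k<n. c ^ k * fact k)"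
proof (cases "m 0 = 0")
  case True
  have "m k = 0" for k
  proof (induction k rule: less_induct)
    case (less k)
    show ?case
    proof (cases "k < 2")
      case True
      then show ?thesis using \<open>m 0 = 0\<close> m1 by (cases k) auto
    next
      case False
      then obtain i where "k = i + 2" by (metis add.commute le_add_diff_inverse not_less)
      then show ?thesis using m2[of i] less[of i] by simp
    qed
  qed
  moreover have "Matrix.mat n n (\<lambda>(j, k). 0) = (0\<^sub>m n n :: 'a mat)" by (intro eq_matI) auto
  ultimately show ?thesis by (cases n) (simp_all add: hankel_det_def)
next
  case False
  define \<mu> where "\<mu> k = m k / m 0" for k
  have \<mu>: "\<mu> 0 = 1" "\<mu> 1 = 0" "\<And>k. \<mu> (k + 2) = of_nat (k + 1) * c * \<mu> k"
    using False m1 m2 by (simp_all add: \<mu>_def field_simps)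
  define A where "A = Matrix.mat n n (\<lambda>(j, k). of_nat (j choose k) * \<mu> (j - k))"
  define D where "D = Matrix.mat n n (\<lambda>(j, k). if j = k then m 0 * (c ^ k * fact k) else 0)"
  have carrier: "A \<in> carrier_mat n n" "D \<in> carrier_mat n n" by (simp_all add: A_def D_def)
  have "Matrix.mat n n (\<lambda>(j, k). m (j + k)) = A * D * transpose_mat A"
  proof (intro eq_matI)
    fix j l assume "j < dim_row (A * D * transpose_mat A)" "l < dim_col (A * D * transpose_mat A)"
    then have jl: "j < n" "l < n" by (simp_all add: A_def)
    have AD: "(A * D) $$ (j, k) = of_nat (j choose k) * \<mu> (j - k) * (m 0 * (c ^ k * fact k))" if "k < n" for k
    proof -
      have "(A * D) $$ (j, k) = (\<Sum>i = 0..<n. of_nat (j choose i) * \<mu> (j - i) * (if i = k then m 0 * (c ^ k * fact k) else 0))"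
        using jl that by (simp add: A_def D_def scalar_prod_def)
      also have "\<dots> = (\<Sum>i = 0..<n. if i = k then of_nat (j choose k) * \<mu> (j - k) * (m 0 * (c ^ k * fact k)) else 0)"
        by (intro sum.cong) auto
      finally show ?thesis using that by simp
    qed
    have "m (j + l) = m 0 * \<mu> (j + l)" using False by (simp add: \<mu>_def)
    also have "\<mu> (j + l) = (\<Sum>k\<le>j + l + n. fact k * c ^ k * (of_nat (j choose k) * \<mu> (j - k)) * (of_nat (l choose k) * \<mu> (l - k)))"
      by (rule gaussian_moment_product[OF \<mu>])
    also have "\<dots> = (\<Sum>k = 0..<n. fact k * c ^ k * (of_nat (j choose k) * \<mu> (j - k)) * (of_nat (l choose k) * \<mu> (l - k)))"
      using jl by (intro sum.mono_neutral_right) auto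
    also have "m 0 * \<dots> = (\<Sum>k = 0..<n. (A * D) $$ (j, k) * A $$ (l, k))"
      unfolding sum_distrib_left using jl by (intro sum.cong refl) (simp add: AD, simp add: A_def mult_ac)
    also have "\<dots> = (A * D * transpose_mat A) $$ (j, l)"
    proof -
      obtain E where E: "E = A * D" "E \<in> carrier_mat n n" using carrier by auto
      then show ?thesis using jl carrier unfolding E(1)[symmetric] by (simp add: scalar_prod_def)
    qed
    finally show "Matrix.mat n n (\<lambda>(j, k). m (j + k)) $$ (j, l) = (A * D * transpose_mat A) $$ (j, l)"
      using jl by simp
  qed (simp_all add: A_def)
  then have "hankel_det m n = Determinant.det A * Determinant.det D * Determinant.det A"
    using carrier by (simp add: hankel_det_def det_mult[of _ n] det_transpose[of _ n])
  moreover have "Determinant.det A = 1"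
  proof -
    have "Determinant.det A = prod_list (diag_mat A)"
      by (rule det_lower_triangular[OF _ carrier(1)]) (auto simp: A_def)
    also have "diag_mat A = map (\<lambda>j. 1) [0..<n]" using \<mu>(1) by (auto simp: diag_mat_def A_def)
    finally show ?thesis by (simp add: map_replicate_const)
  qed
  moreover have "Determinant.det D = m 0 ^ n * (\<Prod>k<n. c ^ k * fact k)"
  proof -
    have "Determinant.det D = prod_list (diag_mat D)"
      by (rule det_lower_triangular[OF _ carrier(2)]) (auto simp: D_def)
    also have "diag_mat D = map (\<lambda>k. m 0 * (c ^ k * fact k)) [0..<n]" by (auto simp: diag_mat_def D_def)
    also have "prod_list \<dots> = (\<Prod>k\<in>{0..<n}. m 0 * (c ^ k * fact k))"
      by (subst prod.distinct_set_conv_list[symmetric]) simp_all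
    finally show ?thesis by (simp add: prod.distrib atLeast0LessThan)
  qed
  ultimately show ?thesis by simp
qed

section \<open>Contour integrals for the Airy functions\<close>

lemma power_le_fact_mult_exp:
  fixes x :: real
  assumes "x \<ge> 0"
  shows "x ^ n \<le> fact n * exp x"
proof -
  have "x ^ n /\<^sub>R fact n \<le> (\<Sum>k. x ^ k /\<^sub>R fact k)"
    using sum_le_suminf[OF summable_exp_generic[of x], of "{n}"] assms by simp
  then show ?thesis by (simp add: exp_def field_simps)
qed

lemma set_integrable_exp_decay:
  fixes f :: "real \<Rightarrow> 'a :: {banach, second_countable_topology}"
  assumes cont: "continuous_on UNIV f" and le: "\<And>x. x \<ge> 0 \<Longrightarrow> norm (f x) \<le> C * exp (- x)"
  shows "set_integrable lborel {0..} f"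
proof -
  have "integrable lborel (\<lambda>x::real. x ^ 0 * exp (- x) * indicator {0..} x)"
    using nn_intergal_power_times_exp_Ici[of 0]
    by (intro integrableI_nonneg) (auto simp: ennreal_mult' ennreal_indicator)
  then have "set_integrable lborel {0..} (\<lambda>x::real. C * exp (- x))"
    unfolding set_integrable_def by (simp add: mult_ac)
  then show ?thesis
  proof (rule set_integrable_bound)
    show "set_borel_measurable lborel {0..} f"
      unfolding set_borel_measurable_def using borel_measurable_continuous_onI[OF cont] by simp
    have "norm (f x) \<le> norm (C * exp (- x))" if "x \<ge> 0" for x
      using le[OF that] abs_ge_self order.trans unfolding real_norm_def by blast
    then show "AE x in lborel. x \<in> {0..} \<longrightarrow> norm (f x) \<le> norm (C * exp (- x))" by auto
  qed
qed

text \<open>The negative half-line is reflected to {0..}. The origin is then counted twice, which is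
  a null set and the reason for the almost-everywhere argument.\<close>

lemma integrable_split_half_lines:
  fixes f :: "real \<Rightarrow> complex"
  assumes f: "set_integrable lborel {0..} f" "set_integrable lborel {0..} (\<lambda>x. f (- x))"
  shows "has_bochner_integral lborel f ((LINT x:{0..}|lborel. f x) + (LINT x:{0..}|lborel. f (- x)))"
proof -
  have "has_bochner_integral lborel (\<lambda>x. indicator {0..} x *\<^sub>R f (- x)) (LINT x:{0..}|lborel. f (- x))"
    using f(2) by (simp add: set_integrable_def set_lebesgue_integral_def has_bochner_integral_iff)
  then have "has_bochner_integral lborel (\<lambda>x. indicator {0..} (0 + (- 1) * x) *\<^sub>R f (- (0 + (- 1) * x))) ((LINT x:{0..}|lborel. f (- x)) /\<^sub>R \<bar>-1\<bar>)"
    by (subst (asm) lborel_has_bochner_integral_real_affine_iff[of "-1" _ _ 0]) simp_all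
  then have *: "has_bochner_integral lborel (\<lambda>x. indicator {..0} x *\<^sub>R f x) (LINT x:{0..}|lborel. f (- x))"
    by (rule has_bochner_integral_cong[THEN iffD1, rotated -1]) (auto split: split_indicator)
  have "has_bochner_integral lborel (\<lambda>x. indicator {0..} x *\<^sub>R f x + indicator {..0} x *\<^sub>R f x)
      ((LINT x:{0..}|lborel. f x) + (LINT x:{0..}|lborel. f (- x)))"
    by (rule has_bochner_integral_add[OF _ *])
      (use f(1) in \<open>simp add: set_integrable_def set_lebesgue_integral_def has_bochner_integral_iff\<close>)
  then show ?thesis
  proof (rule has_bochner_integral_cong_AE[THEN iffD1, rotated -1])
    have meas: "(\<lambda>x. indicator {0..} x *\<^sub>R f x + indicator {..0} x *\<^sub>R f x) \<in> borel_measurable lborel"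
      using \<open>has_bochner_integral lborel (\<lambda>x. indicator {0..} x *\<^sub>R f x + indicator {..0} x *\<^sub>R f x) _\<close>
      by (auto simp: has_bochner_integral_iff)
    have eq: "f x = (indicator {0..} x *\<^sub>R f x + indicator {..0} x *\<^sub>R f x) - indicator {0} x *\<^sub>R f 0" for x
      by (auto split: split_indicator)
    show "f \<in> borel_measurable lborel"
      by (subst eq[abs_def]) (use meas in measurable)
    show "AE x in lborel. indicator {0..} x *\<^sub>R f x + indicator {..0} x *\<^sub>R f x = f x"
      using AE_lborel_singleton[of 0] by eventually_elim (auto split: split_indicator)
    show "(\<lambda>x. indicator {0..} x *\<^sub>R f x + indicator {..0} x *\<^sub>R f x) \<in> borel_measurable lborel"
      by (rule meas)
  qed
qed

lemma integrable_exp_decay: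
  fixes f :: "real \<Rightarrow> complex"
  assumes cont: "continuous_on UNIV f" and le: "\<And>x. norm (f x) \<le> C * exp (- \<bar>x\<bar>)"
  shows "set_integrable lborel {0..} f" "set_integrable lborel {0..} (\<lambda>x. f (- x))" "integrable lborel f"
proof -
  have "norm (f x) \<le> C * exp (- x)" "norm (f (- x)) \<le> C * exp (- x)" if "x \<ge> 0" for x
    using le[of x] le[of "- x"] that by auto
  moreover have "continuous_on UNIV (\<lambda>x. f (- x))"
    by (rule continuous_on_compose2[OF cont]) (auto intro: continuous_intros)
  ultimately show 1: "set_integrable lborel {0..} f" and 2: "set_integrable lborel {0..} (\<lambda>x. f (- x))"
    by (auto intro: set_integrable_exp_decay cont)
  show "integrable lborel f"
    using integrable_split_half_lines[OF 1 2] by (simp add: has_bochner_integral_iff)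
qed

lemma FTC_at_top:
  fixes G g :: "real \<Rightarrow> complex"
  assumes G: "\<And>x. (G has_vector_derivative g x) (at x)" and cont: "continuous_on UNIV g"
    and int: "set_integrable lborel {0..} g"
  shows "(G \<longlongrightarrow> G 0 + (LINT x:{0..}|lborel. g x)) at_top"
proof -
  have "((\<lambda>y. \<integral>x. indicator {..y} x *\<^sub>R (indicator {0..} x *\<^sub>R g x) \<partial>lborel) \<longlongrightarrow> (LINT x:{0..}|lborel. g x)) at_top"
    unfolding set_lebesgue_integral_def
    by (rule tendsto_integral_at_top) (use int in \<open>simp_all add: set_integrable_def\<close>)
  moreover have "eventually (\<lambda>y. (\<integral>x. indicator {..y} x *\<^sub>R (indicator {0..} x *\<^sub>R g x) \<partial>lborel) = G y - G 0) at_top"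
    using eventually_ge_at_top[of 0]
  proof eventually_elim
    case (elim y)
    have "(\<integral>x. indicator {0..y} x *\<^sub>R g x \<partial>lborel) = G y - G 0"
      by (rule integral_FTC_Icc[OF elim]) (use G cont in \<open>auto intro: has_vector_derivative_at_within continuous_on_subset\<close>)
    moreover have "(\<lambda>x. indicator {..y} x *\<^sub>R (indicator {0..} x *\<^sub>R g x)) = (\<lambda>x. indicator {0..y} x *\<^sub>R g x)"
      by (intro ext) (auto simp: indicator_def)
    ultimately show ?case by (simp only:)
  qed
  ultimately have "((\<lambda>y. G y - G 0) \<longlongrightarrow> (LINT x:{0..}|lborel. g x)) at_top"
    by (rule Lim_transform_eventually)
  from tendsto_add[OF tendsto_const[of "G 0"] this] show ?thesis by simp
qed

text \<open>Turns a ray integral into the limit of an entire primitive at infinity. Contours are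
  exchanged below by comparing such limits, which takes the place of Cauchy's theorem on closed
  contours.\<close>

lemma primitive_along_ray:
  fixes P h :: "complex \<Rightarrow> complex"
  assumes P: "\<And>w. (P has_field_derivative h w) (at w)" and cont: "continuous_on UNIV h"
    and int: "set_integrable lborel {0..} (\<lambda>s. h (a + of_real s * e))"
  shows "((\<lambda>s. P (a + of_real s * e)) \<longlongrightarrow> P a + e * (LINT s:{0..}|lborel. h (a + of_real s * e))) at_top"
proof -
  have "((\<lambda>s. P (a + of_real s * e)) \<longlongrightarrow> P (a + of_real 0 * e) + (LINT s:{0..}|lborel. e * h (a + of_real s * e))) at_top"
  proof (rule FTC_at_top)
    fix s :: real
    have "((\<lambda>s. a + of_real s * e) has_vector_derivative e) (at s)"
      by (auto intro!: derivative_eq_intros simp: has_vector_derivative_def scaleR_conv_of_real)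
    from field_vector_diff_chain_at[OF this P]
    show "((\<lambda>s. P (a + of_real s * e)) has_vector_derivative e * h (a + of_real s * e)) (at s)"
      by (simp add: o_def)
    show "continuous_on UNIV (\<lambda>s. e * h (a + of_real s * e))"
      by (intro continuous_intros continuous_on_compose2[OF cont]) auto
    show "set_integrable lborel {0..} (\<lambda>s. e * h (a + of_real s * e))"
      using int by (rule set_integrable_mult_right)
  qed
  then show ?thesis by simp
qed

lemma primitive_vertical_segment_bound:
  fixes P h :: "complex \<Rightarrow> complex"
  assumes P: "\<And>w. (P has_field_derivative h w) (at w)"
    and "y0 \<le> y1" and bd: "\<And>y. y0 \<le> y \<Longrightarrow> y \<le> y1 \<Longrightarrow> norm (h (Complex x y)) \<le> B"
  shows "norm (P (Complex x y1) - P (Complex x y0)) \<le> B * (y1 - y0)"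
proof -
  let ?S = "closed_segment (Complex x y0) (Complex x y1)"
  have "norm (P (Complex x y1) - P (Complex x y0)) \<le> B * norm (Complex x y1 - Complex x y0)"
  proof (rule field_differentiable_bound)
    show "convex ?S" by (rule convex_closed_segment)
    fix w assume w: "w \<in> ?S"
    show "(P has_field_derivative h w) (at w within ?S)"
      using P by (rule has_field_derivative_at_within)
    have "w = Complex x (Im w)" "y0 \<le> Im w" "Im w \<le> y1"
      using w \<open>y0 \<le> y1\<close> by (auto simp: closed_segment_same_Re closed_segment_eq_real_ivl complex_eq_iff)
    then show "norm (h w) \<le> B" using bd by metis
  qed auto
  moreover have "norm (Complex x y1 - Complex x y0) = y1 - y0"
    using \<open>y0 \<le> y1\<close> by (simp add: cmod_def)
  ultimately show ?thesis by simp
qed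

lemma holomorphic_primitive_UNIV:
  assumes "h holomorphic_on UNIV"
  obtains P where "\<And>w. (P has_field_derivative h w) (at w)"
  using holomorphic_convex_primitive'[OF convex_UNIV open_UNIV assms] by auto

text \<open>The substitution t = cis (pi / 6) * w in t^m exp (2t^3/3 + zt) with z = 2b^2, without
  the constant factors from t^m and dt. In the variable w the line through the saddle point is
  horizontal, the two rays have arguments pi/6 and 5 pi/6, and the cubic coefficient is
  imaginary.\<close>

definition airy_integrand :: "nat \<Rightarrow> real \<Rightarrow> complex \<Rightarrow> complex" where
  "airy_integrand m b w = w ^ m * exp (2 / 3 * \<i> * w ^ 3 + of_real (2 * b\<^sup>2) * cis (pi / 6) * w)"

lemma cis_pi_6: "cis (pi / 6) = Complex (sqrt 3 / 2) (1 / 2)"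
  by (simp add: complex_eq_iff cos_30 sin_30)

lemma cis_pi_3: "cis (pi / 3) = Complex (1 / 2) (sqrt 3 / 2)"
  by (simp add: complex_eq_iff cos_60 sin_60)

lemma cis_5_pi_6: "cis (5 * pi / 6) = Complex (- sqrt 3 / 2) (1 / 2)"
proof -
  have "5 * pi / 6 = pi - pi / 6" by simp
  then show ?thesis by (simp only: complex_eq_iff cis.simps cos_pi_minus sin_pi_minus) (simp add: cos_30 sin_30)
qed

lemma norm_airy_integrand:
  "norm (airy_integrand m b (Complex x y)) =
     norm (Complex x y) ^ m * exp (2 / 3 * (y ^ 3 - 3 * x\<^sup>2 * y) + 2 * b\<^sup>2 * (sqrt 3 / 2 * x - y / 2))"
proof -
  have "Re (2 / 3 * \<i> * Complex x y ^ 3 + of_real (2 * b\<^sup>2) * cis (pi / 6) * Complex x y) =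
      2 / 3 * (y ^ 3 - 3 * x\<^sup>2 * y) + 2 * b\<^sup>2 * (sqrt 3 / 2 * x - y / 2)"
    by (simp add: cis_pi_6 power3_eq_cube power2_eq_square field_simps)
  then show ?thesis
    unfolding airy_integrand_def norm_mult norm_power norm_exp_eq_Re by (simp only:)
qed

lemma continuous_on_airy_integrand: "continuous_on A (airy_integrand m b)"
  unfolding airy_integrand_def[abs_def] by (intro continuous_intros)

section \<open>Decay estimates and the change of contour\<close>

lemma cubic_decay:
  fixes c :: real
  obtains C where "C > 0" "\<And>s::real. s \<ge> 0 \<Longrightarrow> s ^ m * exp (c * s - 2 / 3 * s ^ 3) \<le> C * exp (- s)"
proof -
  \<comment> \<open>The expression 2 a^2 s - 2/3 s^3 is largest at s = a. Of the 2 in c + 2, one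
    unit pays for the power s^m and the other leaves the factor exp (- s).\<close>
  define a where "a = sqrt (\<bar>c + 2\<bar> / 2)"
  have a: "a \<ge> 0" "2 * a\<^sup>2 \<ge> c + 2" by (simp_all add: a_def)
  have "s ^ m * exp (c * s - 2 / 3 * s ^ 3) \<le> fact m * exp (4 / 3 * a ^ 3) * exp (- s)" if "s \<ge> 0" for s :: real
  proof -
    have "0 \<le> (s - a)\<^sup>2 * (s + 2 * a)" using that a by simp
    then have "2 * (a\<^sup>2 * s) - 2 / 3 * s ^ 3 \<le> 4 / 3 * a ^ 3"
      by (simp add: power2_eq_square power3_eq_cube algebra_simps)
    moreover have "(c + 2) * s \<le> 2 * a\<^sup>2 * s" using a that by (intro mult_right_mono)
    ultimately have "s + (c * s - 2 / 3 * s ^ 3) \<le> 4 / 3 * a ^ 3 + - s"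
      by (simp add: algebra_simps)
    then have "exp s * exp (c * s - 2 / 3 * s ^ 3) \<le> exp (4 / 3 * a ^ 3) * exp (- s)"
      by (simp flip: exp_add)
    then have 1: "fact m * exp s * exp (c * s - 2 / 3 * s ^ 3) \<le> fact m * exp (4 / 3 * a ^ 3) * exp (- s)"
      by (simp add: mult.assoc)
    have "s ^ m * exp (c * s - 2 / 3 * s ^ 3) \<le> fact m * exp s * exp (c * s - 2 / 3 * s ^ 3)"
      using power_le_fact_mult_exp[OF that, of m] by (intro mult_right_mono) auto
    from this 1 show ?thesis by (rule order.trans)
  qed
  then show ?thesis by (intro that[of "fact m * exp (4 / 3 * a ^ 3)"]) auto
qed

lemma quadratic_decay:
  fixes c d :: real
  assumes "d > 0"
  obtains C where "C > 0" "\<And>x. \<bar>x\<bar> ^ m * exp (c * \<bar>x\<bar> - d * x\<^sup>2) \<le> C * exp (- \<bar>x\<bar>)"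
proof -
  \<comment> \<open>The constant comes from completing the square in (c + 2) \<bar>x\<bar> - d x^2;
    the 2 again pays for the power and for the final decay.\<close>
  define C where "C = fact m * exp ((c + 2)\<^sup>2 / (4 * d))"
  have "\<bar>x\<bar> ^ m * exp (c * \<bar>x\<bar> - d * x\<^sup>2) \<le> C * exp (- \<bar>x\<bar>)" for x
  proof -
    have "0 \<le> (2 * d * \<bar>x\<bar> - (c + 2))\<^sup>2 / (4 * d)" using assms by simp
    also have "\<dots> = d * x\<^sup>2 - (c + 2) * \<bar>x\<bar> + (c + 2)\<^sup>2 / (4 * d)"
      using assms by (simp add: power2_eq_square field_simps flip: abs_mult)
    finally have "\<bar>x\<bar> + (c * \<bar>x\<bar> - d * x\<^sup>2) \<le> (c + 2)\<^sup>2 / (4 * d) + - \<bar>x\<bar>"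
      by (simp add: algebra_simps)
    then have "exp \<bar>x\<bar> * exp (c * \<bar>x\<bar> - d * x\<^sup>2) \<le> exp ((c + 2)\<^sup>2 / (4 * d)) * exp (- \<bar>x\<bar>)"
      by (simp flip: exp_add)
    then have "fact m * exp \<bar>x\<bar> * exp (c * \<bar>x\<bar> - d * x\<^sup>2) \<le> C * exp (- \<bar>x\<bar>)"
      by (simp add: C_def mult.assoc)
    moreover have "\<bar>x\<bar> ^ m * exp (c * \<bar>x\<bar> - d * x\<^sup>2) \<le> fact m * exp \<bar>x\<bar> * exp (c * \<bar>x\<bar> - d * x\<^sup>2)"
      using power_le_fact_mult_exp[of "\<bar>x\<bar>" m] by (intro mult_right_mono) auto
    ultimately show ?thesis by linarith
  qed
  then show ?thesis by (intro that[of C]) (auto simp: C_def)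
qed

lemma set_integrable_airy_ray:
  assumes e: "e = cis (pi / 6) \<or> e = cis (5 * pi / 6)"
  shows "set_integrable lborel {0..} (\<lambda>s. airy_integrand m b (0 + of_real s * e))"
proof -
  obtain C where C: "C > 0" "\<And>s. s \<ge> 0 \<Longrightarrow> s ^ m * exp (b\<^sup>2 * s - 2 / 3 * s ^ 3) \<le> C * exp (- s)"
    using cubic_decay[of m "b\<^sup>2"] by blast
  show ?thesis
  proof (rule set_integrable_exp_decay)
    show "continuous_on UNIV (\<lambda>s. airy_integrand m b (0 + of_real s * e))"
      by (intro continuous_on_compose2[OF continuous_on_airy_integrand[of UNIV]] continuous_intros) auto
    fix s :: real assume s: "s \<ge> 0"
    define \<epsilon> :: real where "\<epsilon> = (if e = cis (pi / 6) then 1 else -1)"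
    have "of_real s * e = Complex (\<epsilon> * (sqrt 3 / 2) * s) (s / 2)"
      using e by (auto simp: \<epsilon>_def cis_pi_6 cis_5_pi_6 complex_eq_iff)
    moreover have "norm (of_real s * e) = s" using e s by (auto simp: norm_mult)
    moreover have "\<epsilon>\<^sup>2 = 1" "\<epsilon> \<le> 1" by (simp_all add: \<epsilon>_def)
    then have "2 / 3 * ((s / 2) ^ 3 - 3 * (\<epsilon> * (sqrt 3 / 2) * s)\<^sup>2 * (s / 2)) = - (2 / 3 * s ^ 3)"
      by (simp add: power_mult_distrib power2_eq_square[of s] power3_eq_cube power_divide algebra_simps)
    moreover have "sqrt 3 / 2 * (\<epsilon> * (sqrt 3 / 2) * s) - s / 2 / 2 \<le> s / 2"
    proof -
      have "sqrt 3 / 2 * (\<epsilon> * (sqrt 3 / 2) * s) = \<epsilon> * s * (sqrt 3 * sqrt 3) / 4" by (simp add: algebra_simps)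
      also have "\<dots> = 3 / 4 * (\<epsilon> * s)" by simp
      also have "\<dots> \<le> 3 / 4 * s" using mult_right_mono[OF \<open>\<epsilon> \<le> 1\<close> s] by simp
      finally show ?thesis by linarith
    qed
    then have "2 * b\<^sup>2 * (sqrt 3 / 2 * (\<epsilon> * (sqrt 3 / 2) * s) - s / 2 / 2) \<le> 2 * b\<^sup>2 * (s / 2)"
      by (rule mult_left_mono) simp
    ultimately have "norm (airy_integrand m b (of_real s * e)) \<le> s ^ m * exp (b\<^sup>2 * s - 2 / 3 * s ^ 3)"
      using s norm_airy_integrand[of m b "\<epsilon> * (sqrt 3 / 2) * s" "s / 2"] by (auto intro!: mult_left_mono)
    also have "\<dots> \<le> C * exp (- s)" using C s by blast
    finally show "norm (airy_integrand m b (0 + of_real s * e)) \<le> C * exp (- s)" by simp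
  qed
qed

text \<open>The horizontal direction is on the boundary of the sectors where the cubic exponential
  decays. At height y > 0, however, the real part of the cubic term is a constant minus 2 y x^2,
  which gives Gaussian decay along the line.\<close>

lemma airy_line_bound:
  assumes "b > 0"
  shows "\<exists>C. \<forall>s. norm (airy_integrand m b (of_real b * cis (pi / 3) + of_real s)) \<le> C * exp (- \<bar>s\<bar>)"
proof -
  define y where "y = sqrt 3 / 2 * b"
  have y: "y > 0" using assms by (simp add: y_def)
  define K where "K = 2 / 3 * y ^ 3 - b\<^sup>2 * y"
  obtain C where C: "C > 0" "\<And>x. \<bar>x\<bar> ^ 0 * exp ((b\<^sup>2 * sqrt 3 + 1) * \<bar>x\<bar> - 2 * y * x\<^sup>2) \<le> C * exp (- \<bar>x\<bar>)"
    using quadratic_decay[of "2 * y" 0 "b\<^sup>2 * sqrt 3 + 1"] y by auto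
  have "norm (airy_integrand m b (of_real b * cis (pi / 3) + of_real s)) \<le>
      (fact m * exp y * exp K * C * exp (b / 2)) * exp (- \<bar>s\<bar>)" for s
  proof -
    define x where "x = b / 2 + s"
    have w: "of_real b * cis (pi / 3) + of_real s = Complex x y"
      by (simp add: cis_pi_3 complex_eq_iff x_def y_def)
    have "norm (Complex x y) \<le> \<bar>x\<bar> + \<bar>y\<bar>" using cmod_le[of "Complex x y"] by simp
    then have "norm (Complex x y) ^ m \<le> (\<bar>x\<bar> + y) ^ m" using y by (intro power_mono) auto
    also have "\<dots> \<le> fact m * exp (\<bar>x\<bar> + y)" using y by (intro power_le_fact_mult_exp) auto
    finally have 1: "norm (Complex x y) ^ m \<le> fact m * exp y * exp \<bar>x\<bar>" by (simp add: exp_add mult_ac)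
    have "2 * b\<^sup>2 * (sqrt 3 / 2 * x) \<le> 2 * b\<^sup>2 * (sqrt 3 / 2 * \<bar>x\<bar>)"
      by (intro mult_left_mono) auto
    then have 2: "\<bar>x\<bar> + (2 / 3 * (y ^ 3 - 3 * x\<^sup>2 * y) + 2 * b\<^sup>2 * (sqrt 3 / 2 * x - y / 2)) \<le>
        K + ((b\<^sup>2 * sqrt 3 + 1) * \<bar>x\<bar> - 2 * y * x\<^sup>2)"
      by (simp add: K_def algebra_simps)
    have "norm (airy_integrand m b (Complex x y)) \<le> (fact m * exp y * exp \<bar>x\<bar>) *
       exp (2 / 3 * (y ^ 3 - 3 * x\<^sup>2 * y) + 2 * b\<^sup>2 * (sqrt 3 / 2 * x - y / 2))"
      unfolding norm_airy_integrand using 1 by (intro mult_right_mono) auto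
    also have "\<dots> = fact m * exp y * exp (\<bar>x\<bar> + (2 / 3 * (y ^ 3 - 3 * x\<^sup>2 * y) + 2 * b\<^sup>2 * (sqrt 3 / 2 * x - y / 2)))"
      by (simp only: exp_add mult.assoc)
    also have "\<dots> \<le> fact m * exp y * exp (K + ((b\<^sup>2 * sqrt 3 + 1) * \<bar>x\<bar> - 2 * y * x\<^sup>2))"
      using 2 by (intro mult_left_mono) auto
    also have "\<dots> = fact m * exp y * exp K * exp ((b\<^sup>2 * sqrt 3 + 1) * \<bar>x\<bar> - 2 * y * x\<^sup>2)"
      by (simp only: exp_add mult.assoc)
    also have "\<dots> \<le> fact m * exp y * exp K * (C * exp (- \<bar>x\<bar>))"
      using C(2)[of x] by (intro mult_left_mono) auto
    also have "\<dots> \<le> fact m * exp y * exp K * (C * exp (b / 2 + - \<bar>s\<bar>))"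
      using C(1) assms by (intro mult_left_mono) (auto simp: x_def)
    also have "\<dots> = (fact m * exp y * exp K * C * exp (b / 2)) * exp (- \<bar>s\<bar>)"
      by (simp only: exp_add mult.assoc)
    finally show ?thesis unfolding w .
  qed
  then show ?thesis by blast
qed

text \<open>At distance X from the imaginary axis the ray has height X / sqrt 3. On the vertical
  segment down to the line, 3 y^2 \<le> X^2, so y^3 - 3 X^2 y \<le> -(8/3) X^2 y0; the factor 2/3 of
  the exponent turns 8/3 into 16/9.\<close>

lemma airy_far_segment:
  assumes P: "\<And>w. (P has_field_derivative airy_integrand m b w) (at w)" and b: "b > 0" and \<epsilon>: "\<epsilon> = 1 \<or> \<epsilon> = (-1::real)"
  shows "((\<lambda>X. P (Complex (\<epsilon> * X) (X / sqrt 3)) - P (Complex (\<epsilon> * X) (sqrt 3 / 2 * b))) \<longlongrightarrow> 0) at_top"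
proof (rule Lim_null_comparison)
  define y0 where "y0 = sqrt 3 / 2 * b"
  have y0: "y0 > 0" using b by (simp add: y0_def)
  define B where "B X = 2 ^ m * fact (m + 1) * exp ((2 * b\<^sup>2 + 1) * X - 16 / 9 * y0 * X\<^sup>2)" for X :: real
  show "(B \<longlongrightarrow> 0) at_top" unfolding B_def using y0 by real_asymp
  show "eventually (\<lambda>X. norm (P (Complex (\<epsilon> * X) (X / sqrt 3)) - P (Complex (\<epsilon> * X) (sqrt 3 / 2 * b))) \<le> B X) at_top"
    using eventually_ge_at_top[of "sqrt 3 * y0"]
  proof eventually_elim
    case (elim X)
    have X: "X \<ge> 0" "y0 \<le> X / sqrt 3" using elim y0 by (auto simp: field_simps intro: order.trans[rotated])
    define K where "K = (2 * X) ^ m * exp (2 * b\<^sup>2 * X - 16 / 9 * y0 * X\<^sup>2)"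
    have "norm (P (Complex (\<epsilon> * X) (X / sqrt 3)) - P (Complex (\<epsilon> * X) y0)) \<le> K * (X / sqrt 3 - y0)"
    proof (rule primitive_vertical_segment_bound[OF P X(2)])
      fix y assume y: "y0 \<le> y" "y \<le> X / sqrt 3"
      have sq: "(\<epsilon> * X)\<^sup>2 = X\<^sup>2" using \<epsilon> by auto
      have "sqrt 3 * y \<le> X" using y by (simp add: field_simps)
      then have "(sqrt 3 * y)\<^sup>2 \<le> X\<^sup>2" using y y0 by (intro power_mono) auto
      then have "3 * y\<^sup>2 \<le> X\<^sup>2" by (simp add: power_mult_distrib)
      then have "3 * y\<^sup>2 * y \<le> X\<^sup>2 * y" using y y0 by (intro mult_right_mono) auto
      moreover have "X\<^sup>2 * y0 \<le> X\<^sup>2 * y" using y by (intro mult_left_mono) auto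
      ultimately have 1: "2 / 3 * (y ^ 3 - 3 * (\<epsilon> * X)\<^sup>2 * y) \<le> - (16 / 9 * y0 * X\<^sup>2)"
        unfolding sq by (simp add: power2_eq_square power3_eq_cube algebra_simps)
      have "sqrt 3 \<le> 2" by (rule real_le_lsqrt) auto
      then have "0 \<le> sqrt 3 * X" "sqrt 3 * X \<le> 2 * X" using X(1) by (auto intro: mult_right_mono)
      then have "sqrt 3 / 2 * (\<epsilon> * X) \<le> X" using \<epsilon> by auto
      then have "sqrt 3 / 2 * (\<epsilon> * X) - y / 2 \<le> X" using y y0 by simp
      then have 2: "2 * b\<^sup>2 * (sqrt 3 / 2 * (\<epsilon> * X) - y / 2) \<le> 2 * b\<^sup>2 * X" by (intro mult_left_mono) auto
      from 1 2 have exponent: "2 / 3 * (y ^ 3 - 3 * (\<epsilon> * X)\<^sup>2 * y) + 2 * b\<^sup>2 * (sqrt 3 / 2 * (\<epsilon> * X) - y / 2) \<le>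
          2 * b\<^sup>2 * X - 16 / 9 * y0 * X\<^sup>2"
        by linarith
      have "X / sqrt 3 \<le> X" using X(1) by (simp add: field_simps mult_le_cancel_left1)
      then have "norm (Complex (\<epsilon> * X) y) \<le> 2 * X"
        using sqrt_sum_squares_le_sum_abs[of "\<epsilon> * X" y] \<epsilon> X y y0 by (auto simp: cmod_def)
      then have "norm (Complex (\<epsilon> * X) y) ^ m \<le> (2 * X) ^ m" by (intro power_mono) auto
      then show "norm (airy_integrand m b (Complex (\<epsilon> * X) y)) \<le> K"
        unfolding norm_airy_integrand K_def using exponent X(1) by (intro mult_mono) auto
    qed
    also have "\<dots> \<le> K * X"
    proof (intro mult_left_mono)
      have "X / sqrt 3 \<le> X" using X(1) by (simp add: field_simps mult_le_cancel_left1)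
      then show "X / sqrt 3 - y0 \<le> X" using y0 by simp
    qed (use X in \<open>simp add: K_def\<close>)
    also have "\<dots> = 2 ^ m * X ^ (m + 1) * exp (2 * b\<^sup>2 * X - 16 / 9 * y0 * X\<^sup>2)"
      by (simp add: K_def power_mult_distrib mult_ac)
    also have "\<dots> \<le> 2 ^ m * (fact (m + 1) * exp X) * exp (2 * b\<^sup>2 * X - 16 / 9 * y0 * X\<^sup>2)"
      using power_le_fact_mult_exp[OF X(1), of "m + 1"] by (intro mult_right_mono mult_left_mono) auto
    also have "\<dots> = 2 ^ m * fact (m + 1) * exp (X + (2 * b\<^sup>2 * X - 16 / 9 * y0 * X\<^sup>2))"
      by (simp only: exp_add mult.assoc)
    also have "X + (2 * b\<^sup>2 * X - 16 / 9 * y0 * X\<^sup>2) = (2 * b\<^sup>2 + 1) * X - 16 / 9 * y0 * X\<^sup>2"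
      by (simp add: algebra_simps)
    finally show ?case by (simp add: B_def y0_def)
  qed
qed

text \<open>Ray and half-line are compared at equal abscissa, to the right and to the left
  separately, and the far segments contribute nothing in the limit. Subtracting the two comparisons
  eliminates the values of the primitive at 0 and at the saddle point.\<close>

lemma airy_contour_deformation:
  assumes b: "b > 0"
  shows "cis (pi / 6) * (LINT s:{0..}|lborel. airy_integrand m b (of_real s * cis (pi / 6))) -
         cis (5 * pi / 6) * (LINT s:{0..}|lborel. airy_integrand m b (of_real s * cis (5 * pi / 6))) =
         (\<integral>s. airy_integrand m b (of_real b * cis (pi / 3) + of_real s) \<partial>lborel)"
proof -
  let ?h = "airy_integrand m b" and ?w = "of_real b * cis (pi / 3)"
  have "?h holomorphic_on UNIV" unfolding airy_integrand_def[abs_def] by (intro holomorphic_intros)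
  then obtain P where P: "\<And>w. (P has_field_derivative ?h w) (at w)"
    by (rule holomorphic_primitive_UNIV) blast
  note cont = continuous_on_airy_integrand[of UNIV m b]
  obtain C where C: "\<And>s. norm (?h (?w + of_real s)) \<le> C * exp (- \<bar>s\<bar>)"
    using airy_line_bound[OF b] by blast
  have "continuous_on UNIV (\<lambda>s. ?h (?w + of_real s))"
    by (intro continuous_on_compose2[OF cont] continuous_intros) auto
  note line = integrable_exp_decay(1,2)[OF this C]
  have join: "P 0 + e * (LINT s:{0..}|lborel. ?h (0 + of_real s * e)) = P ?w + of_real \<epsilon> * (LINT s:{0..}|lborel. ?h (?w + of_real s * of_real \<epsilon>))"
    if e: "e = Complex (\<epsilon> * (sqrt 3 / 2)) (1 / 2)" "e = cis (pi / 6) \<or> e = cis (5 * pi / 6)" and \<epsilon>: "\<epsilon> = 1 \<or> \<epsilon> = (-1::real)" for e \<epsilon>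
  proof -
    have "((\<lambda>s. P (0 + of_real s * e)) \<longlongrightarrow> P 0 + e * (LINT s:{0..}|lborel. ?h (0 + of_real s * e))) at_top"
      by (rule primitive_along_ray[OF P cont set_integrable_airy_ray[OF e(2)]])
    \<comment> \<open>Reparametrisation by the abscissa: a factor 1 / cos (pi/6) on the ray, and on
      the line a shift by b/2, the real part of the saddle point.\<close>
    moreover have "filterlim (\<lambda>X. 2 / sqrt 3 * X) at_top at_top"
      by (rule filterlim_tendsto_pos_mult_at_top[OF tendsto_const]) (auto intro: filterlim_ident)
    ultimately have "((\<lambda>X. P (0 + of_real (2 / sqrt 3 * X) * e)) \<longlongrightarrow> P 0 + e * (LINT s:{0..}|lborel. ?h (0 + of_real s * e))) at_top"
      by (rule filterlim_compose)
    moreover have "0 + of_real (2 / sqrt 3 * X) * e = Complex (\<epsilon> * X) (X / sqrt 3)" for X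
      by (simp add: e(1) complex_eq_iff)
    ultimately have 1: "((\<lambda>X. P (Complex (\<epsilon> * X) (X / sqrt 3))) \<longlongrightarrow> P 0 + e * (LINT s:{0..}|lborel. ?h (0 + of_real s * e))) at_top"
      by simp
    have "set_integrable lborel {0..} (\<lambda>s. ?h (?w + of_real s * of_real \<epsilon>))"
      using line \<epsilon> by auto
    then have "((\<lambda>s. P (?w + of_real s * of_real \<epsilon>)) \<longlongrightarrow> P ?w + of_real \<epsilon> * (LINT s:{0..}|lborel. ?h (?w + of_real s * of_real \<epsilon>))) at_top"
      by (rule primitive_along_ray[OF P cont])
    moreover have "filterlim (\<lambda>X. - (\<epsilon> * b / 2) + X) at_top at_top"
      by (rule filterlim_tendsto_add_at_top[OF tendsto_const filterlim_ident])
    ultimately have "((\<lambda>X. P (?w + of_real (- (\<epsilon> * b / 2) + X) * of_real \<epsilon>)) \<longlongrightarrow> P ?w + of_real \<epsilon> * (LINT s:{0..}|lborel. ?h (?w + of_real s * of_real \<epsilon>))) at_top"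
      by (rule filterlim_compose)
    moreover have "?w + of_real (- (\<epsilon> * b / 2) + X) * of_real \<epsilon> = Complex (\<epsilon> * X) (sqrt 3 / 2 * b)" for X
      using \<epsilon> by (auto simp: cis_pi_3 complex_eq_iff)
    ultimately have 2: "((\<lambda>X. P (Complex (\<epsilon> * X) (sqrt 3 / 2 * b))) \<longlongrightarrow> P ?w + of_real \<epsilon> * (LINT s:{0..}|lborel. ?h (?w + of_real s * of_real \<epsilon>))) at_top"
      by simp
    from tendsto_diff[OF 1 2] airy_far_segment[OF P b \<epsilon>]
    have "P 0 + e * (LINT s:{0..}|lborel. ?h (0 + of_real s * e)) - (P ?w + of_real \<epsilon> * (LINT s:{0..}|lborel. ?h (?w + of_real s * of_real \<epsilon>))) = 0"
      by (rule tendsto_unique[OF trivial_limit_at_top_linorder])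
    then show ?thesis by simp
  qed
  have "P 0 + cis (pi / 6) * (LINT s:{0..}|lborel. ?h (of_real s * cis (pi / 6))) = P ?w + (LINT s:{0..}|lborel. ?h (?w + of_real s))"
    using join[of "cis (pi / 6)" 1] by (simp add: cis_pi_6)
  moreover have "P 0 + cis (5 * pi / 6) * (LINT s:{0..}|lborel. ?h (of_real s * cis (5 * pi / 6))) = P ?w - (LINT s:{0..}|lborel. ?h (?w + of_real (- s)))"
    using join[of "cis (5 * pi / 6)" "-1"] by (simp add: cis_5_pi_6)
  moreover have "(\<integral>s. ?h (?w + of_real s) \<partial>lborel) = (LINT s:{0..}|lborel. ?h (?w + of_real s)) + (LINT s:{0..}|lborel. ?h (?w + of_real (- s)))"
    using integrable_split_half_lines[OF line] by (simp add: has_bochner_integral_iff)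
  moreover have "a + x = c + j \<Longrightarrow> a + y = c - j' \<Longrightarrow> k = j + j' \<Longrightarrow> x - y = k" for a x y c j j' k :: complex
    using add_diff_cancel_left[of a x y] by simp
  ultimately show ?thesis by blast
qed

section \<open>Power series at the origin and identification of Ai and Bi\<close>

definition airy_moment :: "nat \<Rightarrow> real" where
  "airy_moment n = (LINT s:{0..}|lborel. s ^ n * exp (- (2 / 3 * s ^ 3)))"

lemma set_integrable_airy_moment:
  "set_integrable lborel {0..} (\<lambda>s::real. s ^ n * exp (c * s - 2 / 3 * s ^ 3))"
proof -
  obtain C where C: "C > 0" "\<And>s::real. s \<ge> 0 \<Longrightarrow> s ^ n * exp (c * s - 2 / 3 * s ^ 3) \<le> C * exp (- s)"
    using cubic_decay[of n c] by blast
  show ?thesis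
    by (rule set_integrable_exp_decay[where C = C]) (use C in \<open>auto intro!: continuous_intros\<close>)
qed

text \<open>The substitution t = 2/3 s^3 in Euler's integral for the Gamma function.\<close>

lemma airy_moment_eq:
  "airy_moment n = (3 / 2) powr ((real n + 1) / 3) / 3 * Gamma ((real n + 1) / 3)"
proof -
  define x where "x = (real n + 1) / 3"
  have x: "x > 0" by (simp add: x_def)
  define f where "f t = t powr (x - 1) / exp t" for t :: real
  have "(f has_integral Gamma x) {0..}" unfolding f_def by (rule Gamma_integral_real[OF x])
  moreover have "(f has_integral Gamma x) {0..} \<longleftrightarrow> (f has_integral Gamma x) {0<..}"
    by (rule has_integral_spike_set_eq) (auto intro: negligible_subset[of "{0}"])
  ultimately have "(f has_integral Gamma x) {0<..}" by simp
  then have "f absolutely_integrable_on {0<..} \<and> integral {0<..} f = Gamma x"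
    by (auto simp: has_integral_iff f_def intro!: nonnegative_absolutely_integrable_1)
  moreover have "(\<lambda>s::real. 2 / 3 * s ^ 3) ` {0<..} = {0<..}"
  proof (intro equalityI subsetI)
    fix t :: real assume "t \<in> {0<..}"
    then have "t = 2 / 3 * (root 3 (3 / 2 * t)) ^ 3" "root 3 (3 / 2 * t) \<in> {0<..}" by simp_all
    then show "t \<in> (\<lambda>s. 2 / 3 * s ^ 3) ` {0<..}" by blast
  qed auto
  moreover have "inj_on (\<lambda>s::real. 2 / 3 * s ^ 3) {0<..}"
    by (auto simp: inj_on_def power_eq_iff_eq_base)
  moreover have "((\<lambda>s. 2 / 3 * s ^ 3) has_field_derivative 2 * s\<^sup>2) (at s within {0<..})" for s :: real
    by (auto intro!: derivative_eq_intros simp: power2_eq_square)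
  ultimately have "integral {0<..} (\<lambda>s. \<bar>2 * s\<^sup>2\<bar> * f (2 / 3 * s ^ 3)) = Gamma x"
    using has_absolute_integral_change_of_variables_1'[of "{0<..}" "\<lambda>s. 2 / 3 * s ^ 3" "\<lambda>s. 2 * s\<^sup>2" f "Gamma x"]
    by (simp only:) simp
  also have "integral {0<..} (\<lambda>s. \<bar>2 * s\<^sup>2\<bar> * f (2 / 3 * s ^ 3)) =
      integral {0<..} (\<lambda>s. 2 * (2 / 3) powr (x - 1) * (s ^ n * exp (- (2 / 3 * s ^ 3))))"
  proof (rule integral_cong)
    fix s :: real assume "s \<in> {0<..}"
    then have s: "s > 0" by simp
    have "s\<^sup>2 = s powr 2" "(s ^ 3) powr (x - 1) = s powr (3 * (x - 1))"
      using s by (simp_all add: powr_powr flip: powr_numeral)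
    then have "s\<^sup>2 * (s ^ 3) powr (x - 1) = s powr (2 + 3 * (x - 1))"
      by (simp only: powr_add)
    also have "2 + 3 * (x - 1) = real n" by (simp add: x_def field_simps)
    also have "s powr real n = s ^ n" using s by (rule powr_realpow)
    finally have eq: "s\<^sup>2 * (s ^ 3) powr (x - 1) = s ^ n" .
    define y where "y = 2 / 3 * s ^ 3"
    have y: "y powr (x - 1) = (2 / 3) powr (x - 1) * (s ^ 3) powr (x - 1)"
      unfolding y_def by (rule powr_mult)
    have "\<bar>2 * s\<^sup>2\<bar> * f (2 / 3 * s ^ 3) = 2 * (2 / 3) powr (x - 1) * (s\<^sup>2 * (s ^ 3) powr (x - 1)) * exp (- (2 / 3 * s ^ 3))"
      unfolding f_def y_def[symmetric] y by (simp add: exp_minus field_simps)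
    then show "\<bar>2 * s\<^sup>2\<bar> * f (2 / 3 * s ^ 3) = 2 * (2 / 3) powr (x - 1) * (s ^ n * exp (- (2 / 3 * s ^ 3)))"
      unfolding eq by (simp only: mult.assoc)
  qed
  also have "\<dots> = 2 * (2 / 3) powr (x - 1) * integral {0<..} (\<lambda>s. s ^ n * exp (- (2 / 3 * s ^ 3)))"
    by simp
  also have "integral {0<..} (\<lambda>s. s ^ n * exp (- (2 / 3 * s ^ 3))) = integral {0..} (\<lambda>s. s ^ n * exp (- (2 / 3 * s ^ 3)) :: real)"
    by (rule integral_spike_set) (auto intro: negligible_subset[of "{0}"])
  also have "\<dots> = airy_moment n"
    unfolding airy_moment_def using set_integrable_airy_moment[of n 0]
    by (simp add: set_borel_integral_eq_integral)
  finally have "2 * (2 / 3) powr (x - 1) * airy_moment n = Gamma x" .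
  moreover have "2 * (2 / 3) powr (x - 1) = 3 * (2 / 3) powr x" by (simp add: powr_diff)
  moreover have "(2 / 3) powr x * (3 / 2) powr x = (1::real)" by (simp flip: powr_mult)
  moreover have "airy_moment n * 3 * ((2 / 3) powr x * (3 / 2) powr x) = (3 * (2 / 3) powr x * airy_moment n) * (3 / 2) powr x"
    by (simp only: mult_ac)
  ultimately have "airy_moment n = (3 / 2) powr x / 3 * Gamma x" by (simp add: field_simps)
  then show ?thesis by (simp add: x_def)
qed

lemma airy_moment_rec: "airy_moment (n + 3) = (real n + 1) / 2 * airy_moment n"
proof -
  define x where "x = (real n + 1) / 3"
  have "(real (n + 3) + 1) / 3 = x + 1" by (simp add: x_def)
  then have "airy_moment (n + 3) = (3 / 2) powr (x + 1) / 3 * Gamma (x + 1)"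
    using airy_moment_eq[of "n + 3"] by (simp only:)
  moreover have "airy_moment n = (3 / 2) powr x / 3 * Gamma x"
    by (simp only: airy_moment_eq x_def)
  moreover have "Gamma (x + 1) = x * Gamma x"
    by (intro Gamma_plus1) (auto dest: nonpos_Ints_nonpos simp: x_def)
  ultimately have "airy_moment (n + 3) = (3 / 2 * x) * airy_moment n"
    by (simp add: powr_add)
  moreover have "3 / 2 * x = (real n + 1) / 2" by (simp add: x_def)
  ultimately show ?thesis by (simp only:)
qed

text \<open>The series of exp (a s) is integrated term by term. The partial sums of the norms are
  dominated by the same integral with norm a for a, finite because of the cubic decay.\<close>

lemma airy_moment_sums:
  fixes a :: complex
  shows "(\<lambda>n. a ^ n / fact n * of_real (airy_moment (n + m))) sums
    (LINT s:{0..}|lborel. of_real s ^ m * exp (a * of_real s - of_real (2 / 3 * s ^ 3)))"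
proof -
  define f where "f n s = a ^ n / fact n * complex_of_real (indicator {0..} s * (s ^ (n + m) * exp (- (2 / 3 * s ^ 3))))" for n s
  have int_f: "integrable lborel (f n)" for n
    using set_integrable_airy_moment[of "n + m" 0] unfolding f_def
    by (intro integrable_mult_right integrable_of_real) (simp add: set_integrable_def)
  have f_integral: "(\<integral>s. f n s \<partial>lborel) = a ^ n / fact n * of_real (airy_moment (n + m))" for n
    unfolding f_def airy_moment_def
    by (simp only: integral_mult_right_zero integral_complex_of_real set_lebesgue_integral_def real_scaleR_def)
  have norm_f: "norm (f n s) = indicator {0..} s *\<^sub>R (norm a ^ n / fact n * (s ^ (n + m) * exp (- (2 / 3 * s ^ 3))))" for n s
    by (simp add: f_def norm_mult norm_power norm_divide indicator_def)
  have f_sums: "(\<lambda>n. f n s) sums (indicator {0..} s *\<^sub>R (of_real s ^ m * exp (a * of_real s - of_real (2 / 3 * s ^ 3))))" for s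
  proof -
    define E where "E = exp (- (2 / 3 * s ^ 3))"
    define K :: complex where "K = of_real (indicator {0..} s) * (of_real s ^ m * of_real E)"
    have E: "complex_of_real E = exp (- of_real (2 / 3 * s ^ 3))"
      by (simp only: E_def exp_of_real[symmetric] of_real_minus)
    have exp_eq: "exp (a * of_real s - of_real (2 / 3 * s ^ 3)) = exp (a * of_real s) * of_real E"
      by (simp only: E exp_diff exp_minus divide_inverse)
    have K: "indicator {0..} s *\<^sub>R (of_real s ^ m * exp (a * of_real s - of_real (2 / 3 * s ^ 3))) = K * exp (a * of_real s)"
      unfolding exp_eq K_def scaleR_conv_of_real
      by (simp only: mult.assoc mult.commute[of "exp (a * of_real s)" "of_real E"])
    have rearrange: "p * q * (r * (t * u * v)) = r * (u * v) * (q * (p * t))" for p q r t u v :: complex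
      by simp
    have f: "f n s = K * ((a * of_real s) ^ n /\<^sub>R fact n)" for n
      unfolding f_def E_def[symmetric] K_def unfolding of_real_mult of_real_power power_add power_mult_distrib
        scaleR_conv_of_real of_real_inverse of_real_fact divide_inverse
      by (rule rearrange)
    show ?thesis unfolding f K by (rule sums_mult[OF exp_converges])
  qed
  have "(\<lambda>n. \<integral>s. f n s \<partial>lborel) sums (\<integral>s. (\<Sum>n. f n s) \<partial>lborel)"
  proof (rule sums_integral[OF int_f])
    have "summable (\<lambda>n. norm (f n s))" for s
    proof -
      have "summable (\<lambda>n. (norm a * s) ^ n /\<^sub>R fact n)" by (rule summable_exp_generic)
      from summable_mult[OF this, of "indicator {0..} s * (s ^ m * exp (- (2 / 3 * s ^ 3)))"]
      show ?thesis unfolding norm_f by (simp add: power_mult_distrib power_add field_simps)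
    qed
    then show "AE s in lborel. summable (\<lambda>n. norm (f n s))" by simp
    show "summable (\<lambda>n. \<integral>s. norm (f n s) \<partial>lborel)"
    proof (rule bounded_imp_summable)
      fix N
      have "(\<Sum>n\<le>N. \<integral>s. norm (f n s) \<partial>lborel) = (\<integral>s. (\<Sum>n\<le>N. norm (f n s)) \<partial>lborel)"
        using int_f by (subst Bochner_Integration.integral_sum) auto
      also have "\<dots> \<le> (LINT s:{0..}|lborel. s ^ m * exp (norm a * s - 2 / 3 * s ^ 3))"
        unfolding set_lebesgue_integral_def
      proof (rule integral_mono)
        show "integrable lborel (\<lambda>s. \<Sum>n\<le>N. norm (f n s))" using int_f by auto
        show "integrable lborel (\<lambda>s. indicator {0..} s *\<^sub>R (s ^ m * exp (norm a * s - 2 / 3 * s ^ 3)))"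
          using set_integrable_airy_moment[of m "norm a"] by (simp add: set_integrable_def)
        fix s :: real
        show "(\<Sum>n\<le>N. norm (f n s)) \<le> indicator {0..} s *\<^sub>R (s ^ m * exp (norm a * s - 2 / 3 * s ^ 3))"
        proof (cases "s \<ge> 0")
          case True
          have "(\<Sum>n\<le>N. (norm a * s) ^ n /\<^sub>R fact n) \<le> exp (norm a * s)"
            unfolding exp_def using True by (intro sum_le_suminf summable_exp_generic) auto
          then have "(\<Sum>n\<le>N. (norm a * s) ^ n /\<^sub>R fact n) * (s ^ m * exp (- (2 / 3 * s ^ 3))) \<le>
              exp (norm a * s) * (s ^ m * exp (- (2 / 3 * s ^ 3)))"
            using True by (intro mult_right_mono) auto
          also have "\<dots> = indicator {0..} s *\<^sub>R (s ^ m * exp (norm a * s - 2 / 3 * s ^ 3))"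
            using True exp_add[of "norm a * s" "- (2 / 3 * s ^ 3)"] by simp
          also have "(\<Sum>n\<le>N. (norm a * s) ^ n /\<^sub>R fact n) * (s ^ m * exp (- (2 / 3 * s ^ 3))) = (\<Sum>n\<le>N. norm (f n s))"
            unfolding norm_f sum_distrib_right using True
            by (intro sum.cong refl) (simp add: power_mult_distrib power_add field_simps)
          finally show ?thesis .
        qed (simp add: norm_f)
      qed
      finally show "(\<Sum>n\<le>N. \<integral>s. norm (f n s) \<partial>lborel) \<le> (LINT s:{0..}|lborel. s ^ m * exp (norm a * s - 2 / 3 * s ^ 3))" .
    qed simp
  qed
  moreover have "(\<Sum>n. f n s) = indicator {0..} s *\<^sub>R (of_real s ^ m * exp (a * of_real s - of_real (2 / 3 * s ^ 3)))" for s
    using f_sums by (simp add: sums_iff)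
  ultimately show ?thesis by (simp only: f_integral set_lebesgue_integral_def)
qed

text \<open>The n-th derivative at 0 of the contour integral. The directions d = cis (pi/3) and d =
  -1 both satisfy d^3 = -1, so each ray contributes d^(n+1) times the same real moment.\<close>

definition airy_c :: "nat \<Rightarrow> complex" where
  "airy_c n = (cis (pi / 3) ^ (n + 1) - (-1) ^ (n + 1)) * of_real (airy_moment n)"

text \<open>This is f'' = -(z/2) f differentiated n + 1 times at 0, obtained here from the
  functional equation of Gamma.\<close>

lemma airy_c_rec: "airy_c (n + 3) = - of_real ((real n + 1) / 2) * airy_c n"
proof -
  have "cis (pi / 3) ^ 3 = -1" by (simp add: Complex.DeMoivre)
  then have "cis (pi / 3) ^ (3 + (n + 1)) = - (cis (pi / 3) ^ (n + 1))"
    unfolding power_add[of _ 3] by simp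
  then have "cis (pi / 3) ^ (n + 3 + 1) = - (cis (pi / 3) ^ (n + 1))"
    by (simp only: ac_simps)
  moreover have "(-1::complex) ^ (n + 3 + 1) = - ((-1) ^ (n + 1))" by (simp add: power_add)
  ultimately show ?thesis unfolding airy_c_def airy_moment_rec by (simp only: of_real_mult) (simp add: algebra_simps)
qed

text \<open>On each ray the series of exp (z t) integrates term by term, and the extra factor t^m
  merely shifts the index of \<open>airy_c\<close>. Only the summed integrals are then moved to the
  line through the saddle point.\<close>

lemma airy_c_sums:
  assumes "b > 0"
  shows "(\<lambda>n. of_real (2 * b\<^sup>2) ^ n / fact n * airy_c (n + m)) sums
    (cis (pi / 6) ^ (m + 1) * (\<integral>s. airy_integrand m b (of_real b * cis (pi / 3) + of_real s) \<partial>lborel))"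
proof -
  define e1 e2 where "e1 = cis (pi / 6)" and "e2 = cis (5 * pi / 6)"
  define z :: complex where "z = of_real (2 * b\<^sup>2)"
  have e1: "e1 ^ 2 = cis (pi / 3)" "e1 ^ 3 = \<i>" and e12: "e1 * e2 = -1"
    unfolding e1_def e2_def Complex.DeMoivre cis_mult by simp_all
  have "\<i> * e2 ^ 3 = -1" using arg_cong[OF e12, of "\<lambda>x. x ^ 3"] e1(2) by (simp add: power_mult_distrib)
  then have "\<i> * (\<i> * e2 ^ 3) = \<i> * -1" by (rule arg_cong)
  then have "e2 ^ 3 = \<i>" by (simp add: mult.assoc[symmetric])
  note e = e1(1) e12 e1(2) this
  have *: "e1 ^ m * airy_integrand m b (of_real s * e) = (e1 * e) ^ m * (of_real s ^ m * exp (z * (e1 * e) * of_real s - of_real (2 / 3 * s ^ 3)))"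
    if "e ^ 3 = \<i>" for e s
    using that unfolding airy_integrand_def z_def e1_def
    by (simp add: power_mult_distrib algebra_simps)
  have "(\<lambda>n. (e1 * e) ^ (m + 1) * ((z * (e1 * e)) ^ n / fact n * of_real (airy_moment (n + m)))) sums
      (e1 ^ (m + 1) * (e * (LINT s:{0..}|lborel. airy_integrand m b (of_real s * e))))" if "e ^ 3 = \<i>" for e
  proof -
    have "(\<lambda>n. (e1 * e) ^ (m + 1) * ((z * (e1 * e)) ^ n / fact n * of_real (airy_moment (n + m)))) sums
       ((e1 * e) * ((e1 * e) ^ m * (LINT s:{0..}|lborel. of_real s ^ m * exp (z * (e1 * e) * of_real s - of_real (2 / 3 * s ^ 3)))))"
      using sums_mult[OF airy_moment_sums[of "z * (e1 * e)" m], of "(e1 * e) ^ (m + 1)"] by (simp add: mult.assoc)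
    also have "(e1 * e) ^ m * (LINT s:{0..}|lborel. of_real s ^ m * exp (z * (e1 * e) * of_real s - of_real (2 / 3 * s ^ 3))) =
       e1 ^ m * (LINT s:{0..}|lborel. airy_integrand m b (of_real s * e))"
      by (simp only: set_integral_mult_right[symmetric] *[OF that])
    finally show ?thesis by (simp add: mult_ac)
  qed
  from sums_diff[OF this[OF e(3)] this[OF e(4)]]
  have "(\<lambda>n. (e1 * e1) ^ (m + 1) * ((z * (e1 * e1)) ^ n / fact n * of_real (airy_moment (n + m))) -
      (e1 * e2) ^ (m + 1) * ((z * (e1 * e2)) ^ n / fact n * of_real (airy_moment (n + m)))) sums
     (e1 ^ (m + 1) * (\<integral>s. airy_integrand m b (of_real b * cis (pi / 3) + of_real s) \<partial>lborel))"
    unfolding airy_contour_deformation[OF assms, symmetric] by (simp add: e1_def e2_def right_diff_distrib)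
  moreover have "e1 * e1 = cis (pi / 3)" using e(1) by (simp add: power2_eq_square)
  ultimately show ?thesis
    unfolding e(2) e1_def[symmetric] z_def[symmetric] airy_c_def
    by (simp add: power_mult_distrib power_add algebra_simps power_minus[of z])
qed

text \<open>The n-th derivative of \<phi> at 0. The constant 2 powr (-2/3) / pi is the one that
  matches the normalisation of Ai and Bi in \<open>airy_initial_values\<close>.\<close>

definition airy_d :: "complex \<Rightarrow> complex \<Rightarrow> nat \<Rightarrow> complex" where
  "airy_d C1 C2 n = of_real (2 powr (-2/3) / pi) *
     ((C2 - \<i> * C1) * airy_c n + (C2 + \<i> * C1) * cnj (airy_c n))"

lemma airy_d_rec: "airy_d C1 C2 (n + 3) = - of_real ((real n + 1) / 2) * airy_d C1 C2 n"
proof -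
  have "k * (X * (- r * c) + Y * (- r * c')) = - r * (k * (X * c + Y * c'))" for k X Y r c c' :: complex
    by (simp add: algebra_simps)
  moreover have "cnj (- of_real r * c) = - of_real r * cnj c" for r c by simp
  ultimately show ?thesis unfolding airy_d_def airy_c_rec by (simp only:)
qed

text \<open>The reflection formula Gamma (1/3) * Gamma (2/3) = 2 pi / sqrt 3 converts the reciprocal
  Gamma values of the normalisation into the Gamma values of the moments.\<close>

lemma airy_initial_values:
  fixes \<alpha> :: real
  defines "\<alpha> \<equiv> 2 powr (-2/3) / pi"
  shows "3 powr (-2/3) / Gamma (2/3) = \<alpha> * sqrt 3 * airy_moment 0"
    and "3 powr (-1/6) / Gamma (2/3) = 3 * \<alpha> * airy_moment 0"
    and "2 powr (-1/3) * (3 powr (-1/3) / Gamma (1/3)) = \<alpha> * sqrt 3 * airy_moment 1"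
    and "2 powr (-1/3) * (3 powr (1/6) / Gamma (1/3)) = 3 * \<alpha> * airy_moment 1"
proof -
  \<comment> \<open>Cube roots of 2 and 3. In terms of p, t, sqrt 3, pi and u = Gamma (1/3) all four
    identities become rational.\<close>
  define p t :: real where "p = 2 powr (1/3)" and "t = 3 powr (1/3)"
  have pos: "p > 0" "t > 0" by (simp_all add: p_def t_def)
  have cube: "p ^ 3 = 2" "t ^ 3 = 3" by (simp_all add: p_def t_def powr_power)
  have p2: "p\<^sup>2 = 2 / p" using cube(1) pos by (simp add: field_simps power2_eq_square power3_eq_cube)
  have p: "2 powr (-2/3) = p / (2::real)" "2 powr (-1/3) = 1 / (p::real)"
    using powr_diff[of "2::real" "1/3" 1] by (simp_all add: p_def powr_minus_divide)
  have s3: "3 powr (1/2) = sqrt (3::real)" by (rule powr_half_sqrt) simp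
  have "3 powr (1/2 + 1/3 - 1) = sqrt 3 * t / 3" "3 powr (1/2 + 1/3 + 1/3 - 1) = sqrt 3 * t\<^sup>2 / (3::real)"
    "3 powr (1/3 + 1/3 - 1) = t\<^sup>2 / (3::real)" "3 powr (1/3 - 1) = t / (3::real)"
    unfolding powr_diff powr_add s3 t_def[symmetric] by (simp_all add: power2_eq_square)
  then have t: "3 powr (-2/3) = t / 3" "3 powr (-1/3) = t\<^sup>2 / 3" "3 powr (-1/6) = sqrt 3 * t / 3" "3 powr (1/6) = sqrt 3 * t\<^sup>2 / 3"
    by simp_all
  have pt: "(3 / 2) powr (1/3) = t / p" by (simp add: p_def t_def powr_divide)
  moreover have "(3 / 2) powr (1/3 + 1/3) = (t / p)\<^sup>2" unfolding powr_add pt by (simp add: power2_eq_square)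
  ultimately have m: "airy_moment 0 = t / p / 3 * Gamma (1/3)" "airy_moment 1 = (t / p)\<^sup>2 / 3 * Gamma (2/3)"
    by (simp_all add: airy_moment_eq)
  define u v :: real where "u = Gamma (1/3)" and "v = Gamma (2/3)"
  have uv: "u > 0" "v > 0" by (simp_all add: u_def v_def Gamma_real_pos)
  have "complex_of_real u * complex_of_real v = of_real pi / sin (of_real (pi * (1/3)))"
    using Gamma_reflection_complex[of "of_real (1/3)"]
    by (simp add: u_def v_def flip: Gamma_complex_of_real)
  then have "complex_of_real (u * v) = of_real (pi / sin (pi * (1/3)))"
    unfolding sin_of_real by simp
  then have "u * v = pi / sin (pi * (1/3))" by (simp only: of_real_eq_iff)
  then have "u * v * sqrt 3 = 2 * pi" by (simp add: sin_60)
  then have v: "v = 2 * pi / (u * sqrt 3)" using uv by (simp add: field_simps)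
  have sq: "sqrt 3 * sqrt 3 = (3::real)" by simp
  note defs = \<alpha>_def p t m u_def[symmetric] v_def[symmetric] v power_divide p2
  show "3 powr (-2/3) / Gamma (2/3) = \<alpha> * sqrt 3 * airy_moment 0"
    unfolding defs using pos uv pi_gt_zero cube(1) by (simp add: field_simps power3_eq_cube)
  show "3 powr (-1/6) / Gamma (2/3) = 3 * \<alpha> * airy_moment 0"
    unfolding defs using pos uv pi_gt_zero cube(1) by (simp add: field_simps power3_eq_cube)
  show "2 powr (-1/3) * (3 powr (-1/3) / Gamma (1/3)) = \<alpha> * sqrt 3 * airy_moment 1"
    unfolding defs using pos uv pi_gt_zero cube(1) by (simp add: field_simps power3_eq_cube)
  show "2 powr (-1/3) * (3 powr (1/6) / Gamma (1/3)) = 3 * \<alpha> * airy_moment 1"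
    unfolding defs using pos uv pi_gt_zero cube(1) by (simp add: field_simps power3_eq_cube)
qed

lemma airy_c_0_1:
  "airy_c 0 = Complex (3 / 2) (sqrt 3 / 2) * of_real (airy_moment 0)"
  "airy_c 1 = Complex (- 3 / 2) (sqrt 3 / 2) * of_real (airy_moment 1)"
  by (simp_all add: airy_c_def cis_pi_3 complex_eq_iff power2_eq_square)

lemma airy_c_2: "airy_c 2 = 0"
proof -
  have "cis (pi / 3) ^ 3 = -1" by (simp add: Complex.DeMoivre)
  then show ?thesis by (simp add: airy_c_def numeral_eq_Suc)
qed

text \<open>Both sides obey the same recursion of step three, where \<kappa>^3 = 1/2 supplies the
  factor 1/2. The cases n = 0 and n = 1 are the initial values, and at n = 2 both sides
  vanish.\<close>

lemma airy_coeff_eq_airy_d: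
  fixes C1 C2 :: complex
  defines "\<kappa> \<equiv> complex_of_real (2 powr (-1/3))"
  shows "C1 * (airy_coeff (of_real (3 powr (-2/3) / Gamma (2/3))) (of_real (- (3 powr (-1/3) / Gamma (1/3)))) n * (- \<kappa>) ^ n) +
    C2 * (airy_coeff (of_real (3 powr (-1/6) / Gamma (2/3))) (of_real (3 powr (1/6) / Gamma (1/3))) n * (- \<kappa>) ^ n) =
    airy_d C1 C2 n / fact n" (is "?L n = _")
proof -
  let ?\<alpha> = "2 powr (-2/3) / pi"
  have pair: "of_real k * ((C2 - \<i> * C1) * (Complex u v * of_real g) + (C2 + \<i> * C1) * cnj (Complex u v * of_real g)) =
      C1 * of_real (k * (2 * v) * g) + C2 * of_real (k * (2 * u) * g)" for k u v g
    by (simp add: complex_eq_iff algebra_simps)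
  have \<kappa>3: "\<kappa> ^ 3 = 1 / 2"
  proof -
    have "(2 powr (1/3)) ^ 3 = (2 :: real)" by (simp add: powr_power)
    then have "(2 powr (-1/3)) ^ 3 = (1 / 2 :: real)" by (simp add: powr_minus_divide power_divide)
    then show ?thesis unfolding \<kappa>_def by (metis of_real_power of_real_divide of_real_1 of_real_numeral)
  qed
  have step: "?L (m + 3) = - ?L m / (2 * of_nat ((m + 2) * (m + 3)))" for m
  proof -
    have "(- \<kappa>) ^ 3 = - (1 / 2)" using \<kappa>3 by simp
    then have pow: "(- \<kappa>) ^ (m + 3) = (- \<kappa>) ^ m * - (1 / 2)"
      by (simp only: power_add)
    have "m + 3 = Suc (Suc (Suc m))" by simp
    then have coeff: "airy_coeff w0 w1 (m + 3) = airy_coeff w0 w1 m / of_nat ((m + 2) * (m + 3))" for w0 w1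
      by (simp only: airy_coeff.simps)
    have "C1 * (A / N * (P * - (1 / 2))) + C2 * (B / N * (P * - (1 / 2))) = - (C1 * (A * P) + C2 * (B * P)) / (2 * N)" for A B N P :: complex
      by (simp add: add_divide_distrib diff_divide_distrib algebra_simps)
    then show ?thesis unfolding pow coeff .
  qed
  have fact3: "fact (m + 3) = (of_nat (m + 1) * of_nat ((m + 2) * (m + 3)) * fact m :: complex)" for m
    by (simp add: numeral_eq_Suc algebra_simps)
  show ?thesis
  proof (induction n rule: less_induct)
    case (less n)
    consider "n = 0" | "n = 1" | "n = 2" | m where "n = m + 3"
      by (metis One_nat_def Suc_1 add.commute less_2_cases linorder_not_less nat_le_iff_add numeral_3_eq_3 less_Suc_eq)
    then show ?case
    proof cases
      case 1
      have "?L 0 = C1 * of_real (?\<alpha> * sqrt 3 * airy_moment 0) + C2 * of_real (3 * ?\<alpha> * airy_moment 0)"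
        by (simp only: airy_coeff.simps airy_initial_values(1,2)) simp
      also have "\<dots> = C1 * of_real (?\<alpha> * (2 * (sqrt 3 / 2)) * airy_moment 0) + C2 * of_real (?\<alpha> * (2 * (3 / 2)) * airy_moment 0)"
        by simp
      also have "\<dots> = airy_d C1 C2 0" unfolding airy_d_def airy_c_0_1 pair ..
      finally show ?thesis using 1 by simp
    next
      case 2
      have "?L 1 = C1 * of_real (2 powr (-1/3) * (3 powr (-1/3) / Gamma (1/3))) - C2 * of_real (2 powr (-1/3) * (3 powr (1/6) / Gamma (1/3)))"
        by (simp add: \<kappa>_def mult_ac)
      also have "\<dots> = C1 * of_real (?\<alpha> * sqrt 3 * airy_moment 1) - C2 * of_real (3 * ?\<alpha> * airy_moment 1)"
        unfolding airy_initial_values(3,4) ..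
      also have "\<dots> = C1 * of_real (?\<alpha> * (2 * (sqrt 3 / 2)) * airy_moment 1) + C2 * of_real (?\<alpha> * (2 * (- 3 / 2)) * airy_moment 1)"
        by simp
      also have "\<dots> = airy_d C1 C2 1" unfolding airy_d_def airy_c_0_1 pair ..
      finally show ?thesis using 2 by simp
    next
      case 3
      then have "?L n = 0" by (simp add: numeral_2_eq_2)
      moreover have "airy_d C1 C2 n = 0" using 3 by (simp add: airy_d_def airy_c_2)
      ultimately show ?thesis by simp
    next
      case 4
      have "?L n = - (airy_d C1 C2 m / fact m) / (2 * of_nat ((m + 2) * (m + 3)))"
        unfolding 4 step using less[of m] 4 by simp
      also have "\<dots> = airy_d C1 C2 n / fact n"
      proof -
        have "of_nat ((m + 2) * (m + 3)) \<noteq> (0::complex)" "of_nat (m + 1) \<noteq> (0::complex)"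
          by (simp_all only: of_nat_eq_0_iff) simp_all
        moreover have "of_real ((real m + 1) / 2) = (of_nat (m + 1) / 2 :: complex)" by simp
        ultimately show ?thesis unfolding 4 airy_d_rec fact3 by (simp only:) (simp add: field_simps del: of_nat_mult of_nat_add of_nat_Suc)
      qed
      finally show ?thesis .
    qed
  qed
qed

lemma airy_d_sums: "(\<lambda>n. airy_d C1 C2 n / fact n * z ^ n) sums airy_phi C1 C2 z"
proof -
  let ?\<kappa> = "complex_of_real (2 powr (-1/3))"
  have "(\<lambda>n. airy_coeff w0 w1 n * (- ?\<kappa> * z) ^ n) sums airy_sol w0 w1 (- ?\<kappa> * z)" for w0 w1
    unfolding airy_sol_def by (rule summable_sums[OF summable_airy_coeff])
  then have *: "(\<lambda>n. airy_coeff w0 w1 n * (- ?\<kappa>) ^ n * z ^ n) sums airy_sol w0 w1 (- ?\<kappa> * z)" for w0 w1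
    by (simp only: power_mult_distrib mult.assoc)
  show ?thesis
    using sums_add[OF sums_mult[OF *, of C1] sums_mult[OF *, of C2]]
    unfolding airy_phi_def Ai_def Bi_def airy_coeff_eq_airy_d[symmetric] distrib_right mult.assoc by blast
qed

text \<open>With coefficients d n / n! differentiation is an index shift, so derivatives of \<phi>
  are obtained without differentiating under the integral sign.\<close>

lemma higher_deriv_exponential_series:
  fixes d :: "nat \<Rightarrow> complex"
  assumes "\<And>z. (\<lambda>n. d n / fact n * z ^ n) sums f z"
  shows "(\<lambda>n. d (n + m) / fact n * z ^ n) sums (deriv ^^ m) f z"
proof (induction m arbitrary: z)
  case (Suc m)
  let ?c = "\<lambda>n. d (n + m) / fact n"
  have sm: "summable (\<lambda>n. ?c n * z ^ n)" for z using Suc by (rule sums_summable)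
  have diffs: "diffs ?c = (\<lambda>n. d (n + Suc m) / fact n)"
    by (simp add: diffs_def fun_eq_iff del: of_nat_Suc)
  have "((\<lambda>z. \<Sum>n. ?c n * z ^ n) has_field_derivative (\<Sum>n. diffs ?c n * z ^ n)) (at z)"
    by (rule termdiffs_strong_converges_everywhere) (rule sm)
  moreover have "(\<lambda>z. \<Sum>n. ?c n * z ^ n) = (deriv ^^ m) f"
    using Suc by (simp add: sums_iff fun_eq_iff)
  ultimately have "(deriv ^^ Suc m) f z = (\<Sum>n. diffs ?c n * z ^ n)"
    by (simp add: DERIV_imp_deriv)
  moreover have "summable (\<lambda>n. diffs ?c n * z ^ n)"
    by (rule termdiff_converges_all) (rule sm)
  ultimately show ?case unfolding diffs by (simp add: sums_iff)
qed (use assms in simp)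

text \<open>The factor restores t^m and dt after t = cis (pi / 6) * w, so this is the m-th
  derivative of the contour integral at z = 2b^2.\<close>

definition airy_saddle :: "nat \<Rightarrow> real \<Rightarrow> complex" where
  "airy_saddle m b = cis (pi / 6) ^ (m + 1) *
     (\<integral>s. airy_integrand m b (of_real b * cis (pi / 3) + of_real s) \<partial>lborel)"

lemma higher_deriv_airy_phi:
  assumes "b > 0"
  shows "(deriv ^^ m) (airy_phi C1 C2) (of_real (2 * b\<^sup>2)) =
    of_real (2 powr (-2/3) / pi) * ((C2 - \<i> * C1) * airy_saddle m b + (C2 + \<i> * C1) * cnj (airy_saddle m b))"
proof -
  let ?z = "complex_of_real (2 * b\<^sup>2)"
  have 1: "(\<lambda>n. ?z ^ n / fact n * airy_c (n + m)) sums airy_saddle m b"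
    unfolding airy_saddle_def by (rule airy_c_sums[OF assms])
  then have 2: "(\<lambda>n. cnj (?z ^ n / fact n * airy_c (n + m))) sums cnj (airy_saddle m b)"
    by (subst sums_cnj)
  have real: "cnj (?z ^ n / fact n) = ?z ^ n / fact n" for n by simp
  have rearrange: "k * (X * (u / v * c) + Y * (u / v * c')) = k * (X * c + Y * c') / v * u" for k X Y u v c c' :: complex
    by (simp add: add_divide_distrib algebra_simps)
  have "(\<lambda>n. airy_d C1 C2 (n + m) / fact n * ?z ^ n) sums
     (of_real (2 powr (-2/3) / pi) * ((C2 - \<i> * C1) * airy_saddle m b + (C2 + \<i> * C1) * cnj (airy_saddle m b)))"
    using sums_mult[OF sums_add[OF sums_mult[OF 1, of "C2 - \<i> * C1"] sums_mult[OF 2, of "C2 + \<i> * C1"]], of "of_real (2 powr (-2/3) / pi)"]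
    unfolding airy_d_def complex_cnj_mult[of "?z ^ _ / fact _"] real rearrange .
  with higher_deriv_exponential_series[OF airy_d_sums] show ?thesis by (rule sums_unique2)
qed

section \<open>The integral at the saddle point\<close>

text \<open>The integrand along the saddle line, measured in Gaussian widths and without its value
  at the saddle point. It is defined for every real \<epsilon>, although only \<epsilon> > 0 comes
  from some z: 0 gives the limit and negative \<epsilon> the parity.\<close>

definition airy_kernel :: "real \<Rightarrow> real \<Rightarrow> complex" where
  "airy_kernel \<epsilon> x = exp (- cis (- pi / 6) * of_real (x\<^sup>2) + \<i> * of_real (2 / 3 * \<epsilon> * x ^ 3))"

definition airy_h :: "nat \<Rightarrow> real \<Rightarrow> complex" where
  "airy_h k \<epsilon> = cis (pi / 6) ^ (k + 1) * (\<integral>x. of_real x ^ k * airy_kernel \<epsilon> x \<partial>lborel)"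

lemma norm_airy_kernel: "norm (airy_kernel \<epsilon> x) = exp (- (sqrt 3 / 2) * x\<^sup>2)"
  unfolding airy_kernel_def norm_exp_eq_Re by (simp add: cos_30)

lemma continuous_airy_kernel: "continuous_on A (airy_kernel \<epsilon>)"
  unfolding airy_kernel_def[abs_def] by (intro continuous_intros)

lemma integrable_power_airy_kernel: "integrable lborel (\<lambda>x. of_real x ^ k * airy_kernel \<epsilon> x)"
proof -
  obtain C where C: "C > 0" "\<And>x. \<bar>x\<bar> ^ k * exp (0 * \<bar>x\<bar> - sqrt 3 / 2 * x\<^sup>2) \<le> C * exp (- \<bar>x\<bar>)"
    using quadratic_decay[of "sqrt 3 / 2" k 0] by auto
  show ?thesis
  proof (rule integrable_exp_decay(3))
    show "continuous_on UNIV (\<lambda>x. of_real x ^ k * airy_kernel \<epsilon> x)"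
      by (intro continuous_intros continuous_airy_kernel)
    show "norm (of_real x ^ k * airy_kernel \<epsilon> x) \<le> C * exp (- \<bar>x\<bar>)" for x
      using C(2)[of x] by (simp add: norm_mult norm_power norm_airy_kernel)
  qed
qed

lemma taylor_coeff_sum:
  fixes T :: "bool \<Rightarrow> 'a::comm_ring_1"
  assumes "j < n"
  shows "(T s + u) ^ j = (\<Sum>a<n. taylor_coeff T j (s, a) * u ^ a)"
proof -
  have "(T s + u) ^ j = (\<Sum>a\<le>j. taylor_coeff T j (s, a) * u ^ a)"
    unfolding add.commute[of "T s"] binomial_ring by (simp add: taylor_coeff_def mult_ac)
  also have "\<dots> = (\<Sum>a<n. taylor_coeff T j (s, a) * u ^ a)"
    using assms by (intro sum.mono_neutral_left) (auto simp: taylor_coeff_def binomial_eq_0)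
  finally show ?thesis .
qed

text \<open>Here \<open>b = 1 / (2\<sigma>\<^sup>2)\<close>, so that \<open>\<sigma>\<close> is the width of the Gaussian at the saddle point,
  and \<open>\<sigma> / b = 2\<sigma>\<^sup>3\<close>.\<close>

lemma airy_integrand_saddle:
  assumes "\<sigma> > 0" "b = 1 / (2 * \<sigma>\<^sup>2)"
  shows "cis (pi / 6) ^ m * airy_integrand m b (of_real b * cis (pi / 3) + of_real (0 + \<sigma> * x)) =
    cis (4 / 3 * b ^ 3) * of_real b ^ m * ((\<i> + of_real (2 * \<sigma> ^ 3) * cis (pi / 6) * of_real x) ^ m * airy_kernel (\<sigma> ^ 3) x)"
proof -
  define e where "e = cis (pi / 6)"
  define w where "w = of_real b * cis (pi / 3) + complex_of_real (\<sigma> * x)"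
  define q where "q = cis (- pi / 6)"
  have b: "complex_of_real b * of_real (2 * \<sigma> ^ 3) = of_real \<sigma>" "of_real (2 * b) * of_real (\<sigma>\<^sup>2) = (1::complex)"
    using assms by (simp_all add: field_simps power2_eq_square power3_eq_cube flip: of_real_mult)
  have e: "e * cis (pi / 3) = \<i>"
    by (simp add: e_def cis_mult)
  have "e * w = of_real b * (e * cis (pi / 3)) + of_real \<sigma> * e * of_real x"
    unfolding w_def by (simp add: algebra_simps)
  then have "e * w = of_real b * (\<i> + of_real (2 * \<sigma> ^ 3) * e * of_real x)"
    unfolding e b(1)[symmetric] by (simp only: distrib_left mult.assoc)
  then have pow: "e ^ m * w ^ m = of_real b ^ m * (\<i> + of_real (2 * \<sigma> ^ 3) * e * of_real x) ^ m"
    by (metis power_mult_distrib)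
  define c where "c = cis (pi / 3)"
  have c3: "c ^ 3 = -1" by (simp add: c_def Complex.DeMoivre)
  \<comment> \<open>\<open>\<i> * c\<^sup>2 = - e\<close> is the saddle-point equation and cancels
    the terms linear in S. \<open>e * c = \<i>\<close> enters the constant term and
    \<open>\<i> * c = - q\<close> the Gaussian one.\<close>
  have c: "\<i> * c\<^sup>2 = - e" "e * c = \<i>" "\<i> * c = - q"
    unfolding c_def e_def q_def
    by (simp_all add: Complex.DeMoivre cis_mult cis_pi_6 cis_pi_3 complex_eq_iff power2_eq_square cos_30 sin_30)
  have "2 / 3 * \<i> * w ^ 3 + of_real (2 * b\<^sup>2) * e * w =
     \<i> * of_real (4 / 3 * b ^ 3) + (- q * of_real (x\<^sup>2) + \<i> * of_real (2 / 3 * \<sigma> ^ 3 * x ^ 3))"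
  proof -
    define B S where "B = complex_of_real b" and "S = complex_of_real (\<sigma> * x)"
    have BS: "2 * B * S\<^sup>2 = of_real (x\<^sup>2)"
      using b(2) by (simp add: B_def S_def power_mult_distrib mult.assoc)
    have "2 / 3 * \<i> * (B * c + S) ^ 3 + 2 * B\<^sup>2 * e * (B * c + S) =
      2 / 3 * \<i> * B ^ 3 * c ^ 3 + 2 * B\<^sup>2 * S * (\<i> * c\<^sup>2) + 2 * B * S\<^sup>2 * (\<i> * c) + 2 / 3 * \<i> * S ^ 3 +
      2 * B ^ 3 * (e * c) + 2 * B\<^sup>2 * S * e"
      by (simp add: power2_eq_square power3_eq_cube field_simps)
    also have "\<dots> = \<i> * (4 / 3 * B ^ 3) + (- q * (2 * B * S\<^sup>2) + \<i> * (2 / 3 * S ^ 3))"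
      unfolding c c3 by (simp add: field_simps)
    finally show ?thesis
      unfolding BS unfolding w_def B_def S_def c_def by (simp add: power_mult_distrib mult.assoc)
  qed
  then have "exp (2 / 3 * \<i> * w ^ 3 + of_real (2 * b\<^sup>2) * e * w) = cis (4 / 3 * b ^ 3) * airy_kernel (\<sigma> ^ 3) x"
    by (simp only: exp_add airy_kernel_def q_def cis_conv_exp)
  then have "e ^ m * airy_integrand m b w = (e ^ m * w ^ m) * (cis (4 / 3 * b ^ 3) * airy_kernel (\<sigma> ^ 3) x)"
    unfolding airy_integrand_def e_def[symmetric] by (simp only: mult.assoc)
  then have "e ^ m * airy_integrand m b w = cis (4 / 3 * b ^ 3) * of_real b ^ m * ((\<i> + of_real (2 * \<sigma> ^ 3) * e * of_real x) ^ m * airy_kernel (\<sigma> ^ 3) x)"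
    unfolding pow by (simp only: mult_ac)
  then show ?thesis unfolding w_def e_def by (simp only: add_0_left)
qed

text \<open>The power t^(j+k) is split into t^j and t^k, and each factor is expanded about the
  saddle point on its own; this puts the constant matrix of Taylor coefficients on both sides of the
  Hankel block.\<close>

lemma airy_saddle_expand:
  fixes T :: "bool \<Rightarrow> complex"
  assumes \<sigma>: "\<sigma> > 0" "b = 1 / (2 * \<sigma>\<^sup>2)" and T: "T False = \<i>" and jk: "j < n" "k < n"
  shows "airy_saddle (j + k) b = of_real b ^ (j + k) * of_real \<sigma> * (\<Sum>a<n. \<Sum>a'<n. taylor_coeff T j (False, a) *
     (cis (4 / 3 * b ^ 3) * of_real (2 * \<sigma> ^ 3) ^ (a + a') * airy_h (a + a') (\<sigma> ^ 3)) * taylor_coeff T k (False, a'))"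
proof -
  let ?m = "j + k" and ?e = "cis (pi / 6)" and ?u = "of_real (2 * \<sigma> ^ 3) * cis (pi / 6)"
  have "airy_saddle ?m b = ?e * (\<integral>s. ?e ^ ?m * airy_integrand ?m b (of_real b * cis (pi / 3) + of_real s) \<partial>lborel)"
    by (simp add: airy_saddle_def)
  also have "(\<integral>s. ?e ^ ?m * airy_integrand ?m b (of_real b * cis (pi / 3) + of_real s) \<partial>lborel) =
      \<bar>\<sigma>\<bar> *\<^sub>R (\<integral>x. ?e ^ ?m * airy_integrand ?m b (of_real b * cis (pi / 3) + of_real (0 + \<sigma> * x)) \<partial>lborel)"
    using \<sigma> by (intro lborel_integral_real_affine) simp
  also have "\<dots> = of_real \<sigma> * (\<integral>x. cis (4 / 3 * b ^ 3) * of_real b ^ ?m * ((\<i> + ?u * of_real x) ^ ?m * airy_kernel (\<sigma> ^ 3) x) \<partial>lborel)"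
    unfolding airy_integrand_saddle[OF \<sigma>] using \<sigma> by (simp add: scaleR_conv_of_real)
  also have "\<dots> = of_real \<sigma> * (cis (4 / 3 * b ^ 3) * of_real b ^ ?m * (\<integral>x. (\<i> + ?u * of_real x) ^ ?m * airy_kernel (\<sigma> ^ 3) x \<partial>lborel))"
    by (simp only: integral_mult_right_zero)
  also have "(\<integral>x. (\<i> + ?u * of_real x) ^ ?m * airy_kernel (\<sigma> ^ 3) x \<partial>lborel) =
     (\<integral>x. (\<Sum>a<n. \<Sum>a'<n. taylor_coeff T j (False, a) * taylor_coeff T k (False, a') * ?u ^ (a + a') * (of_real x ^ (a + a') * airy_kernel (\<sigma> ^ 3) x)) \<partial>lborel)"
  proof (rule Bochner_Integration.integral_cong[OF refl])
    fix x
    have "(\<i> + ?u * of_real x) ^ ?m = (\<Sum>a<n. taylor_coeff T j (False, a) * (?u * of_real x) ^ a) * (\<Sum>a<n. taylor_coeff T k (False, a) * (?u * of_real x) ^ a)"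
      unfolding power_add T[symmetric] taylor_coeff_sum[OF jk(1)] taylor_coeff_sum[OF jk(2)] ..
    also have "\<dots> = (\<Sum>a<n. \<Sum>a'<n. taylor_coeff T j (False, a) * taylor_coeff T k (False, a') * ?u ^ (a + a') * of_real x ^ (a + a'))"
      unfolding sum_product by (intro sum.cong refl) (simp add: power_mult_distrib power_add mult_ac)
    finally show "(\<i> + ?u * of_real x) ^ ?m * airy_kernel (\<sigma> ^ 3) x = (\<Sum>a<n. \<Sum>a'<n. taylor_coeff T j (False, a) * taylor_coeff T k (False, a') * ?u ^ (a + a') * (of_real x ^ (a + a') * airy_kernel (\<sigma> ^ 3) x))"
      by (simp only: sum_distrib_right mult.assoc)
  qed
  also have "\<dots> = (\<Sum>a<n. \<Sum>a'<n. taylor_coeff T j (False, a) * taylor_coeff T k (False, a') * ?u ^ (a + a') * (\<integral>x. of_real x ^ (a + a') * airy_kernel (\<sigma> ^ 3) x \<partial>lborel))"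
    using integrable_power_airy_kernel
    by (simp add: Bochner_Integration.integral_sum)
  finally show ?thesis
    by (simp add: airy_h_def sum_distrib_left power_mult_distrib mult_ac)
qed

section \<open>Asymptotic power series\<close>

text \<open>An estimate on all of [-1, 1] rather than a limit from the right: it contains \<epsilon>
  = 0, where the function equals its leading coefficient, and it can be reflected.\<close>

definition has_expansion :: "(real \<Rightarrow> complex) \<Rightarrow> (nat \<Rightarrow> complex) \<Rightarrow> bool" where
  "has_expansion J a \<longleftrightarrow> (\<forall>N. \<exists>C. \<forall>\<epsilon>. \<bar>\<epsilon>\<bar> \<le> 1 \<longrightarrow>
     norm (J \<epsilon> - (\<Sum>j<N. a j * of_real \<epsilon> ^ j)) \<le> C * \<bar>\<epsilon>\<bar> ^ N)"

lemma has_expansionE: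
  assumes "has_expansion J a"
  obtains C where "C \<ge> 0" "\<And>\<epsilon>. \<bar>\<epsilon>\<bar> \<le> 1 \<Longrightarrow> norm (J \<epsilon> - (\<Sum>j<N. a j * of_real \<epsilon> ^ j)) \<le> C * \<bar>\<epsilon>\<bar> ^ N"
proof -
  from assms obtain C where C: "\<And>\<epsilon>. \<bar>\<epsilon>\<bar> \<le> 1 \<Longrightarrow> norm (J \<epsilon> - (\<Sum>j<N. a j * of_real \<epsilon> ^ j)) \<le> C * \<bar>\<epsilon>\<bar> ^ N"
    unfolding has_expansion_def by meson
  have "norm (J 1 - (\<Sum>j<N. a j * of_real 1 ^ j)) \<le> C" using C[of 1] by simp
  then have "C \<ge> 0" using norm_ge_zero order.trans by blast
  with C that show ?thesis by blast
qed

lemma has_expansion_value_0: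
  assumes "has_expansion J a"
  shows "J 0 = a 0"
proof -
  obtain C where "C \<ge> 0" "\<And>\<epsilon>. \<bar>\<epsilon>\<bar> \<le> 1 \<Longrightarrow> norm (J \<epsilon> - (\<Sum>j<1. a j * of_real \<epsilon> ^ j)) \<le> C * \<bar>\<epsilon>\<bar> ^ 1"
    using assms by (rule has_expansionE[where N = 1]) (rule that)
  from this(2)[of 0] show ?thesis by simp
qed

lemma has_expansion_const: "has_expansion (\<lambda>_. c) (\<lambda>j. if j = 0 then c else 0)"
  unfolding has_expansion_def
proof (standard, goal_cases)
  case (1 N)
  have "c - (\<Sum>j<N. (if j = 0 then c else 0) * of_real \<epsilon> ^ j) = (if N = 0 then c else 0)" for \<epsilon> :: real
    by (cases N) (simp_all add: sum.lessThan_Suc_shift del: sum.lessThan_Suc)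
  then show ?case
    by (intro exI[of _ "norm c"]) auto
qed

lemma has_expansion_ident: "has_expansion of_real (\<lambda>j. if j = 1 then 1 else 0)"
  unfolding has_expansion_def
proof (standard, goal_cases)
  case (1 N)
  have "of_real \<epsilon> - (\<Sum>j<N. (if j = 1 then 1 else 0) * of_real \<epsilon> ^ j) = (if N \<le> 1 then of_real \<epsilon> else 0 :: complex)" for \<epsilon> :: real
  proof -
    have "(\<Sum>j<N. (if j = 1 then 1 else 0) * of_real \<epsilon> ^ j) = (\<Sum>j<N. if j = 1 then of_real \<epsilon> else 0 :: complex)"
      by (intro sum.cong) auto
    then show ?thesis by simp
  qed
  then show ?case
    by (intro exI[of _ 1]) (auto simp: le_Suc_eq)
qed

lemma has_expansion_add:
  assumes "has_expansion J a" "has_expansion K b"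
  shows "has_expansion (\<lambda>\<epsilon>. J \<epsilon> + K \<epsilon>) (\<lambda>j. a j + b j)"
  unfolding has_expansion_def
proof (standard, goal_cases)
  case (1 N)
  obtain C where "C \<ge> 0" and C: "\<And>\<epsilon>. \<bar>\<epsilon>\<bar> \<le> 1 \<Longrightarrow> norm (J \<epsilon> - (\<Sum>j<N. a j * of_real \<epsilon> ^ j)) \<le> C * \<bar>\<epsilon>\<bar> ^ N"
    using assms(1) by (rule has_expansionE[where N = N]) (rule that)
  obtain D where "D \<ge> 0" and D: "\<And>\<epsilon>. \<bar>\<epsilon>\<bar> \<le> 1 \<Longrightarrow> norm (K \<epsilon> - (\<Sum>j<N. b j * of_real \<epsilon> ^ j)) \<le> D * \<bar>\<epsilon>\<bar> ^ N"
    using assms(2) by (rule has_expansionE[where N = N]) (rule that)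
  have "norm (J \<epsilon> + K \<epsilon> - (\<Sum>j<N. (a j + b j) * of_real \<epsilon> ^ j)) \<le> (C + D) * \<bar>\<epsilon>\<bar> ^ N" if "\<bar>\<epsilon>\<bar> \<le> 1" for \<epsilon>
  proof -
    have eq: "J \<epsilon> + K \<epsilon> - (\<Sum>j<N. (a j + b j) * of_real \<epsilon> ^ j) =
      (J \<epsilon> - (\<Sum>j<N. a j * of_real \<epsilon> ^ j)) + (K \<epsilon> - (\<Sum>j<N. b j * of_real \<epsilon> ^ j))"
      by (simp add: distrib_right sum.distrib)
    have "(C + D) * \<bar>\<epsilon>\<bar> ^ N = C * \<bar>\<epsilon>\<bar> ^ N + D * \<bar>\<epsilon>\<bar> ^ N" by (rule distrib_right)
    then show ?thesis unfolding eq by (simp only:) (rule norm_triangle_mono[OF C[OF that] D[OF that]])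
  qed
  then show ?case
    by blast
qed

text \<open>With partial sums A and B the error is (J - A) K + A (K - B) plus the terms of A B of
  total order at least N; the last are indexed by \<open>U\<close>.\<close>

lemma has_expansion_mult:
  assumes "has_expansion J a" "has_expansion K b"
  shows "has_expansion (\<lambda>\<epsilon>. J \<epsilon> * K \<epsilon>) (\<lambda>n. \<Sum>i\<le>n. a i * b (n - i))"
  unfolding has_expansion_def
proof (standard, goal_cases)
  case (1 N)
  obtain C where C: "C \<ge> 0" "\<And>\<epsilon>. \<bar>\<epsilon>\<bar> \<le> 1 \<Longrightarrow> norm (J \<epsilon> - (\<Sum>j<N. a j * of_real \<epsilon> ^ j)) \<le> C * \<bar>\<epsilon>\<bar> ^ N"
    using assms(1) by (rule has_expansionE[where N = N]) (rule that)
  obtain D where D: "D \<ge> 0" "\<And>\<epsilon>. \<bar>\<epsilon>\<bar> \<le> 1 \<Longrightarrow> norm (K \<epsilon> - (\<Sum>j<N. b j * of_real \<epsilon> ^ j)) \<le> D * \<bar>\<epsilon>\<bar> ^ N"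
    using assms(2) by (rule has_expansionE[where N = N]) (rule that)
  obtain E where E: "E \<ge> 0" "\<And>\<epsilon>. \<bar>\<epsilon>\<bar> \<le> 1 \<Longrightarrow> norm (K \<epsilon>) \<le> E"
    using has_expansionE[OF assms(2), of 0] by auto
  define F where "F = (\<Sum>j<N. norm (a j))"
  define U where "U = {(i, j). i < N \<and> j < N \<and> \<not> i + j < N}"
  define G where "G = (\<Sum>(i, j)\<in>U. norm (a i) * norm (b j))"
  have finU: "finite U" unfolding U_def by (rule finite_subset[of _ "{..<N} \<times> {..<N}"]) auto
  have "norm (J \<epsilon> * K \<epsilon> - (\<Sum>n<N. (\<Sum>i\<le>n. a i * b (n - i)) * of_real \<epsilon> ^ n)) \<le> (C * E + F * D + G) * \<bar>\<epsilon>\<bar> ^ N"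
    if \<epsilon>: "\<bar>\<epsilon>\<bar> \<le> 1" for \<epsilon>
  proof -
    define x where "x = complex_of_real \<epsilon>"
    define A B where "A = (\<Sum>i<N. a i * x ^ i)" and "B = (\<Sum>j<N. b j * x ^ j)"
    have x: "norm x = \<bar>\<epsilon>\<bar>" by (simp add: x_def)
    have "norm A \<le> (\<Sum>i<N. norm (a i * x ^ i))" unfolding A_def by (rule norm_sum)
    also have "\<dots> \<le> F" unfolding F_def
      using \<epsilon> by (intro sum_mono) (simp add: norm_mult norm_power x mult_left_le power_le_one)
    finally have normA: "norm A \<le> F" .
    have "A * B = (\<Sum>(i, j)\<in>{..<N} \<times> {..<N}. a i * x ^ i * (b j * x ^ j))"
      unfolding A_def B_def sum_product sum.cartesian_product ..
    also have "{..<N} \<times> {..<N} = {(i, j). i + j < N} \<union> U" unfolding U_def by auto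
    also have "(\<Sum>(i, j)\<in>{(i, j). i + j < N} \<union> U. a i * x ^ i * (b j * x ^ j)) =
        (\<Sum>(i, j)\<in>{(i, j). i + j < N}. a i * x ^ i * (b j * x ^ j)) + (\<Sum>(i, j)\<in>U. a i * x ^ i * (b j * x ^ j))"
      by (rule sum.union_disjoint[OF finite_subset[of _ "{..<N} \<times> {..<N}"] finU]) (auto simp: U_def)
    also have "(\<Sum>(i, j)\<in>{(i, j). i + j < N}. a i * x ^ i * (b j * x ^ j)) = (\<Sum>n<N. \<Sum>i\<le>n. a i * x ^ i * (b (n - i) * x ^ (n - i)))"
      by (rule sum.triangle_reindex)
    also have "\<dots> = (\<Sum>n<N. (\<Sum>i\<le>n. a i * b (n - i)) * x ^ n)"
      unfolding sum_distrib_right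
    proof (intro sum.cong refl)
      fix n i :: nat assume "i \<in> {..n}"
      then have "x ^ n = x ^ i * x ^ (n - i)" by (simp flip: power_add)
      then show "a i * x ^ i * (b (n - i) * x ^ (n - i)) = a i * b (n - i) * x ^ n" by simp
    qed
    finally have AB: "A * B - (\<Sum>n<N. (\<Sum>i\<le>n. a i * b (n - i)) * x ^ n) = (\<Sum>(i, j)\<in>U. a i * x ^ i * (b j * x ^ j))"
      by simp
    have "norm (\<Sum>(i, j)\<in>U. a i * x ^ i * (b j * x ^ j)) \<le> (\<Sum>(i, j)\<in>U. norm (a i) * norm (b j) * \<bar>\<epsilon>\<bar> ^ N)"
    proof (rule sum_norm_le, clarify)
      fix i j assume "(i, j) \<in> U"
      then have "\<bar>\<epsilon>\<bar> ^ (i + j) \<le> \<bar>\<epsilon>\<bar> ^ N" using \<epsilon> by (intro power_decreasing) (auto simp: U_def)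
      then have "norm (a i) * norm (b j) * \<bar>\<epsilon>\<bar> ^ (i + j) \<le> norm (a i) * norm (b j) * \<bar>\<epsilon>\<bar> ^ N"
        by (intro mult_left_mono) auto
      then show "norm (a i * x ^ i * (b j * x ^ j)) \<le> norm (a i) * norm (b j) * \<bar>\<epsilon>\<bar> ^ N"
        by (simp add: norm_mult norm_power x power_add mult_ac)
    qed
    then have 3: "norm (A * B - (\<Sum>n<N. (\<Sum>i\<le>n. a i * b (n - i)) * x ^ n)) \<le> G * \<bar>\<epsilon>\<bar> ^ N"
      unfolding AB G_def by (simp add: sum_distrib_right case_prod_unfold)
    have 1: "norm ((J \<epsilon> - A) * K \<epsilon>) \<le> (C * \<bar>\<epsilon>\<bar> ^ N) * E"
      unfolding norm_mult using C E(2)[OF \<epsilon>] \<epsilon> by (intro mult_mono) (auto simp: A_def x_def)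
    have 2: "norm (A * (K \<epsilon> - B)) \<le> F * (D * \<bar>\<epsilon>\<bar> ^ N)"
      unfolding norm_mult using D normA \<epsilon> by (intro mult_mono) (auto simp: B_def x_def F_def sum_nonneg)
    have "J \<epsilon> * K \<epsilon> - (\<Sum>n<N. (\<Sum>i\<le>n. a i * b (n - i)) * x ^ n) =
       (J \<epsilon> - A) * K \<epsilon> + A * (K \<epsilon> - B) + (A * B - (\<Sum>n<N. (\<Sum>i\<le>n. a i * b (n - i)) * x ^ n))"
      by (simp add: algebra_simps)
    also have "norm \<dots> \<le> (C * \<bar>\<epsilon>\<bar> ^ N) * E + F * (D * \<bar>\<epsilon>\<bar> ^ N) + G * \<bar>\<epsilon>\<bar> ^ N"
      using 1 2 3 by (intro norm_triangle_mono)
    finally show ?thesis by (simp add: x_def algebra_simps)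
  qed
  then show ?case
    by blast
qed

lemma has_expansion_cnj:
  assumes "has_expansion J a"
  shows "has_expansion (\<lambda>\<epsilon>. cnj (J \<epsilon>)) (\<lambda>j. cnj (a j))"
proof -
  have eq: "cnj (J \<epsilon>) - (\<Sum>j<N. cnj (a j) * of_real \<epsilon> ^ j) = cnj (J \<epsilon> - (\<Sum>j<N. a j * of_real \<epsilon> ^ j))" for \<epsilon> N
    by simp
  show ?thesis using assms unfolding has_expansion_def eq complex_mod_cnj .
qed

text \<open>Averaging the error bounds at \<epsilon> and - \<epsilon> deletes the odd terms.\<close>

lemma has_expansion_even:
  assumes "has_expansion J a" and even: "\<And>\<epsilon>. J (- \<epsilon>) = J \<epsilon>"
  shows "has_expansion J (\<lambda>j. if even j then a j else 0)"
  unfolding has_expansion_def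
proof (standard, goal_cases)
  case (1 N)
  obtain C where "C \<ge> 0" and C: "\<And>\<epsilon>. \<bar>\<epsilon>\<bar> \<le> 1 \<Longrightarrow> norm (J \<epsilon> - (\<Sum>j<N. a j * of_real \<epsilon> ^ j)) \<le> C * \<bar>\<epsilon>\<bar> ^ N"
    using assms(1) by (rule has_expansionE[where N = N]) (rule that)
  have "norm (J \<epsilon> - (\<Sum>j<N. (if even j then a j else 0) * of_real \<epsilon> ^ j)) \<le> C * \<bar>\<epsilon>\<bar> ^ N" if "\<bar>\<epsilon>\<bar> \<le> 1" for \<epsilon>
  proof -
    let ?d = "\<lambda>\<epsilon>. J \<epsilon> - (\<Sum>j<N. a j * of_real \<epsilon> ^ j)"
    have "(\<Sum>j<N. (if even j then a j else 0) * of_real \<epsilon> ^ j) =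
        (\<Sum>j<N. (a j * of_real \<epsilon> ^ j + a j * of_real (- \<epsilon>) ^ j) / 2)"
      by (intro sum.cong) (auto simp: uminus_power_if)
    also have "\<dots> = ((\<Sum>j<N. a j * of_real \<epsilon> ^ j) + (\<Sum>j<N. a j * of_real (- \<epsilon>) ^ j)) / 2"
      by (simp only: sum_divide_distrib[symmetric] sum.distrib)
    finally have "J \<epsilon> - (\<Sum>j<N. (if even j then a j else 0) * of_real \<epsilon> ^ j) = (?d \<epsilon> + ?d (- \<epsilon>)) / 2"
      using even[of \<epsilon>] by (simp add: field_simps)
    moreover have "norm (?d \<epsilon> + ?d (- \<epsilon>)) \<le> C * \<bar>\<epsilon>\<bar> ^ N + C * \<bar>\<epsilon>\<bar> ^ N"
      using C[of \<epsilon>] C[of "- \<epsilon>"] that by (intro norm_triangle_mono) auto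
    ultimately show ?thesis by (simp only: norm_divide) simp
  qed
  then show ?case
    by blast
qed

text \<open>A determinant is a polynomial in its entries, so existence of an expansion passes
  through it by closure properties. The coefficients can be forgotten: the only one wanted
  explicitly is the leading one, which is the value at 0.\<close>

definition expandable :: "(real \<Rightarrow> complex) \<Rightarrow> bool" where
  "expandable J \<longleftrightarrow> (\<exists>a. has_expansion J a)"

lemma expandable_const [intro]: "expandable (\<lambda>_. c)"
  using has_expansion_const unfolding expandable_def by blast

lemma expandable_of_real [intro]: "expandable of_real"
  using has_expansion_ident unfolding expandable_def by blast

lemma expandable_add [intro]: "expandable J \<Longrightarrow> expandable K \<Longrightarrow> expandable (\<lambda>\<epsilon>. J \<epsilon> + K \<epsilon>)"
  using has_expansion_add unfolding expandable_def by blast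

lemma expandable_mult [intro]: "expandable J \<Longrightarrow> expandable K \<Longrightarrow> expandable (\<lambda>\<epsilon>. J \<epsilon> * K \<epsilon>)"
  using has_expansion_mult unfolding expandable_def by blast

lemma expandable_sum [intro]: "(\<And>x. x \<in> S \<Longrightarrow> expandable (J x)) \<Longrightarrow> expandable (\<lambda>\<epsilon>. \<Sum>x\<in>S. J x \<epsilon>)"
  by (induction S rule: infinite_finite_induct) auto

lemma expandable_prod [intro]: "(\<And>x. x \<in> S \<Longrightarrow> expandable (J x)) \<Longrightarrow> expandable (\<lambda>\<epsilon>. \<Prod>x\<in>S. J x \<epsilon>)"
  by (induction S rule: infinite_finite_induct) auto

lemma expandable_power [intro]: "expandable J \<Longrightarrow> expandable (\<lambda>\<epsilon>. J \<epsilon> ^ k)"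
  by (induction k) auto

lemma expandable_block_det:
  assumes "\<And>s k. expandable (h s k)"
  shows "expandable (\<lambda>\<epsilon>. block_det (\<lambda>s k. h s k \<epsilon>) n f g)"
proof -
  have entry: "expandable (\<lambda>\<epsilon>. if P then h s k \<epsilon> else 0)" for P s k
    using assms by (cases P) auto
  show ?thesis unfolding block_det_def det_mat_eq_sum split_conv
    by (intro expandable_sum expandable_mult expandable_const expandable_prod entry)
qed

lemma expandable_reduced_det:
  assumes "\<And>s k. expandable (h s k)"
  shows "expandable (\<lambda>\<epsilon>. reduced_det V (\<lambda>s k. h s k \<epsilon>) (of_real (2 * \<epsilon>)) n r)"
  unfolding reduced_det_def of_real_mult
  by (intro expandable_sum expandable_mult expandable_const expandable_power expandable_of_real
      expandable_block_det assms)

text \<open>Changing the sign of the odd moments multiplies \<open>block_det\<close> by (-1) to the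
  total degree of \<open>f\<close> and \<open>g\<close>. The power of - t has the same parity, as
  the exponent differs from that degree by an even number.\<close>

lemma reduced_det_parity:
  fixes h :: "bool \<Rightarrow> nat \<Rightarrow> 'a::comm_ring_1"
  shows "reduced_det V (\<lambda>s k. (-1) ^ k * h s k) (- t) n r = reduced_det V h t n r"
proof -
  have block: "block_det (\<lambda>s k. (-1) ^ k * h s k) n f g = (-1) ^ (total_deg n f + total_deg n g) * block_det h n f g" for f g
    using det_block_scaled[of n f g "\<lambda>_. 1" "-1" h] unfolding block_det_def by (simp cong: if_cong)
  have "(- t) ^ (total_deg n f + total_deg n g - 2 * min_deg n r) * ((-1) ^ (total_deg n f + total_deg n g) * block_det h n f g) =
      t ^ (total_deg n f + total_deg n g - 2 * min_deg n r) * block_det h n f g"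
    if "f \<in> selections n r" "g \<in> selections n r" for f g
  proof -
    define d where "d = total_deg n f + total_deg n g - 2 * min_deg n r"
    have "total_deg n f + total_deg n g = d + 2 * min_deg n r"
      using selections_degree(1)[OF that(1)] selections_degree(1)[OF that(2)] by (simp add: d_def)
    then have "(-1) ^ (total_deg n f + total_deg n g) = ((-1) ^ d :: 'a)" by (simp add: power_add)
    moreover have "(- t) ^ d * (-1) ^ d = t ^ d" by (simp flip: power_mult_distrib)
    ultimately show ?thesis unfolding d_def[symmetric] by (simp only: mult.assoc[symmetric])
  qed
  then show ?thesis
    unfolding reduced_det_def block by (intro sum.cong refl) (simp only: mult.assoc)
qed

section \<open>Expansion and reflection of the saddle-point moments\<close>

lemma norm_iexp_remainder:
  "norm (exp (\<i> * of_real x) - (\<Sum>j<N. (\<i> * of_real x) ^ j / fact j)) \<le> \<bar>x\<bar> ^ N / fact N"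
proof (cases N)
  case (Suc n)
  then show ?thesis using iexp_approx1[of x n] by (simp add: lessThan_Suc_atMost)
qed simp

text \<open>The cubic factor is the exponential of an imaginary number, so its Taylor remainder of
  order N is at most \<bar>y\<bar>^N / N! on the whole line. Against the Gaussian this integrates to
  a constant times \<bar>\<epsilon>\<bar>^N.\<close>

lemma has_expansion_airy_h:
  "has_expansion (airy_h k) (\<lambda>j. cis (pi / 6) ^ (k + 1) * ((2 / 3 * \<i>) ^ j / fact j) *
     (\<integral>x. of_real x ^ (k + 3 * j) * airy_kernel 0 x \<partial>lborel))"
  unfolding has_expansion_def
proof (standard, goal_cases)
  case (1 N)
  let ?a = "\<lambda>j. cis (pi / 6) ^ (k + 1) * ((2 / 3 * \<i>) ^ j / fact j) * (\<integral>x. of_real x ^ (k + 3 * j) * airy_kernel 0 x \<partial>lborel)"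
  define C where "C = (\<integral>x. norm (of_real x ^ (k + 3 * N) * airy_kernel 0 x) * ((2 / 3) ^ N / fact N) \<partial>lborel)"
  have "norm (airy_h k \<epsilon> - (\<Sum>j<N. ?a j * of_real \<epsilon> ^ j)) \<le> C * \<bar>\<epsilon>\<bar> ^ N" for \<epsilon>
  proof -
    define y where "y x = 2 / 3 * \<epsilon> * x ^ 3" for x :: real
    let ?p = "\<lambda>x j. of_real x ^ k * airy_kernel 0 x * ((\<i> * of_real (y x)) ^ j / fact j)"
    have kernel: "airy_kernel \<epsilon> x = airy_kernel 0 x * exp (\<i> * of_real (y x))" for x
      by (simp add: airy_kernel_def y_def exp_add[symmetric])
    have p: "?p x j = ((2 / 3 * \<i>) ^ j / fact j * of_real \<epsilon> ^ j) * (of_real x ^ (k + 3 * j) * airy_kernel 0 x)" for x j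
    proof -
      have "\<i> * of_real (y x) = 2 / 3 * \<i> * of_real \<epsilon> * of_real x ^ 3" by (simp add: y_def)
      then have "(\<i> * of_real (y x)) ^ j = (2 / 3 * \<i>) ^ j * of_real \<epsilon> ^ j * of_real x ^ (3 * j)"
        by (simp only: power_mult_distrib power_mult)
      then show ?thesis by (simp only: power_add) (simp add: mult_ac)
    qed
    have int_p: "integrable lborel (\<lambda>x. ?p x j)" for j
      unfolding p by (intro integrable_mult_right integrable_power_airy_kernel)
    have "(\<Sum>j<N. ?a j * of_real \<epsilon> ^ j) = cis (pi / 6) ^ (k + 1) * (\<Sum>j<N. \<integral>x. ?p x j \<partial>lborel)"
      unfolding p integral_mult_right_zero sum_distrib_left by (intro sum.cong refl) (simp add: mult_ac)
    also have "(\<Sum>j<N. \<integral>x. ?p x j \<partial>lborel) = (\<integral>x. (\<Sum>j<N. ?p x j) \<partial>lborel)"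
      by (rule Bochner_Integration.integral_sum[symmetric]) (rule int_p)
    finally have "airy_h k \<epsilon> - (\<Sum>j<N. ?a j * of_real \<epsilon> ^ j) =
       cis (pi / 6) ^ (k + 1) * ((\<integral>x. of_real x ^ k * airy_kernel \<epsilon> x \<partial>lborel) - (\<integral>x. (\<Sum>j<N. ?p x j) \<partial>lborel))"
      by (simp only: airy_h_def right_diff_distrib)
    also have "(\<integral>x. of_real x ^ k * airy_kernel \<epsilon> x \<partial>lborel) - (\<integral>x. (\<Sum>j<N. ?p x j) \<partial>lborel) =
       (\<integral>x. of_real x ^ k * airy_kernel \<epsilon> x - (\<Sum>j<N. ?p x j) \<partial>lborel)"
      by (rule Bochner_Integration.integral_diff[symmetric])
        (intro integrable_power_airy_kernel Bochner_Integration.integrable_sum int_p)+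
    finally have "norm (airy_h k \<epsilon> - (\<Sum>j<N. ?a j * of_real \<epsilon> ^ j)) =
        norm (\<integral>x. of_real x ^ k * airy_kernel \<epsilon> x - (\<Sum>j<N. ?p x j) \<partial>lborel)"
      by (simp only: norm_mult norm_power norm_cis power_one mult_1)
    also have "\<dots> \<le> (\<integral>x. norm (of_real x ^ k * airy_kernel \<epsilon> x - (\<Sum>j<N. ?p x j)) \<partial>lborel)"
      by (rule integral_norm_bound)
    also have "\<dots> \<le> (\<integral>x. norm (of_real x ^ (k + 3 * N) * airy_kernel 0 x) * ((2 / 3) ^ N / fact N) * \<bar>\<epsilon>\<bar> ^ N \<partial>lborel)"
    proof (rule integral_mono)
      show "integrable lborel (\<lambda>x. norm (of_real x ^ k * airy_kernel \<epsilon> x - (\<Sum>j<N. ?p x j)))"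
        by (intro integrable_norm Bochner_Integration.integrable_diff integrable_power_airy_kernel Bochner_Integration.integrable_sum int_p)
      show "integrable lborel (\<lambda>x. norm (of_real x ^ (k + 3 * N) * airy_kernel 0 x) * ((2 / 3) ^ N / fact N) * \<bar>\<epsilon>\<bar> ^ N)"
        by (intro integrable_mult_left integrable_norm integrable_power_airy_kernel)
      fix x
      have "of_real x ^ k * airy_kernel \<epsilon> x - (\<Sum>j<N. ?p x j) =
          of_real x ^ k * airy_kernel 0 x * (exp (\<i> * of_real (y x)) - (\<Sum>j<N. (\<i> * of_real (y x)) ^ j / fact j))"
        unfolding kernel by (simp only: right_diff_distrib sum_distrib_left mult.assoc)
      then have "norm (of_real x ^ k * airy_kernel \<epsilon> x - (\<Sum>j<N. ?p x j)) = norm (of_real x ^ k * airy_kernel 0 x) *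
          norm (exp (\<i> * of_real (y x)) - (\<Sum>j<N. (\<i> * of_real (y x)) ^ j / fact j))"
        by (simp only: norm_mult[of "of_real x ^ k * airy_kernel 0 x"])
      also have "\<dots> \<le> norm (of_real x ^ k * airy_kernel 0 x) * (\<bar>y x\<bar> ^ N / fact N)"
        by (intro mult_left_mono norm_iexp_remainder norm_ge_zero)
      also have "\<bar>y x\<bar> ^ N = (2 / 3) ^ N * \<bar>\<epsilon>\<bar> ^ N * \<bar>x\<bar> ^ (3 * N)"
      proof -
        have "\<bar>y x\<bar> = 2 / 3 * \<bar>\<epsilon>\<bar> * \<bar>x\<bar> ^ 3" by (simp add: y_def abs_mult power_abs)
        then show ?thesis by (simp only: power_mult_distrib power_mult)
      qed
      finally show "norm (of_real x ^ k * airy_kernel \<epsilon> x - (\<Sum>j<N. ?p x j)) \<le>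
          norm (of_real x ^ (k + 3 * N) * airy_kernel 0 x) * ((2 / 3) ^ N / fact N) * \<bar>\<epsilon>\<bar> ^ N"
        by (simp add: norm_mult norm_power power_add mult_ac)
    qed
    also have "\<dots> = C * \<bar>\<epsilon>\<bar> ^ N" unfolding C_def by simp
    finally show ?thesis .
  qed
  then show ?case
    by blast
qed

lemma airy_h_minus: "airy_h k (- \<epsilon>) = (-1) ^ k * airy_h k \<epsilon>"
proof -
  have "(\<integral>x. of_real x ^ k * airy_kernel (- \<epsilon>) x \<partial>lborel) =
     \<bar>-1\<bar> *\<^sub>R (\<integral>x. of_real (0 + (-1) * x) ^ k * airy_kernel (- \<epsilon>) (0 + (-1) * x) \<partial>lborel)"
    by (rule lborel_integral_real_affine) simp
  also have "(\<integral>x. of_real (0 + (-1) * x) ^ k * airy_kernel (- \<epsilon>) (0 + (-1) * x) \<partial>lborel) =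
     (\<integral>x. (-1) ^ k * (of_real x ^ k * airy_kernel \<epsilon> x) \<partial>lborel)"
  proof (intro Bochner_Integration.integral_cong refl)
    fix x :: real
    have "airy_kernel (- \<epsilon>) (0 + (-1) * x) = airy_kernel \<epsilon> x"
      by (simp add: airy_kernel_def)
    moreover have "complex_of_real (0 + (-1) * x) ^ k = (-1) ^ k * of_real x ^ k"
      by (simp flip: power_mult_distrib)
    ultimately show "of_real (0 + (-1) * x) ^ k * airy_kernel (- \<epsilon>) (0 + (-1) * x) = (-1) ^ k * (of_real x ^ k * airy_kernel \<epsilon> x)"
      by (simp only: mult.assoc)
  qed
  finally show ?thesis by (simp add: airy_h_def)
qed

section \<open>Moments of the limiting Gaussian\<close>

definition gauss_fun :: "nat \<Rightarrow> complex \<Rightarrow> complex" where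
  "gauss_fun k w = w ^ k * exp (- w\<^sup>2)"

lemma norm_gauss_fun: "norm (gauss_fun k (Complex x y)) = norm (Complex x y) ^ k * exp (y\<^sup>2 - x\<^sup>2)"
  unfolding gauss_fun_def norm_mult norm_power norm_exp_eq_Re by (simp add: power2_eq_square)

lemma continuous_gauss_fun: "continuous_on A (gauss_fun k)"
  unfolding gauss_fun_def[abs_def] by (intro continuous_intros)

lemma set_integrable_gauss_ray:
  assumes "norm e = 1" "1 / 2 \<le> (Re e)\<^sup>2 - (Im e)\<^sup>2"
  shows "set_integrable lborel {0..} (\<lambda>s. gauss_fun k (0 + of_real s * e))"
proof -
  obtain C where C: "C > 0" "\<And>x::real. \<bar>x\<bar> ^ k * exp (0 * \<bar>x\<bar> - 1 / 2 * x\<^sup>2) \<le> C * exp (- \<bar>x\<bar>)"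
    by (rule quadratic_decay[of "1 / 2" k 0]) (simp, rule that)
  show ?thesis
  proof (rule set_integrable_exp_decay)
    show "continuous_on UNIV (\<lambda>s. gauss_fun k (0 + of_real s * e))"
      by (intro continuous_on_compose2[OF continuous_gauss_fun[of UNIV]] continuous_intros) auto
    fix s :: real assume s: "s \<ge> 0"
    have w: "of_real s * e = Complex (s * Re e) (s * Im e)" by (simp add: complex_eq_iff)
    have "norm (of_real s * e) = s" using assms(1) s by (simp add: norm_mult)
    then have n: "norm (Complex (s * Re e) (s * Im e)) = s" by (simp only: w)
    have "s\<^sup>2 * (1 / 2) \<le> s\<^sup>2 * ((Re e)\<^sup>2 - (Im e)\<^sup>2)" using assms(2) by (intro mult_left_mono) auto
    then have "(s * Im e)\<^sup>2 - (s * Re e)\<^sup>2 \<le> 0 * \<bar>s\<bar> - 1 / 2 * s\<^sup>2"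
      by (simp add: power_mult_distrib algebra_simps)
    then have "norm (gauss_fun k (of_real s * e)) \<le> s ^ k * exp (0 * \<bar>s\<bar> - 1 / 2 * s\<^sup>2)"
      unfolding w norm_gauss_fun n using s by (intro mult_left_mono) auto
    also have "\<dots> \<le> C * exp (- s)" using C(2)[of s] s by simp
    finally show "norm (gauss_fun k (0 + of_real s * e)) \<le> C * exp (- s)" by simp
  qed
qed

text \<open>The condition 3 d^2 \<le> c^2 keeps the ray within the angle pi/6 of the real axis. On
  the vertical segments between the two rays this means y^2 \<le> X^2 / 3, so the integrand is of
  size exp (- (2/3) X^2) up to a power.\<close>

lemma gauss_rotation:
  assumes c: "c > 0" and d: "d \<ge> 0" and cd: "3 * d\<^sup>2 \<le> c\<^sup>2" "c\<^sup>2 + d\<^sup>2 = 1"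
  shows "Complex c (- d) * (LINT s:{0..}|lborel. gauss_fun k (0 + of_real s * Complex c (- d))) =
    (LINT s:{0..}|lborel. gauss_fun k (0 + of_real s * 1))"
proof -
  let ?h = "gauss_fun k" and ?e = "Complex c (- d)"
  have "?h holomorphic_on UNIV" unfolding gauss_fun_def[abs_def] by (intro holomorphic_intros)
  then obtain P where P: "\<And>w. (P has_field_derivative ?h w) (at w)"
    by (rule holomorphic_primitive_UNIV) blast
  note cont = continuous_gauss_fun[of UNIV k]
  have "norm ?e = 1" using cd(2) by (simp add: cmod_def)
  then have "((\<lambda>s. P (0 + of_real s * ?e)) \<longlongrightarrow> P 0 + ?e * (LINT s:{0..}|lborel. ?h (0 + of_real s * ?e))) at_top"
    using cd by (intro primitive_along_ray[OF P cont] set_integrable_gauss_ray) auto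
  moreover have "filterlim (\<lambda>X. (1 / c) * X) at_top at_top"
    using c by (intro filterlim_tendsto_pos_mult_at_top[OF tendsto_const]) (auto intro: filterlim_ident)
  ultimately have "((\<lambda>X. P (0 + of_real ((1 / c) * X) * ?e)) \<longlongrightarrow> P 0 + ?e * (LINT s:{0..}|lborel. ?h (0 + of_real s * ?e))) at_top"
    by (rule filterlim_compose)
  moreover have "0 + of_real ((1 / c) * X) * ?e = Complex X (- (d / c * X))" for X
    using c by (simp add: complex_eq_iff)
  ultimately have 1: "((\<lambda>X. P (Complex X (- (d / c * X)))) \<longlongrightarrow> P 0 + ?e * (LINT s:{0..}|lborel. ?h (0 + of_real s * ?e))) at_top"
    by simp
  have "((\<lambda>s. P (0 + of_real s * 1)) \<longlongrightarrow> P 0 + 1 * (LINT s:{0..}|lborel. ?h (0 + of_real s * 1))) at_top"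
    by (intro primitive_along_ray[OF P cont] set_integrable_gauss_ray) auto
  moreover have "0 + of_real X * 1 = Complex X 0" for X by (simp add: complex_eq_iff)
  ultimately have 2: "((\<lambda>X. P (Complex X 0)) \<longlongrightarrow> P 0 + (LINT s:{0..}|lborel. ?h (0 + of_real s * 1))) at_top"
    by simp
  have "((\<lambda>X. P (Complex X 0) - P (Complex X (- (d / c * X)))) \<longlongrightarrow> 0) at_top"
  proof (rule Lim_null_comparison)
    define B where "B X = 2 ^ k * fact (k + 1) * exp (X - 2 / 3 * X\<^sup>2)" for X :: real
    show "(B \<longlongrightarrow> 0) at_top" unfolding B_def by real_asymp
    show "eventually (\<lambda>X. norm (P (Complex X 0) - P (Complex X (- (d / c * X)))) \<le> B X) at_top"
      using eventually_ge_at_top[of 0]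
    proof eventually_elim
      case (elim X)
      define K where "K = (2 * X) ^ k * exp (- (2 / 3 * X\<^sup>2))"
      have "d\<^sup>2 \<le> c\<^sup>2" using cd(1) zero_le_power2[of d] by linarith
      then have "d \<le> c" by (rule power2_le_imp_le) (use c in simp)
      then have dX: "0 \<le> d / c * X" "d / c * X \<le> X"
        using c d elim \<open>d \<le> c\<close> mult_right_mono[of "d / c" 1 X] by simp_all
      have "(d / c)\<^sup>2 \<le> 1 / 3" using cd(1) c by (simp add: power_divide divide_le_eq)
      then have "(d / c)\<^sup>2 * X\<^sup>2 \<le> 1 / 3 * X\<^sup>2" by (rule mult_right_mono) simp
      then have sq: "(d / c * X)\<^sup>2 \<le> X\<^sup>2 / 3" by (simp only: power_mult_distrib)
      have "norm (P (Complex X 0) - P (Complex X (- (d / c * X)))) \<le> K * (0 - (- (d / c * X)))"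
      proof (rule primitive_vertical_segment_bound[OF P])
        fix y assume y: "- (d / c * X) \<le> y" "y \<le> 0"
        then have "\<bar>y\<bar> \<le> d / c * X" by simp
        from power_mono[OF this, of 2] have "y\<^sup>2 \<le> X\<^sup>2 / 3" using sq by simp
        then have 1: "y\<^sup>2 - X\<^sup>2 \<le> - (2 / 3 * X\<^sup>2)" by simp
        have "norm (Complex X y) \<le> 2 * X" using cmod_le[of "Complex X y"] y dX elim by simp
        then have "norm (Complex X y) ^ k \<le> (2 * X) ^ k" by (intro power_mono) auto
        then show "norm (?h (Complex X y)) \<le> K"
          unfolding norm_gauss_fun K_def using 1 elim by (intro mult_mono) auto
      qed (use dX in simp)
      also have "\<dots> \<le> K * X" using dX elim by (intro mult_left_mono) (auto simp: K_def)
      also have "\<dots> = 2 ^ k * X ^ (k + 1) * exp (- (2 / 3 * X\<^sup>2))"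
        by (simp add: K_def power_mult_distrib mult_ac)
      also have "\<dots> \<le> 2 ^ k * (fact (k + 1) * exp X) * exp (- (2 / 3 * X\<^sup>2))"
        using power_le_fact_mult_exp[OF elim, of "k + 1"] by (intro mult_right_mono mult_left_mono) auto
      also have "\<dots> = 2 ^ k * fact (k + 1) * exp (X + - (2 / 3 * X\<^sup>2))"
        by (simp only: exp_add mult.assoc)
      finally show ?case by (simp add: B_def)
    qed
  qed
  with tendsto_diff[OF 2 1]
  have "P 0 + (LINT s:{0..}|lborel. ?h (0 + of_real s * 1)) - (P 0 + ?e * (LINT s:{0..}|lborel. ?h (0 + of_real s * ?e))) = 0"
    by (rule tendsto_unique[OF trivial_limit_at_top_linorder])
  then show ?thesis by simp
qed

definition gauss_half_moment :: "nat \<Rightarrow> real" where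
  "gauss_half_moment k = (LINT s:{0..}|lborel. s ^ k * exp (- s\<^sup>2))"

text \<open>Turning the ray by half the angle of the coefficient cis (- pi/6) makes the Gaussian
  real.\<close>

lemma airy_kernel_half_moment:
  "(LINT s:{0..}|lborel. of_real s ^ k * airy_kernel 0 s) = cis (pi / 12) ^ (k + 1) * of_real (gauss_half_moment k)"
proof -
  let ?e = "cis (- (pi / 12))"
  define c d where "c = cos (pi / 12)" and "d = sin (pi / 12)"
  have e: "?e = Complex c (- d)" by (simp add: c_def d_def complex_eq_iff)
  \<comment> \<open>Comparison with the angle pi/6 suffices: c \<ge> sqrt 3 / 2 and d \<le> 1/2 give
    3 d^2 \<le> 3/4 \<le> c^2.\<close>
  have "cos (pi / 6) \<le> c" unfolding c_def by (rule cos_monotone_0_pi_le) auto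
  then have c: "sqrt 3 / 2 \<le> c" by (simp add: cos_30)
  have "d \<le> sin (pi / 6)" unfolding d_def by (rule sin_monotone_2pi_le) auto
  then have d: "d \<le> 1 / 2" by (simp add: sin_30)
  have d0: "d \<ge> 0" unfolding d_def by (rule sin_ge_zero) auto
  have "(sqrt 3 / 2)\<^sup>2 \<le> c\<^sup>2" using c by (intro power_mono) auto
  moreover have "d\<^sup>2 \<le> (1 / 2)\<^sup>2" using d d0 by (intro power_mono) auto
  ultimately have cd: "3 * d\<^sup>2 \<le> c\<^sup>2" by (simp add: power_divide)
  have c0: "c > 0" using c by (rule less_le_trans[rotated]) simp
  have ray: "gauss_fun k (0 + of_real s * ?e) = ?e ^ k * (of_real s ^ k * airy_kernel 0 s)" for s
  proof -
    have "(of_real s * ?e)\<^sup>2 = cis (- pi / 6) * of_real (s\<^sup>2)"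
      by (simp add: power_mult_distrib Complex.DeMoivre)
    then have "gauss_fun k (0 + of_real s * ?e) = (of_real s * ?e) ^ k * exp (- cis (- pi / 6) * of_real (s\<^sup>2))"
      by (simp add: gauss_fun_def)
    then show ?thesis by (simp add: airy_kernel_def power_mult_distrib mult_ac)
  qed
  have real: "gauss_fun k (0 + of_real s * 1) = of_real (s ^ k * exp (- s\<^sup>2))" for s :: real
    by (simp add: gauss_fun_def flip: exp_of_real)
  have "c\<^sup>2 + d\<^sup>2 = 1" by (simp add: c_def d_def)
  from gauss_rotation[OF c0 d0 cd this, of k]
  have "?e * (LINT s:{0..}|lborel. ?e ^ k * (of_real s ^ k * airy_kernel 0 s)) = (LINT s:{0..}|lborel. complex_of_real (s ^ k * exp (- s\<^sup>2)))"
    unfolding e[symmetric] ray real .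
  also have "(LINT s:{0..}|lborel. ?e ^ k * (of_real s ^ k * airy_kernel 0 s)) = ?e ^ k * (LINT s:{0..}|lborel. of_real s ^ k * airy_kernel 0 s)"
    by (rule set_integral_mult_right)
  also have "(LINT s:{0..}|lborel. complex_of_real (s ^ k * exp (- s\<^sup>2))) = of_real (gauss_half_moment k)"
    unfolding gauss_half_moment_def by (rule set_integral_complex_of_real)
  finally have "?e ^ (k + 1) * (LINT s:{0..}|lborel. of_real s ^ k * airy_kernel 0 s) = of_real (gauss_half_moment k)"
    by (simp add: mult.assoc)
  then have "cis (pi / 12) ^ (k + 1) * ?e ^ (k + 1) * (LINT s:{0..}|lborel. of_real s ^ k * airy_kernel 0 s) = cis (pi / 12) ^ (k + 1) * of_real (gauss_half_moment k)"
    by (simp only: mult.assoc)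
  moreover have "cis (pi / 12) ^ (k + 1) * ?e ^ (k + 1) = 1"
    unfolding power_mult_distrib[symmetric] cis_mult by simp
  ultimately show ?thesis by (simp only: mult_1)
qed

text \<open>The angle pi/6 of the line and the rotation by pi/12 add up to pi/4, the direction of
  steepest descent; the two half-lines differ by the sign (-1)^k.\<close>

lemma airy_h_0:
  "airy_h k 0 = cis (pi / 4) ^ (k + 1) * (1 + (-1) ^ k) * of_real (gauss_half_moment k)"
proof -
  let ?f = "\<lambda>x. of_real x ^ k * airy_kernel 0 x"
  have minus: "?f (- x) = (-1) ^ k * ?f x" for x
    by (simp add: airy_kernel_def uminus_power_if)
  obtain C where "C > 0" "\<And>x. \<bar>x\<bar> ^ k * exp (0 * \<bar>x\<bar> - sqrt 3 / 2 * x\<^sup>2) \<le> C * exp (- \<bar>x\<bar>)"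
    using quadratic_decay[of "sqrt 3 / 2" k 0] by auto
  then have C: "norm (?f x) \<le> C * exp (- \<bar>x\<bar>)" for x
    by (simp add: norm_mult norm_power norm_airy_kernel)
  have cont: "continuous_on UNIV ?f" by (intro continuous_intros continuous_airy_kernel)
  have "(\<integral>x. ?f x \<partial>lborel) = (LINT x:{0..}|lborel. ?f x) + (LINT x:{0..}|lborel. ?f (- x))"
    using integrable_split_half_lines[OF integrable_exp_decay(1,2)[OF cont C]]
    by (simp add: has_bochner_integral_iff)
  also have "(LINT x:{0..}|lborel. ?f (- x)) = (-1) ^ k * (LINT x:{0..}|lborel. ?f x)"
    unfolding minus by (rule set_integral_mult_right)
  finally have "(\<integral>x. ?f x \<partial>lborel) = (1 + (-1) ^ k) * (cis (pi / 12) ^ (k + 1) * of_real (gauss_half_moment k))"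
    unfolding airy_kernel_half_moment by (simp add: algebra_simps)
  then have "airy_h k 0 = (cis (pi / 6) * cis (pi / 12)) ^ (k + 1) * (1 + (-1) ^ k) * of_real (gauss_half_moment k)"
    unfolding airy_h_def power_mult_distrib by simp
  then show ?thesis by (simp add: cis_mult)
qed

text \<open>These say that the limiting moments are those of a centred Gaussian with complex
  variance \<i>/2 and total mass cis (pi/4) * sqrt pi, the form that the Hankel determinants
  require.\<close>

lemma airy_h_0_values:
  "airy_h 0 0 = cis (pi / 4) * of_real (sqrt pi)"
  "airy_h 1 0 = 0"
  "airy_h (k + 2) 0 = of_nat (k + 1) * (\<i> / 2) * airy_h k 0"
proof -
  have m: "gauss_half_moment (2 * j) = sqrt pi / 2 * (fact (2 * j) / (2 ^ (2 * j) * fact j))" for j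
    using has_bochner_integral_integral_eq[OF gaussian_moment_even_pos[of j]]
    by (simp add: gauss_half_moment_def set_lebesgue_integral_def mult.commute)
  show "airy_h 0 0 = cis (pi / 4) * of_real (sqrt pi)"
  proof -
    have "gauss_half_moment 0 = sqrt pi / 2" using m[of 0] by simp
    then show ?thesis unfolding airy_h_0 by (simp only:) simp
  qed
  show "airy_h 1 0 = 0" by (simp add: airy_h_0)
  show "airy_h (k + 2) 0 = of_nat (k + 1) * (\<i> / 2) * airy_h k 0"
  proof (cases "even k")
    case True
    then obtain j where k: "k = 2 * j" by blast
    have "gauss_half_moment (k + 2) = (real k + 1) / 2 * gauss_half_moment k"
    proof -
      have "fact (2 * Suc j) = (2 * (real j + 1)) * ((2 * real j + 1) * fact (2 * j))"
        "2 ^ (2 * Suc j) * fact (Suc j) = (2 * (real j + 1)) * (2 * (2 ^ (2 * j) * fact j))"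
        by (simp_all add: algebra_simps)
      then have "fact (2 * Suc j) / (2 ^ (2 * Suc j) * fact (Suc j)) =
          ((2 * real j + 1) * fact (2 * j)) / (2 * (2 ^ (2 * j) * fact j))"
        by (simp only: mult_divide_mult_cancel_left_if) simp
      then have "gauss_half_moment (2 * Suc j) = (2 * real j + 1) / 2 * gauss_half_moment (2 * j)"
        unfolding m by (simp only:) simp
      then show ?thesis by (simp add: k)
    qed
    moreover have "cis (pi / 4) ^ (k + 2 + 1) = \<i> * cis (pi / 4) ^ (k + 1)"
      by (simp add: Complex.DeMoivre cis_mult[symmetric] distrib_right flip: cis_pi_half) (simp add: cis_mult algebra_simps)
    ultimately have "airy_h (k + 2) 0 = (\<i> * cis (pi / 4) ^ (k + 1)) * (1 + (-1) ^ (k + 2)) * of_real ((real k + 1) / 2 * gauss_half_moment k)"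
      unfolding airy_h_0 by (simp only:)
    then show ?thesis unfolding airy_h_0 by (simp add: mult_ac add.commute)
  qed (simp add: airy_h_0)
qed

section \<open>The expansion of the determinant\<close>

text \<open>The saddle points in units of b: \<open>False\<close> for the contour integral,
  \<open>True\<close> for its conjugate.\<close>

definition saddle_sign :: "bool \<Rightarrow> complex" where
  "saddle_sign s = (if s then - \<i> else \<i>)"

definition airy_moments :: "bool \<Rightarrow> nat \<Rightarrow> real \<Rightarrow> complex" where
  "airy_moments s k \<epsilon> = (if s then cnj (airy_h k \<epsilon>) else airy_h k \<epsilon>)"

definition tau_coeff :: "nat \<Rightarrow> nat \<Rightarrow> real \<Rightarrow> complex" where
  "tau_coeff n r \<epsilon> = reduced_det (taylor_coeff saddle_sign) (\<lambda>s k. airy_moments s k \<epsilon>) (of_real (2 * \<epsilon>)) n r"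

lemma det_mat_scale:
  fixes A :: "nat \<Rightarrow> nat \<Rightarrow> 'a::comm_ring_1"
  shows "mat_det n (\<lambda>(j, k). u j * v k * A j k) =
    (\<Prod>j = 0..<n. u j) * (\<Prod>j = 0..<n. v j) * mat_det n (\<lambda>(j, k). A j k)"
proof -
  have "(\<Prod>j = 0..<n. v (p j)) = (\<Prod>j = 0..<n. v j)" if "p permutes {0..<n}" for p
    using prod.permute[OF that, of v] by (simp add: o_def)
  then show ?thesis
    by (simp add: det_mat_eq_sum prod.distrib sum_distrib_left mult_ac)
qed

lemma taylor_coeff_cnj: "cnj (taylor_coeff saddle_sign j (False, a)) = taylor_coeff saddle_sign j (True, a)"
  by (simp add: taylor_coeff_def saddle_sign_def)

text \<open>The power b^(j+k) in entry (j, k) leaves the determinant through rows and columns, and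
  \<sigma> / b = 2 \<sigma>^3 is the parameter t of the two-block expansion. The constants C1, C2
  and the oscillation enter only through the block factors X.\<close>

lemma airy_tau_expand:
  assumes \<sigma>: "\<sigma> > 0" "b = 1 / (2 * \<sigma>\<^sup>2)"
  shows "airy_tau C1 C2 n (of_real (2 * b\<^sup>2)) =
    of_real ((2 powr (-2/3) / pi * \<sigma>) ^ n * b ^ (2 * \<Sum>{0..<n})) *
    (\<Sum>r\<le>n. ((C2 - \<i> * C1) * cis (4 / 3 * b ^ 3)) ^ (n - r) * ((C2 + \<i> * C1) * cis (- (4 / 3 * b ^ 3))) ^ r *
       of_real (2 * \<sigma> ^ 3) ^ (2 * min_deg n r) * tau_coeff n r (\<sigma> ^ 3))"
proof -
  define X where "X s = (if s then (C2 + \<i> * C1) * cis (- (4 / 3 * b ^ 3)) else (C2 - \<i> * C1) * cis (4 / 3 * b ^ 3))" for s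
  define t where "t = complex_of_real (2 * \<sigma> ^ 3)"
  define H where "H \<rho> \<tau> = (if fst \<rho> = fst \<tau> then X (fst \<rho>) * t ^ (snd \<rho> + snd \<tau>) * airy_moments (fst \<rho>) (snd \<rho> + snd \<tau>) (\<sigma> ^ 3) else 0)" for \<rho> \<tau>
  let ?V = "taylor_coeff saddle_sign" and ?\<alpha> = "2 powr (-2/3) / pi"
  let ?S = "\<lambda>j k. \<Sum>\<rho>\<in>UNIV \<times> {..<n}. \<Sum>\<tau>\<in>UNIV \<times> {..<n}. ?V j \<rho> * H \<rho> \<tau> * ?V k \<tau>"
  have b: "b > 0" using \<sigma> by simp
  define z where "z = complex_of_real (2 * b\<^sup>2)"
  have entry: "(deriv ^^ (j + k)) (airy_phi C1 C2) z = (of_real (?\<alpha> * \<sigma>) * of_real b ^ j) * of_real b ^ k * ?S j k"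
    if jk: "j < n" "k < n" for j k
  proof -
    define E where "E = (\<Sum>a<n. \<Sum>a'<n. ?V j (False, a) * (cis (4 / 3 * b ^ 3) * t ^ (a + a') * airy_h (a + a') (\<sigma> ^ 3)) * ?V k (False, a'))"
    have saddle: "airy_saddle (j + k) b = of_real b ^ (j + k) * of_real \<sigma> * E"
      unfolding E_def t_def by (rule airy_saddle_expand[OF \<sigma> _ jk]) (simp add: saddle_sign_def)
    have cnjE: "cnj E = (\<Sum>a<n. \<Sum>a'<n. ?V j (True, a) * (cis (- (4 / 3 * b ^ 3)) * t ^ (a + a') * cnj (airy_h (a + a') (\<sigma> ^ 3))) * ?V k (True, a'))"
      unfolding E_def by (simp add: taylor_coeff_cnj cis_cnj t_def)
    have split: "(\<Sum>\<rho>\<in>UNIV \<times> {..<n}. F \<rho>) = (\<Sum>a<n. F (False, a)) + (\<Sum>a<n. F (True, a))" for F :: "bool \<times> nat \<Rightarrow> complex"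
      by (simp add: sum.cartesian_product' UNIV_bool)
    have S_eq: "?S j k = (C2 - \<i> * C1) * E + (C2 + \<i> * C1) * cnj E"
      unfolding split cnjE unfolding E_def sum_distrib_left
      by (simp add: H_def X_def airy_moments_def mult_ac)
    have rearrange: "a * (X * (B * B' * s * E) + Y * (B * B' * s * F)) = a * s * B * B' * (X * E + Y * F)" for a X Y B B' s E F :: complex
      by (simp add: algebra_simps)
    have "cnj (airy_saddle (j + k) b) = of_real b ^ (j + k) * of_real \<sigma> * cnj E"
      unfolding saddle by simp
    then show ?thesis
      unfolding z_def higher_deriv_airy_phi[OF b] S_eq by (simp only: saddle power_add rearrange of_real_mult)
  qed
  have "airy_tau C1 C2 n z = mat_det n (\<lambda>(j, k). (of_real (?\<alpha> * \<sigma>) * of_real b ^ j) * of_real b ^ k * ?S j k)"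
    unfolding airy_tau_def by (rule arg_cong[of _ _ Determinant.det], rule eq_matI) (simp_all add: entry)
  also have "\<dots> = (\<Prod>j = 0..<n. of_real (?\<alpha> * \<sigma>) * of_real b ^ j) * (\<Prod>k = 0..<n. of_real b ^ k) * mat_det n (\<lambda>(j, k). ?S j k)"
    by (rule det_mat_scale)
  also have "(\<Prod>j = 0..<n. of_real (?\<alpha> * \<sigma>) * of_real b ^ j) * (\<Prod>k = 0..<n. of_real b ^ k) =
      complex_of_real ((?\<alpha> * \<sigma>) ^ n * b ^ (2 * \<Sum>{0..<n}))"
  proof -
    have "(\<Prod>j = 0..<n. a * B ^ j) * (\<Prod>k = 0..<n. B ^ k) = a ^ n * B ^ (2 * \<Sum>{0..<n})" for a B :: complex
      by (simp add: prod.distrib mult_2 power_add flip: power_sum)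
    then show ?thesis by (simp only: of_real_mult[of "_ ^ _"] of_real_power)
  qed
  also have "mat_det n (\<lambda>(j, k). ?S j k) =
     (\<Sum>r\<le>n. X False ^ (n - r) * X True ^ r * t ^ (2 * min_deg n r) * reduced_det ?V (\<lambda>s k. airy_moments s k (\<sigma> ^ 3)) t n r)"
    by (rule det_two_block_congruence) (simp add: H_def)
  finally show ?thesis by (simp only: X_def t_def tau_coeff_def z_def if_True if_False)
qed

lemma two_sum_lessThan: "2 * \<Sum>{0..<m} + m = (m::nat) * m"
  by (induction m) auto

text \<open>For variance \<omega>^2 / 2 the powers of \<omega> add up to m + 2 (0 + ... + (m - 1)) =
  m^2, which separates the phase from a positive real factor.\<close>

lemma hankel_det_gaussian_moments:
  fixes h :: "nat \<Rightarrow> complex"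
  assumes "h 0 = \<omega> * of_real (sqrt pi)" "h 1 = 0" "\<And>k. h (k + 2) = of_nat (k + 1) * (\<omega>\<^sup>2 / 2) * h k"
  shows "hankel_det h m = \<omega> ^ (m * m) * of_real (sqrt pi ^ m / 2 ^ \<Sum>{0..<m} * barnes_G (m + 1))"
proof -
  have "hankel_det h m = (\<omega> * of_real (sqrt pi)) ^ m * (\<Prod>k<m. (\<omega>\<^sup>2 / 2) ^ k * fact k)"
    using gaussian_hankel_det[of h "\<omega>\<^sup>2 / 2" m] assms by simp
  also have "(\<Prod>k<m. (\<omega>\<^sup>2 / 2) ^ k * fact k) = (\<omega>\<^sup>2 / 2) ^ \<Sum>{0..<m} * of_real (barnes_G (m + 1))"
    by (simp add: prod.distrib barnes_G_def atLeast0LessThan flip: power_sum)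
  also have "(\<omega>\<^sup>2 / 2) ^ \<Sum>{0..<m} = \<omega> ^ (2 * \<Sum>{0..<m}) / 2 ^ \<Sum>{0..<m}"
    by (simp add: power_divide power_mult)
  finally have "hankel_det h m = (\<omega> ^ (2 * \<Sum>{0..<m}) * \<omega> ^ m) * of_real (sqrt pi ^ m / 2 ^ \<Sum>{0..<m} * barnes_G (m + 1))"
    by (simp add: power_mult_distrib mult_ac)
  then show ?thesis by (simp only: power_add[symmetric] two_sum_lessThan)
qed

text \<open>The squared Vandermonde determinant is (-2i)^(2r(n-r)) = (-4)^(r(n-r)). With m = n - r
  the phases of the Hankel blocks combine to (m^2 - r^2) pi/4 = (n - 2r) n pi/4, the constant term
  of \<open>psi\<close>.\<close>

lemma tau_coeff_0:
  assumes "r \<le> n"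
  shows "tau_coeff n r 0 = cis ((real n - 2 * real r) * (real n * pi / 4)) *
    of_real ((-1) ^ (r * (n - r)) * 4 ^ (r * (n - r)) * (sqrt pi ^ n / 2 ^ min_deg n r * barnes_G (r + 1) * barnes_G (n - r + 1)))"
proof -
  define m where "m = n - r"
  define R where "R = r * (n - r)"
  have n: "real n = real m + real r" "n = m + r" using assms by (simp_all add: m_def)
  have "tau_coeff n r 0 = ((saddle_sign True - saddle_sign False) ^ R)\<^sup>2 *
      (hankel_det (\<lambda>k. airy_h k 0) m * hankel_det (\<lambda>k. cnj (airy_h k 0)) r)"
    using reduced_det_0[OF assms, of "taylor_coeff saddle_sign" "\<lambda>s k. airy_moments s k 0"] det_confluent_vandermonde[OF assms, of saddle_sign]
    by (simp add: tau_coeff_def airy_moments_def R_def m_def)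
  also have "((saddle_sign True - saddle_sign False) ^ R)\<^sup>2 = of_real ((-1) ^ R * 4 ^ R)"
  proof -
    have "((saddle_sign True - saddle_sign False) ^ R)\<^sup>2 = ((saddle_sign True - saddle_sign False)\<^sup>2) ^ R"
      by (simp only: power_mult[symmetric] mult.commute)
    also have "(saddle_sign True - saddle_sign False)\<^sup>2 = of_real (-1 * 4)"
      by (simp add: saddle_sign_def power2_eq_square algebra_simps)
    finally show ?thesis by (simp only: power_mult_distrib of_real_power[symmetric])
  qed
  also have "hankel_det (\<lambda>k. airy_h k 0) m = cis (pi / 4) ^ (m * m) * of_real (sqrt pi ^ m / 2 ^ \<Sum>{0..<m} * barnes_G (m + 1))"
    using airy_h_0_values by (intro hankel_det_gaussian_moments) (simp_all add: Complex.DeMoivre)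
  also have "hankel_det (\<lambda>k. cnj (airy_h k 0)) r = cis (- (pi / 4)) ^ (r * r) * of_real (sqrt pi ^ r / 2 ^ \<Sum>{0..<r} * barnes_G (r + 1))"
  proof (rule hankel_det_gaussian_moments)
    show "cnj (airy_h (k + 2) 0) = of_nat (k + 1) * ((cis (- (pi / 4)))\<^sup>2 / 2) * cnj (airy_h k 0)" for k
      unfolding airy_h_0_values by (simp add: Complex.DeMoivre)
  qed (use airy_h_0_values in \<open>simp_all add: cis_cnj\<close>)
  also have "cis (pi / 4) ^ (m * m) * of_real (sqrt pi ^ m / 2 ^ \<Sum>{0..<m} * barnes_G (m + 1)) *
      (cis (- (pi / 4)) ^ (r * r) * of_real (sqrt pi ^ r / 2 ^ \<Sum>{0..<r} * barnes_G (r + 1))) =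
      (cis (pi / 4) ^ (m * m) * cis (- (pi / 4)) ^ (r * r)) *
      of_real (sqrt pi ^ n / 2 ^ min_deg n r * barnes_G (r + 1) * barnes_G (n - r + 1))"
    by (simp add: n(2) min_deg_def power_add mult_ac)
  also have "cis (pi / 4) ^ (m * m) * cis (- (pi / 4)) ^ (r * r) = cis ((real n - 2 * real r) * (real n * pi / 4))"
  proof -
    have "real (m * m) * (pi / 4) + real (r * r) * - (pi / 4) = (real n - 2 * real r) * (real n * pi / 4)"
      by (simp add: n(1) field_simps)
    then show ?thesis by (simp only: Complex.DeMoivre cis_mult)
  qed
  finally show ?thesis by (simp only: R_def of_real_mult mult_ac)
qed

text \<open>Apart from the sign and the Barnes values, every factor is a monomial in 2, z and pi.
  The function \<open>p\<close> is closed under products, quotients and powers, so the identity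
  becomes a comparison of three exponents.\<close>

lemma airy_prefactor:
  assumes z: "z > 0" and r: "r \<le> n"
  defines "\<sigma> \<equiv> (2 * z) powr (-1/4)"
  defines "b \<equiv> 1 / (2 * \<sigma>\<^sup>2)"
  shows "\<sigma> > 0" "2 * b\<^sup>2 = z" "4 / 3 * b ^ 3 = sqrt 2 * z powr (3/2) / 3" "\<sigma> ^ 3 = (2 * z) powr (-3/4)"
    and "(2 powr (-2/3) / pi * \<sigma>) ^ n * b ^ (2 * \<Sum>{0..<n}) * (2 * \<sigma> ^ 3) ^ (2 * min_deg n r) *
      ((-1) ^ (r * (n - r)) * 4 ^ (r * (n - r)) * (sqrt pi ^ n / 2 ^ min_deg n r * barnes_G (r + 1) * barnes_G (n - r + 1))) =
      K_const n * z powr (- (real n ^ 2 / 4)) * (M_const n r * z powr (3/2 * real (r * (n - r))))" (is "?L = ?R")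
proof -
  define p where "p x y w = 2 powr x * z powr y * pi powr w" for x y w :: real
  have pm: "p x y w * p x' y' w' = p (x + x') (y + y') (w + w')" for x y w x' y' w'
    by (simp add: p_def powr_add)
  have pp: "p x y w ^ k = p (x * real k) (y * real k) (w * real k)" for x y w k
    using z by (simp add: p_def power_mult_distrib powr_power mult.commute)
  have pd: "p x y w / p x' y' w' = p (x - x') (y - y') (w - w')" for x y w x' y' w'
    using z by (simp add: p_def powr_diff)
  have p_cong: "x = x' \<Longrightarrow> y = y' \<Longrightarrow> w = w' \<Longrightarrow> p x y w = p x' y' w'" for x y w x' y' w'
    by simp
  have sp: "\<sigma> = p (-1/4) (-1/4) 0" using z by (simp add: \<sigma>_def p_def powr_mult)
  have one: "1 = p 0 0 0" and two: "2 = p 1 0 0" using z by (simp_all add: p_def)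
  have bp: "b = p (-1/2) (1/2) 0"
  proof -
    have "b = p 0 0 0 / (p 1 0 0 * (p (-1/4) (-1/4) 0)\<^sup>2)"
      unfolding b_def sp one[symmetric] two[symmetric] ..
    then show ?thesis unfolding pp pm pd by simp
  qed
  show "\<sigma> > 0" using z by (simp add: \<sigma>_def)
  have "2 * b\<^sup>2 = p 1 0 0 * p (-1/2) (1/2) 0 ^ 2" by (simp only: bp two[symmetric])
  also have "\<dots> = z" unfolding pp pm using z by (simp add: p_def)
  finally show "2 * b\<^sup>2 = z" .
  have "2 * b ^ 3 = p 1 0 0 * p (-1/2) (1/2) 0 ^ 3" by (simp only: bp two[symmetric])
  also have "\<dots> = p (- (1/2)) (3/2) 0" unfolding pp pm by simp
  finally have "4 / 3 * b ^ 3 = 2 * 2 powr (- (1/2)) * z powr (3/2) / 3" by (simp add: p_def)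
  moreover have "2 * 2 powr (- (1/2)) = sqrt (2::real)"
    by (simp add: powr_minus_divide powr_half_sqrt real_div_sqrt)
  ultimately show "4 / 3 * b ^ 3 = sqrt 2 * z powr (3/2) / 3" by (simp only:)
  show "\<sigma> ^ 3 = (2 * z) powr (-3/4)" using z by (simp add: \<sigma>_def powr_power)
  define R where "R = real (r * (n - r))"
  define N where "N = real n"
  have S2: "real (2 * \<Sum>{0..<n}) = N * N - N"
    using arg_cong[OF two_sum_lessThan[of n], of real] by (simp add: N_def)
  \<comment> \<open>With m = n - r, twice the minimal degree plus n is m^2 + r^2 = n^2 - 2 r m. The
    term -2R, through the factor z powr (-3/4) of 2 \<sigma>^3, yields z^(3R/2).\<close>
  have min2: "real (min_deg n r) = (N * N - N - 2 * R) / 2"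
  proof -
    define m where "m = n - r"
    have n: "n = m + r" using r by (simp add: m_def)
    have "2 * min_deg n r + n = m * m + r * r"
      using two_sum_lessThan[of m] two_sum_lessThan[of r] by (simp add: min_deg_def n)
    then have "2 * min_deg n r + n + 2 * (r * m) = n * n" by (simp add: n algebra_simps)
    from arg_cong[OF this, of real] have "2 * real (min_deg n r) + N + 2 * R = N * N"
      by (simp add: N_def R_def m_def)
    then show ?thesis by simp
  qed
  have min2': "real (2 * min_deg n r) = N * N - N - 2 * R" using min2 by simp
  have factors: "2 powr (-2/3) / pi * \<sigma> = p (-11/12) (-1/4) (-1)" "2 * \<sigma> ^ 3 = p (1/4) (-3/4) 0"
    "4 ^ (r * (n - r)) = p (2 * R) 0 0" "sqrt pi ^ n = p 0 0 (N / 2)" "2 ^ min_deg n r = p (real (min_deg n r)) 0 0"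
  proof -
    have "2 powr (-2/3) / pi = p (-2/3) 0 (-1)" using z by (simp add: p_def powr_minus_divide)
    then show "2 powr (-2/3) / pi * \<sigma> = p (-11/12) (-1/4) (-1)" unfolding sp by (simp only: pm) simp
    have "2 * \<sigma> ^ 3 = p 1 0 0 * p (-1/4) (-1/4) 0 ^ 3" by (simp only: sp two[symmetric])
    then show "2 * \<sigma> ^ 3 = p (1/4) (-3/4) 0" unfolding pp pm by simp
    have "(4::real) ^ (r * (n - r)) = (p 1 0 0 ^ 2) ^ (r * (n - r))" by (simp flip: two)
    then show "4 ^ (r * (n - r)) = p (2 * R) 0 0" unfolding pp by (simp add: R_def)
    have "sqrt pi = p 0 0 (1/2)" using z by (simp add: p_def powr_half_sqrt)
    then have "sqrt pi ^ n = p 0 0 (1/2) ^ n" by simp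
    then show "sqrt pi ^ n = p 0 0 (N / 2)" unfolding pp by (simp add: N_def)
    have "(2::real) ^ min_deg n r = p 1 0 0 ^ min_deg n r" by (simp flip: two)
    then show "2 ^ min_deg n r = p (real (min_deg n r)) 0 0" unfolding pp by simp
  qed
  have "p (-11/12) (-1/4) (-1) ^ n * p (-1/2) (1/2) 0 ^ (2 * \<Sum>{0..<n}) * p (1/4) (-3/4) 0 ^ (2 * min_deg n r) * p (2 * R) 0 0 *
     (p 0 0 (N / 2) / p (real (min_deg n r)) 0 0) = p (- (3 * N\<^sup>2 / 4) - N / 6 + 5 / 2 * R) (- (N\<^sup>2 / 4) + 3 / 2 * R) (- (N / 2))"
    unfolding pp S2 min2' unfolding pm pd min2 N_def[symmetric]
    by (rule p_cong) (simp_all add: power2_eq_square field_simps)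
  moreover have "?R =
     p (- (3 * N\<^sup>2 / 4) - N / 6 + 5 / 2 * R) (- (N\<^sup>2 / 4) + 3 / 2 * R) (- (N / 2)) * ((-1) ^ (r * (n - r)) * barnes_G (r + 1) * barnes_G (n - r + 1))"
    unfolding p_def powr_add by (simp add: K_const_def M_const_def N_def R_def powr_minus_divide mult_ac)
  moreover have rearrange: "a * b * c * (e * f * (g / h * u * v)) = a * b * c * f * (g / h) * (e * u * v)" for a b c e f g h u v :: real
    by (simp only: mult_ac)
  ultimately show "?L = ?R"
    unfolding factors bp by (simp only: rearrange)
qed

section \<open>Normalised amplitudes\<close>

lemma tau_coeff_0_nonzero: "r \<le> n \<Longrightarrow> tau_coeff n r 0 \<noteq> 0"
  by (simp add: tau_coeff_0 barnes_G_def)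

text \<open>Dividing by the value at 0 moves the phase into \<open>psi\<close> and the constants
  into \<open>M_const\<close>, so that the amplitude at \<epsilon> = 0 is just the product of powers
  of C2 - \<i> C1 and C2 + \<i> C1.\<close>

definition airy_amplitude :: "complex \<Rightarrow> complex \<Rightarrow> nat \<Rightarrow> nat \<Rightarrow> real \<Rightarrow> complex" where
  "airy_amplitude C1 C2 n r \<epsilon> = (C2 - \<i> * C1) ^ (n - r) * (C2 + \<i> * C1) ^ r * (tau_coeff n r \<epsilon> / tau_coeff n r 0)"

text \<open>An exact identity for every z > 0; the asymptotic statement concerns the amplitudes
  only.\<close>

lemma airy_tau_eq_sum:
  assumes z: "z > 0"
  shows "airy_tau C1 C2 n (of_real z) = of_real (K_const n * z powr (- (real n ^ 2 / 4))) *
    (\<Sum>r\<le>n. of_real (M_const n r * z powr (3/2 * real (r * (n - r)))) * airy_amplitude C1 C2 n r ((2 * z) powr (-3/4)) * cis (psi n r z))"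
proof -
  define \<sigma> where "\<sigma> = (2 * z) powr (-1/4)"
  define b where "b = 1 / (2 * \<sigma>\<^sup>2)"
  define \<zeta> where "\<zeta> = sqrt 2 * z powr (3/2) / 3"
  define A where "A = (2 powr (-2/3) / pi * \<sigma>) ^ n * b ^ (2 * \<Sum>{0..<n})"
  note pre = airy_prefactor[OF z, folded \<sigma>_def, folded b_def]
  have "airy_tau C1 C2 n (of_real (2 * b\<^sup>2)) = of_real A *
    (\<Sum>r\<le>n. ((C2 - \<i> * C1) * cis (4 / 3 * b ^ 3)) ^ (n - r) * ((C2 + \<i> * C1) * cis (- (4 / 3 * b ^ 3))) ^ r *
       of_real (2 * \<sigma> ^ 3) ^ (2 * min_deg n r) * tau_coeff n r (\<sigma> ^ 3))"
    unfolding A_def by (rule airy_tau_expand[OF pre(1)[of n n] b_def]) simp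
  also have "2 * b\<^sup>2 = z" by (rule pre(2)[of n n]) simp
  also have "4 / 3 * b ^ 3 = \<zeta>" unfolding \<zeta>_def by (rule pre(3)[of n n]) simp
  also have "of_real A * (\<Sum>r\<le>n. ((C2 - \<i> * C1) * cis \<zeta>) ^ (n - r) * ((C2 + \<i> * C1) * cis (- \<zeta>)) ^ r *
       of_real (2 * \<sigma> ^ 3) ^ (2 * min_deg n r) * tau_coeff n r (\<sigma> ^ 3)) =
    (\<Sum>r\<le>n. of_real (K_const n * z powr (- (real n ^ 2 / 4))) * (of_real (M_const n r * z powr (3/2 * real (r * (n - r)))) *
       airy_amplitude C1 C2 n r (\<sigma> ^ 3) * cis (psi n r z)))"
    unfolding sum_distrib_left
  proof (intro sum.cong refl)
    fix r assume "r \<in> {..n}"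
    then have r: "r \<le> n" by simp
    define U where "U = (C2 - \<i> * C1) ^ (n - r) * (C2 + \<i> * C1) ^ r"
    define q where "q = tau_coeff n r (\<sigma> ^ 3) / tau_coeff n r 0"
    define c where "c = (-1) ^ (r * (n - r)) * 4 ^ (r * (n - r)) * (sqrt pi ^ n / 2 ^ min_deg n r * barnes_G (r + 1) * barnes_G (n - r + 1))"
    define \<theta> where "\<theta> = (real n - 2 * real r) * (real n * pi / 4)"
    have tau: "tau_coeff n r (\<sigma> ^ 3) = cis \<theta> * of_real c * q"
      unfolding \<theta>_def c_def tau_coeff_0[OF r, symmetric] q_def using tau_coeff_0_nonzero[OF r] by simp
    have amp: "airy_amplitude C1 C2 n r (\<sigma> ^ 3) = U * q"
      by (simp only: airy_amplitude_def U_def q_def)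
    have "cis \<zeta> ^ (n - r) * cis (- \<zeta>) ^ r * cis \<theta> = cis (psi n r z)"
    proof -
      have "real (n - r) * \<zeta> + real r * - \<zeta> + \<theta> = psi n r z"
        using r by (simp add: psi_def \<theta>_def \<zeta>_def of_nat_diff field_simps)
      then show ?thesis by (simp only: Complex.DeMoivre cis_mult)
    qed
    moreover have "of_real A * of_real (2 * \<sigma> ^ 3) ^ (2 * min_deg n r) * of_real c =
        complex_of_real (K_const n * z powr (- (real n ^ 2 / 4)) * (M_const n r * z powr (3/2 * real (r * (n - r)))))"
      unfolding pre(5)[OF r, symmetric] A_def c_def by (simp only: of_real_mult of_real_power)
    ultimately have "of_real (K_const n * z powr (- (real n ^ 2 / 4)) * (M_const n r * z powr (3/2 * real (r * (n - r))))) * (U * q) * cis (psi n r z) =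
       (of_real A * of_real (2 * \<sigma> ^ 3) ^ (2 * min_deg n r) * of_real c) * (U * q) * (cis \<zeta> ^ (n - r) * cis (- \<zeta>) ^ r * cis \<theta>)"
      by (simp only:)
    then show "of_real A * (((C2 - \<i> * C1) * cis \<zeta>) ^ (n - r) * ((C2 + \<i> * C1) * cis (- \<zeta>)) ^ r *
       of_real (2 * \<sigma> ^ 3) ^ (2 * min_deg n r) * tau_coeff n r (\<sigma> ^ 3)) =
       of_real (K_const n * z powr (- (real n ^ 2 / 4))) * (of_real (M_const n r * z powr (3/2 * real (r * (n - r)))) *
       airy_amplitude C1 C2 n r (\<sigma> ^ 3) * cis (psi n r z))"
      unfolding amp tau power_mult_distrib[of "C2 - _"] power_mult_distrib[of "C2 + _"]
      unfolding U_def of_real_mult by (simp only: mult_ac)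
  qed
  also have "\<sigma> ^ 3 = (2 * z) powr (-3/4)" by (rule pre(4)[of n n]) simp
  finally show ?thesis by (simp only: sum_distrib_left)
qed

section \<open>The oscillatory form\<close>

text \<open>Both binomial sums are regrouped by k = q + l. The bounds on q encode q \<le> m and 0
  \<le> k - q \<le> r, the truncated k - r standing for max 0 (k - r).\<close>

lemma binomial_product_coeffs:
  fixes u v :: "'a::comm_ring_1"
  shows "(v - u) ^ m * (v + u) ^ r = (\<Sum>k\<le>m + r. u ^ k * v ^ (m + r - k) *
     (\<Sum>q = k - r..min k m. (-1) ^ q * of_nat (r choose (k - q)) * of_nat (m choose q)))"
proof -
  have "(v - u) ^ m * (v + u) ^ r = (\<Sum>q\<le>m. of_nat (m choose q) * (- u) ^ q * v ^ (m - q)) * (\<Sum>l\<le>r. of_nat (r choose l) * u ^ l * v ^ (r - l))"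
    by (simp only: binomial_ring[symmetric]) (simp add: add.commute)
  also have "\<dots> = (\<Sum>(q, l)\<in>{..m} \<times> {..r}. u ^ (q + l) * v ^ (m + r - (q + l)) * ((-1) ^ q * of_nat (r choose l) * of_nat (m choose q)))"
    unfolding sum_product sum.cartesian_product
  proof (rule sum.cong[OF refl])
    have "of_nat (m choose q) * (- u) ^ q * v ^ (m - q) * (of_nat (r choose l) * u ^ l * v ^ (r - l)) =
      u ^ (q + l) * v ^ (m + r - (q + l)) * ((-1) ^ q * of_nat (r choose l) * of_nat (m choose q))"
      if "q \<le> m" "l \<le> r" for q l
    proof -
      have "v ^ (m + r - (q + l)) = v ^ (m - q) * v ^ (r - l)" using that by (simp flip: power_add)
      then show ?thesis by (simp add: power_add power_minus[of u] mult_ac)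
    qed
    then show "(case x of (q, l) \<Rightarrow> of_nat (m choose q) * (- u) ^ q * v ^ (m - q) * (of_nat (r choose l) * u ^ l * v ^ (r - l))) =
      (case x of (q, l) \<Rightarrow> u ^ (q + l) * v ^ (m + r - (q + l)) * ((-1) ^ q * of_nat (r choose l) * of_nat (m choose q)))"
      if "x \<in> {..m} \<times> {..r}" for x
      using that by (cases x) (simp only: split_conv mem_Times_iff fst_conv snd_conv atMost_iff)
  qed
  also have "\<dots> = (\<Sum>(k, q)\<in>(SIGMA k:{..m + r}. {k - r..min k m}). u ^ k * v ^ (m + r - k) * ((-1) ^ q * of_nat (r choose (k - q)) * of_nat (m choose q)))"
    by (rule sum.reindex_bij_witness[of _ "\<lambda>(k, q). (q, k - q)" "\<lambda>(q, l). (q + l, q)"]) auto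
  also have "\<dots> = (\<Sum>k\<le>m + r. \<Sum>q = k - r..min k m. u ^ k * v ^ (m + r - k) * ((-1) ^ q * of_nat (r choose (k - q)) * of_nat (m choose q)))"
    by (rule sum.Sigma[symmetric]) auto
  finally show ?thesis by (simp only: sum_distrib_left)
qed

lemma sum_even_odd_parts:
  fixes F :: "nat \<Rightarrow> complex"
  shows "((\<Sum>k\<le>n. F k) + (\<Sum>k\<le>n. (-1) ^ k * F k)) / 2 = (\<Sum>p = 0..n div 2. F (2 * p))"
    and "n \<ge> 1 \<Longrightarrow> ((\<Sum>k\<le>n. F k) - (\<Sum>k\<le>n. (-1) ^ k * F k)) / 2 = (\<Sum>p = 0..(n + 1) div 2 - 1. F (2 * p + 1))"
proof -
  have "((\<Sum>k\<le>n. F k) + (\<Sum>k\<le>n. (-1) ^ k * F k)) / 2 = (\<Sum>k\<le>n. if even k then F k else 0)"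
    by (simp only: sum.distrib[symmetric] sum_divide_distrib) (rule sum.cong, auto)
  also have "\<dots> = (\<Sum>k\<in>{k\<in>{..n}. even k}. F k)"
    by (rule sum.inter_filter[symmetric]) simp
  also have "\<dots> = (\<Sum>p = 0..n div 2. F (2 * p))"
    by (rule sum.reindex_bij_witness[of _ "\<lambda>p. 2 * p" "\<lambda>k. k div 2"]) auto
  finally show "((\<Sum>k\<le>n. F k) + (\<Sum>k\<le>n. (-1) ^ k * F k)) / 2 = (\<Sum>p = 0..n div 2. F (2 * p))" .
  \<comment> \<open>For n = 0 the truncated upper limit would still admit p = 0, that is the index 1
    beyond n.\<close>
  assume n: "n \<ge> 1"
  have "((\<Sum>k\<le>n. F k) - (\<Sum>k\<le>n. (-1) ^ k * F k)) / 2 = (\<Sum>k\<le>n. if odd k then F k else 0)"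
    by (simp only: sum_subtractf[symmetric] sum_divide_distrib) (rule sum.cong, auto)
  also have "\<dots> = (\<Sum>k\<in>{k\<in>{..n}. odd k}. F k)"
    by (rule sum.inter_filter[symmetric]) simp
  also have "\<dots> = (\<Sum>p = 0..(n + 1) div 2 - 1. F (2 * p + 1))"
    using n by (intro sum.reindex_bij_witness[of _ "\<lambda>p. 2 * p + 1" "\<lambda>k. k div 2"]) (auto elim!: oddE)
  finally show "((\<Sum>k\<le>n. F k) - (\<Sum>k\<le>n. (-1) ^ k * F k)) / 2 = (\<Sum>p = 0..(n + 1) div 2 - 1. F (2 * p + 1))" .
qed

text \<open>Exchanging r and n - r amounts to replacing C1 by - C1. Half the sum and half the
  difference are therefore the even and odd parts in C1 of one binomial product, and \<i> *
  \<i>^(2p+1) = (-1)^(p+1) gives the sign in \<open>d_lead\<close>.\<close>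

lemma lead_coeffs:
  fixes C1 C2 :: complex
  assumes r: "r \<le> n" and n: "n \<ge> 1"
  defines "U \<equiv> \<lambda>r. (C2 - \<i> * C1) ^ (n - r) * (C2 + \<i> * C1) ^ r"
  shows "(U r + U (n - r)) / 2 = b_lead C1 C2 n r" "\<i> * (U r - U (n - r)) / 2 = d_lead C1 C2 n r"
proof -
  define c where "c k = (\<Sum>q = k - r..min k (n - r). (-1) ^ q * of_nat (r choose (k - q)) * of_nat ((n - r) choose q) :: complex)" for k
  define F where "F k = (\<i> * C1) ^ k * C2 ^ (n - k) * c k" for k
  have 1: "U r = (\<Sum>k\<le>n. F k)"
    using binomial_product_coeffs[of C2 "\<i> * C1" "n - r" r] r by (simp add: U_def F_def c_def)
  have 2: "U (n - r) = (\<Sum>k\<le>n. (-1) ^ k * F k)"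
  proof -
    have "U (n - r) = (C2 - (- (\<i> * C1))) ^ (n - r) * (C2 + - (\<i> * C1)) ^ r"
      using r by (simp add: U_def mult.commute)
    also have "\<dots> = (\<Sum>k\<le>n. (- (\<i> * C1)) ^ k * C2 ^ (n - k) * c k)"
      using binomial_product_coeffs[of C2 "- (\<i> * C1)" "n - r" r] r by (simp only: c_def) simp
    also have "\<dots> = (\<Sum>k\<le>n. (-1) ^ k * F k)"
      by (intro sum.cong refl) (simp add: F_def power_minus[of "\<i> * C1"] mult.assoc)
    finally show ?thesis .
  qed
  show "(U r + U (n - r)) / 2 = b_lead C1 C2 n r"
    unfolding 1 2 sum_even_odd_parts(1) b_lead_def
    by (intro sum.cong refl) (simp add: F_def c_def power_mult_distrib power_mult power_minus[of "C1\<^sup>2"])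
  have "\<i> * (U r - U (n - r)) / 2 = (\<Sum>p = 0..(n + 1) div 2 - 1. \<i> * F (2 * p + 1))"
    using sum_even_odd_parts(2)[OF n, of F] unfolding 1 2 by (simp only: sum_distrib_left[symmetric]) simp
  also have "\<dots> = d_lead C1 C2 n r"
    unfolding d_lead_def
  proof (intro sum.cong refl)
    fix p
    have "(\<i> * C1) ^ (2 * p + 1) = \<i> * (-1) ^ p * C1 ^ (2 * p + 1)"
      by (simp add: power_mult_distrib power_mult power_minus[of "C1\<^sup>2"])
    moreover have "\<i> * (\<i> * x * y * w * t) = x * -1 * y * w * t" for x y w t :: complex
      by (simp flip: mult.assoc)
    moreover have "(-1) ^ (p + 1) = (-1) ^ p * (-1 :: complex)" "n - (2 * p + 1) = n - 2 * p - 1" by simp_all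
    ultimately show "\<i> * F (2 * p + 1) = (-1) ^ (p + 1) * C1 ^ (2 * p + 1) * C2 ^ (n - 2 * p - 1) *
        (\<Sum>q = 2 * p + 1 - r..min (2 * p + 1) (n - r). (-1) ^ q * of_nat (r choose (2 * p + 1 - q)) * of_nat ((n - r) choose q))"
      unfolding F_def c_def by (simp only:)
  qed
  finally show "\<i> * (U r - U (n - r)) / 2 = d_lead C1 C2 n r" .
qed

text \<open>The remainder is taken at order 2N + 2 in \<epsilon>, which beats the last scale
  function by z^(-3/2) and so gives little o. The coefficients acquire powers of 2 because
  \<epsilon>^(2j) = (2z)^(-3j/2).\<close>

lemma poincare_expansion_even:
  assumes J: "has_expansion J a" and odd: "\<And>j. odd j \<Longrightarrow> a j = 0"
  shows "poincare_expansion (\<lambda>z. H z * J ((2 * z) powr (-3/4))) H (\<lambda>j. a (2 * j) * of_real (2 powr (- (3 * real j / 2))))"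
  unfolding poincare_expansion_def
proof
  fix N
  let ?S = "\<lambda>z. \<Sum>j\<le>N. a (2 * j) * of_real (2 powr (- (3 * real j / 2))) / of_real (z powr (3 * real j / 2))"
  obtain C where C: "C \<ge> 0" "\<And>\<epsilon>. \<bar>\<epsilon>\<bar> \<le> 1 \<Longrightarrow> norm (J \<epsilon> - (\<Sum>j<2 * N + 2. a j * of_real \<epsilon> ^ j)) \<le> C * \<bar>\<epsilon>\<bar> ^ (2 * N + 2)"
    using J by (rule has_expansionE[where N = "2 * N + 2"]) (rule that)
  have bound: "norm (J ((2 * z) powr (-3/4)) - ?S z) \<le> C * z powr (-3/2) / z powr (3 * real N / 2)" if z: "z \<ge> 1" for z
  proof -
    define \<epsilon> where "\<epsilon> = (2 * z) powr (-3/4)"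
    have "\<epsilon> \<le> 1" "\<epsilon> > 0" using z powr_mono[of "-3/4" 0 "2 * z"] by (simp_all add: \<epsilon>_def)
    then have \<epsilon>: "\<bar>\<epsilon>\<bar> \<le> 1" by simp
    have pow: "\<epsilon> ^ (2 * j) = 2 powr (- (3 * real j / 2)) / z powr (3 * real j / 2)" for j
    proof -
      have "\<epsilon> ^ (2 * j) = (2 * z) powr (real (2 * j) * (-3/4))"
        unfolding \<epsilon>_def using z by (subst powr_power) auto
      also have "real (2 * j) * (-3/4) = - (3 * real j / 2)" by simp
      finally show ?thesis by (simp add: powr_mult powr_minus_divide)
    qed
    have "(\<Sum>j<2 * N + 2. a j * of_real \<epsilon> ^ j) = (\<Sum>j\<in>(\<lambda>i. 2 * i) ` {..N}. a j * of_real \<epsilon> ^ j)"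
    proof (rule sum.mono_neutral_right)
      show "\<forall>j\<in>{..<2 * N + 2} - (\<lambda>i. 2 * i) ` {..N}. a j * of_real \<epsilon> ^ j = 0"
        using odd by (auto elim!: evenE simp: image_iff) (metis atMost_iff dvd_def less_Suc_eq_le mult_Suc_right nat_mult_less_cancel1 zero_less_numeral add_2_eq_Suc)
    qed auto
    also have "\<dots> = ?S z"
      by (subst sum.reindex) (auto simp: inj_on_def pow simp flip: of_real_power intro!: sum.cong)
    finally have "norm (J \<epsilon> - ?S z) \<le> C * \<bar>\<epsilon>\<bar> ^ (2 * N + 2)" using C(2)[OF \<epsilon>] by simp
    also have "\<bar>\<epsilon>\<bar> ^ (2 * N + 2) = \<epsilon> ^ (2 * (N + 1))" using \<open>\<epsilon> > 0\<close> by simp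
    also have "\<dots> \<le> 1 / z powr (3 * real (N + 1) / 2)"
      unfolding pow by (intro divide_right_mono) (simp_all add: powr_minus_divide ge_one_powr_ge_zero)
    also have "\<dots> = z powr (-3/2) / z powr (3 * real N / 2)"
      using z by (simp add: powr_minus_divide powr_add[symmetric] algebra_simps add_divide_distrib)
    finally show ?thesis using C(1) by (simp add: \<epsilon>_def mult_left_mono)
  qed
  show "(\<lambda>z. H z * J ((2 * z) powr (-3/4)) - H z * ?S z) \<in> o[at_top](\<lambda>z. H z / of_real (z powr (3 * real N / 2)))"
  proof (rule landau_o.smallI)
    fix c :: real assume c: "c > 0"
    have "((\<lambda>z::real. C * z powr (-3/2)) \<longlongrightarrow> 0) at_top" by real_asymp
    from order_tendstoD(2)[OF this c] have ev: "eventually (\<lambda>z. C * z powr (-3/2) < c) at_top" .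
    show "eventually (\<lambda>z. norm (H z * J ((2 * z) powr (-3/4)) - H z * ?S z) \<le> c * norm (H z / of_real (z powr (3 * real N / 2)))) at_top"
      using ev eventually_ge_at_top[of 1]
    proof eventually_elim
      case (elim z)
      have "norm (H z * J ((2 * z) powr (-3/4)) - H z * ?S z) = norm (H z) * norm (J ((2 * z) powr (-3/4)) - ?S z)"
        by (simp only: right_diff_distrib[symmetric] norm_mult)
      also have "\<dots> \<le> norm (H z) * (C * z powr (-3/2) / z powr (3 * real N / 2))"
        using bound[OF elim(2)] by (intro mult_left_mono) auto
      also have "\<dots> \<le> norm (H z) * (c / z powr (3 * real N / 2))"
        using elim by (intro mult_left_mono divide_right_mono) auto
      finally show ?case by (simp add: norm_divide mult_ac)
    qed
  qed
qed

text \<open>Reflecting \<epsilon> multiplies the k-th moment by (-1)^k in both blocks, which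
  \<open>reduced_det_parity\<close> translates into evenness of the amplitude; only powers of
  z^(-3/2) can then occur.\<close>

lemma airy_amplitude_expansion:
  obtains a where "\<And>r. has_expansion (airy_amplitude C1 C2 n r) (a r)" "\<And>r j. odd j \<Longrightarrow> a r j = 0"
proof -
  have "\<exists>a. has_expansion (airy_amplitude C1 C2 n r) a \<and> (\<forall>j. odd j \<longrightarrow> a j = 0)" for r
  proof -
    have h: "expandable (airy_moments s k)" for s k
    proof (cases s)
      case True
      then have "airy_moments s k = (\<lambda>\<epsilon>. cnj (airy_h k \<epsilon>))" by (simp add: airy_moments_def fun_eq_iff)
      then show ?thesis using has_expansion_cnj[OF has_expansion_airy_h[of k]] by (auto simp: expandable_def)
    next
      case False
      then have "airy_moments s k = airy_h k" by (simp add: airy_moments_def fun_eq_iff)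
      then show ?thesis using has_expansion_airy_h[of k] by (auto simp: expandable_def)
    qed
    have "expandable (tau_coeff n r)"
      using expandable_reduced_det[of airy_moments, OF h] by (simp add: tau_coeff_def[abs_def])
    then have "expandable (airy_amplitude C1 C2 n r)"
      unfolding airy_amplitude_def[abs_def] divide_inverse by (intro expandable_mult expandable_const)
    then obtain a where a: "has_expansion (airy_amplitude C1 C2 n r) a" by (auto simp: expandable_def)
    have "airy_moments s k (- \<epsilon>) = (-1) ^ k * airy_moments s k \<epsilon>" for s k \<epsilon>
      by (simp add: airy_moments_def airy_h_minus)
    then have "tau_coeff n r (- \<epsilon>) = tau_coeff n r \<epsilon>" for \<epsilon>
      using reduced_det_parity[of "taylor_coeff saddle_sign" "\<lambda>s k. airy_moments s k \<epsilon>" "of_real (2 * \<epsilon>)" n r]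
      by (simp add: tau_coeff_def)
    then have "airy_amplitude C1 C2 n r (- \<epsilon>) = airy_amplitude C1 C2 n r \<epsilon>" for \<epsilon>
      by (simp add: airy_amplitude_def)
    from has_expansion_even[OF a this] show ?thesis by (intro exI) auto
  qed
  then show ?thesis using that by metis
qed

section \<open>Pairing the terms r and n - r\<close>

lemma M_const_reflect: "r \<le> n \<Longrightarrow> M_const n (n - r) = M_const n r"
  by (simp add: M_const_def mult.commute)

lemma psi_reflect: "r \<le> n \<Longrightarrow> psi n (n - r) z = - psi n r z"
proof -
  assume "r \<le> n"
  then have "real n - 2 * real (n - r) = - (real n - 2 * real r)" by (simp add: of_nat_diff)
  then show ?thesis by (simp only: psi_def mult_minus_left)
qed

lemma sum_reflect_pairs:
  fixes g :: "nat \<Rightarrow> complex"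
  assumes s: "s \<ge> 1"
  shows "(\<Sum>r\<le>2 * s. g r) = g s + (\<Sum>r = 0..s - 1. g r + g (2 * s - r))"
    and "(\<Sum>r\<le>2 * s - 1. g r) = (\<Sum>r = 0..s - 1. g r + g (2 * s - 1 - r))"
proof -
  have "{..2 * s} = insert s ({0..s - 1} \<union> {s + 1..2 * s})" using s by auto
  then have "(\<Sum>r\<le>2 * s. g r) = g s + (\<Sum>r\<in>{0..s - 1} \<union> {s + 1..2 * s}. g r)"
    using s by simp
  also have "(\<Sum>r\<in>{0..s - 1} \<union> {s + 1..2 * s}. g r) = (\<Sum>r = 0..s - 1. g r) + (\<Sum>r = s + 1..2 * s. g r)"
    using s by (intro sum.union_disjoint) auto
  also have "(\<Sum>r = s + 1..2 * s. g r) = (\<Sum>r = 0..s - 1. g (2 * s - r))"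
    using s by (intro sum.reindex_bij_witness[of _ "\<lambda>r. 2 * s - r" "\<lambda>r. 2 * s - r"]) auto
  finally show "(\<Sum>r\<le>2 * s. g r) = g s + (\<Sum>r = 0..s - 1. g r + g (2 * s - r))"
    by (simp only: sum.distrib)
  have "{..2 * s - 1} = {0..s - 1} \<union> {s..2 * s - 1}" using s by auto
  then have "(\<Sum>r\<le>2 * s - 1. g r) = (\<Sum>r = 0..s - 1. g r) + (\<Sum>r = s..2 * s - 1. g r)"
    using s by (simp only:) (intro sum.union_disjoint, auto)
  also have "(\<Sum>r = s..2 * s - 1. g r) = (\<Sum>r = 0..s - 1. g (2 * s - 1 - r))"
    using s by (intro sum.reindex_bij_witness[of _ "\<lambda>r. 2 * s - 1 - r" "\<lambda>r. 2 * s - 1 - r"]) auto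
  finally show "(\<Sum>r\<le>2 * s - 1. g r) = (\<Sum>r = 0..s - 1. g r + g (2 * s - 1 - r))"
    by (simp only: sum.distrib)
qed

theorem theorem2p5:
  fixes C1 C2 :: complex
  shows "\<exists>(B :: nat \<Rightarrow> nat \<Rightarrow> real \<Rightarrow> complex) (D :: nat \<Rightarrow> nat \<Rightarrow> real \<Rightarrow> complex)
            (b :: nat \<Rightarrow> nat \<Rightarrow> nat \<Rightarrow> complex) (d :: nat \<Rightarrow> nat \<Rightarrow> nat \<Rightarrow> complex).
    (\<forall>s::nat. s \<ge> 1 \<longrightarrow> (\<forall>z::real. z > 0 \<longrightarrow>
       airy_tau C1 C2 (2 * s) (of_real z) =
         of_real (K_const (2 * s) * z powr (- (real s ^ 2))) *
         (B (2 * s) s z + 2 * (\<Sum>r = 0..s - 1.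
            B (2 * s) r z * of_real (cos (psi (2 * s) r z)) +
            D (2 * s) r z * of_real (sin (psi (2 * s) r z)))) \<and>
       airy_tau C1 C2 (2 * s - 1) (of_real z) =
         of_real (2 * K_const (2 * s - 1) * z powr (- ((2 * real s - 1) ^ 2 / 4))) *
         (\<Sum>r = 0..s - 1.
            B (2 * s - 1) r z * of_real (cos (psi (2 * s - 1) r z)) +
            D (2 * s - 1) r z * of_real (sin (psi (2 * s - 1) r z))))) \<and>
    (\<forall>(n::nat) (r::nat). n \<ge> 1 \<and> 2 * r \<le> n \<longrightarrow>
       poincare_expansion (B n r)
         (\<lambda>z. of_real (M_const n r * z powr (3/2 * real (r * (n - r))))) (b n r) \<and>
       poincare_expansion (D n r)
         (\<lambda>z. of_real (M_const n r * z powr (3/2 * real (r * (n - r))))) (d n r) \<and>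
       b n r 0 = b_lead C1 C2 n r \<and>
       d n r 0 = d_lead C1 C2 n r)"
proof -
  have "\<exists>a. \<forall>n r. has_expansion (airy_amplitude C1 C2 n r) (a n r) \<and> (\<forall>j. odd j \<longrightarrow> a n r j = 0)"
    by (intro choice allI) (metis airy_amplitude_expansion)
  then obtain a where a: "\<And>n r. has_expansion (airy_amplitude C1 C2 n r) (a n r)" "\<And>n r j. odd j \<Longrightarrow> a n r j = 0"
    by blast
  define \<epsilon> where "\<epsilon> z = (2 * z) powr (-3/4)" for z :: real
  define H where "H n r z = complex_of_real (M_const n r * z powr (3/2 * real (r * (n - r))))" for n r z
  \<comment> \<open>From P cis \<psi> + Q cis (- \<psi>) = (P + Q) cos \<psi> + \<i> (P - Q) sin
    \<psi>; the halves compensate the factor 2 in front of the sums.\<close>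
  define JB where "JB n r x = 1 / 2 * airy_amplitude C1 C2 n r x + 1 / 2 * airy_amplitude C1 C2 n (n - r) x" for n r x
  define JD where "JD n r x = \<i> / 2 * airy_amplitude C1 C2 n r x + - \<i> / 2 * airy_amplitude C1 C2 n (n - r) x" for n r x
  define B where "B n r z = H n r z * JB n r (\<epsilon> z)" for n r z
  define D where "D n r z = H n r z * JD n r (\<epsilon> z)" for n r z
  define aB where "aB n r j = 1 / 2 * a n r j + 1 / 2 * a n (n - r) j" for n r j
  define aD where "aD n r j = \<i> / 2 * a n r j + - \<i> / 2 * a n (n - r) j" for n r j
  define b where "b n r j = aB n r (2 * j) * of_real (2 powr (- (3 * real j / 2)))" for n r j
  define d where "d n r j = aD n r (2 * j) * of_real (2 powr (- (3 * real j / 2)))" for n r j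
  have scale: "has_expansion (\<lambda>x. c * J x) (\<lambda>j. c * v j)" if "has_expansion J v" for c J v
  proof -
    have "(\<Sum>i\<le>j. (if i = 0 then c else 0) * v (j - i)) = (\<Sum>i\<in>{0}. (if i = 0 then c else 0) * v (j - i))" for j
      by (rule sum.mono_neutral_right) auto
    then show ?thesis using has_expansion_mult[OF has_expansion_const[of c] that] by simp
  qed
  have JB: "has_expansion (JB n r) (aB n r)" and JD: "has_expansion (JD n r) (aD n r)" for n r
    unfolding JB_def[abs_def] JD_def[abs_def] aB_def[abs_def] aD_def[abs_def] by (intro has_expansion_add scale a)+
  have H_reflect: "H n (n - r) z = H n r z" if "r \<le> n" for n r z
    using that by (simp add: H_def M_const_reflect mult.commute)
  define g where "g n z r = H n r z * airy_amplitude C1 C2 n r (\<epsilon> z) * cis (psi n r z)" for n z r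
  have tau: "airy_tau C1 C2 n (of_real z) = of_real (K_const n * z powr (- (real n ^ 2 / 4))) * (\<Sum>r\<le>n. g n z r)" if "z > 0" for n z
    unfolding g_def H_def \<epsilon>_def by (rule airy_tau_eq_sum[OF that])
  have pair: "g n z r + g n z (n - r) = 2 * (B n r z * of_real (cos (psi n r z)) + D n r z * of_real (sin (psi n r z)))"
    if "r \<le> n" for n r z
  proof -
    have "h * p * (c + \<i> * s) + h * q * (c - \<i> * s) = 2 * (h * (1 / 2 * p + 1 / 2 * q) * c + h * (\<i> / 2 * p + - \<i> / 2 * q) * s)"
      for h p q c s :: complex
      by (simp add: algebra_simps)
    moreover have "cis x = of_real (cos x) + \<i> * of_real (sin x)" "cis (- x) = of_real (cos x) - \<i> * of_real (sin x)" for x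
      by (simp_all add: complex_eq_iff)
    ultimately show ?thesis
      unfolding g_def B_def D_def JB_def JD_def H_reflect[OF that] psi_reflect[OF that] by (simp only:)
  qed
  \<comment> \<open>For n = 2s and r = s the phase vanishes and n - r = r, so the half-sum is the
    amplitude itself and the term occurs once, without the factor 2.\<close>
  have middle: "g (2 * s) z s = B (2 * s) s z" for s z
    by (simp add: g_def B_def JB_def psi_def flip: distrib_left)
  have even: "airy_tau C1 C2 (2 * s) (of_real z) = of_real (K_const (2 * s) * z powr (- (real s ^ 2))) *
         (B (2 * s) s z + 2 * (\<Sum>r = 0..s - 1.
            B (2 * s) r z * of_real (cos (psi (2 * s) r z)) + D (2 * s) r z * of_real (sin (psi (2 * s) r z))))"
    if s: "s \<ge> 1" and z: "z > 0" for s z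
  proof -
    have "(\<Sum>r\<le>2 * s. g (2 * s) z r) = B (2 * s) s z + (\<Sum>r = 0..s - 1. g (2 * s) z r + g (2 * s) z (2 * s - r))"
      unfolding sum_reflect_pairs(1)[OF s] middle ..
    also have "(\<Sum>r = 0..s - 1. g (2 * s) z r + g (2 * s) z (2 * s - r)) =
      (\<Sum>r = 0..s - 1. 2 * (B (2 * s) r z * of_real (cos (psi (2 * s) r z)) + D (2 * s) r z * of_real (sin (psi (2 * s) r z))))"
      by (intro sum.cong refl pair) auto
    finally have "(\<Sum>r\<le>2 * s. g (2 * s) z r) = B (2 * s) s z + 2 * (\<Sum>r = 0..s - 1.
            B (2 * s) r z * of_real (cos (psi (2 * s) r z)) + D (2 * s) r z * of_real (sin (psi (2 * s) r z)))"
      by (simp only: sum_distrib_left)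
    moreover have "real (2 * s) ^ 2 / 4 = real s ^ 2" by (simp add: power2_eq_square)
    ultimately show ?thesis unfolding tau[OF z] by (simp only:)
  qed
  have odd: "airy_tau C1 C2 (2 * s - 1) (of_real z) =
         of_real (2 * K_const (2 * s - 1) * z powr (- ((2 * real s - 1) ^ 2 / 4))) *
         (\<Sum>r = 0..s - 1.
            B (2 * s - 1) r z * of_real (cos (psi (2 * s - 1) r z)) + D (2 * s - 1) r z * of_real (sin (psi (2 * s - 1) r z)))"
    if s: "s \<ge> 1" and z: "z > 0" for s z
  proof -
    have "(\<Sum>r\<le>2 * s - 1. g (2 * s - 1) z r) = (\<Sum>r = 0..s - 1. g (2 * s - 1) z r + g (2 * s - 1) z (2 * s - 1 - r))"
      by (rule sum_reflect_pairs(2)[OF s])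
    also have "\<dots> = (\<Sum>r = 0..s - 1. 2 * (B (2 * s - 1) r z * of_real (cos (psi (2 * s - 1) r z)) + D (2 * s - 1) r z * of_real (sin (psi (2 * s - 1) r z))))"
      using s by (intro sum.cong refl pair) auto
    finally have sum: "(\<Sum>r\<le>2 * s - 1. g (2 * s - 1) z r) = 2 * (\<Sum>r = 0..s - 1.
            B (2 * s - 1) r z * of_real (cos (psi (2 * s - 1) r z)) + D (2 * s - 1) r z * of_real (sin (psi (2 * s - 1) r z)))"
      by (simp only: sum_distrib_left)
    have "real (2 * s - 1) = 2 * real s - 1" using s by (simp add: of_nat_diff)
    then show ?thesis unfolding tau[OF z] sum by (simp only: of_real_mult of_real_numeral mult_ac)
  qed
  have expansion_B: "poincare_expansion (B n r) (\<lambda>z. of_real (M_const n r * z powr (3/2 * real (r * (n - r))))) (b n r)" for n r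
    unfolding B_def[abs_def] b_def[abs_def] \<epsilon>_def H_def[abs_def]
    by (rule poincare_expansion_even[OF JB]) (simp add: aB_def a(2))
  have expansion_D: "poincare_expansion (D n r) (\<lambda>z. of_real (M_const n r * z powr (3/2 * real (r * (n - r))))) (d n r)" for n r
    unfolding D_def[abs_def] d_def[abs_def] \<epsilon>_def H_def[abs_def]
    by (rule poincare_expansion_even[OF JD]) (simp add: aD_def a(2))
  have leading: "b n r 0 = b_lead C1 C2 n r" "d n r 0 = d_lead C1 C2 n r" if "n \<ge> 1" "2 * r \<le> n" for n r
  proof -
    have r: "r \<le> n" "n - r \<le> n" using that by auto
    \<comment> \<open>The coefficient of order 0 is the value at \<epsilon> = 0, where the quotient
      in \<open>airy_amplitude\<close> is 1.\<close>
    have a0: "a n r 0 = (C2 - \<i> * C1) ^ (n - r) * (C2 + \<i> * C1) ^ r" if "r \<le> n" for r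
      using has_expansion_value_0[OF a(1)[of n r]] tau_coeff_0_nonzero[OF that] by (simp add: airy_amplitude_def)
    show "b n r 0 = b_lead C1 C2 n r" "d n r 0 = d_lead C1 C2 n r"
      unfolding lead_coeffs[OF r(1) that(1), symmetric]
      by (simp_all add: b_def d_def aB_def aD_def a0 r add_divide_distrib diff_divide_distrib right_diff_distrib)
  qed
  show ?thesis
    by (rule exI[of _ B], rule exI[of _ D], rule exI[of _ b], rule exI[of _ d], intro conjI allI impI; (elim conjE)?)
      (rule even odd expansion_B expansion_D leading; assumption)+
qed

end
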